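(* Let $\eta^6(4\tau)=\sum_{n\ge 1}a(n)q^n$ be the Fourier expansion of $\eta^6(4\tau)$, where $q=e^{2\pi i\tau}$. For any integer $n\ge 0$, $$A_{4,2}(n)=\frac{1}{32}\bigl(\sigma_{2,\chi_{4,2}}(4n+5)-a(4n+5)\bigr).$$
   Context: A partition is called $t$-core if none of its hook numbers (hook lengths) is a multiple of $t$ (the empty partition is $t$-core). A partition $k$-tuple of $n$ is an ordered $k$-tuple $(\lambda_1,\ldots,\lambda_k)$ of (possibly empty) partitions such that the sum of all the parts of all the $\lambda_i$ equals $n$. $A_{t,k}(n)$ denotes the number of partition $k$-tuples of $n$ in which each $\lambda_i$ is $t$-core. The Dedekind eta function is $\eta(\tau)=q^{1/24}\prod_{m\ge 1}(1-q^m)$ with $q=e^{2\pi i\tau}$, $\tau$ in the complex upper half plane, and $\eta^r(m\tau)$ means $(\eta(m\tau))^r$. $\chi_{4,2}$ is the Dirichlet character mod $4$ given by $\chi_{4,2}(n)=1$ if $n\equiv 1 \pmod 4$, $\chi_{4,2}(n)=-1$ if $n\equiv 3\pmod 4$, and $\chi_{4,2}(n)=0$ if $\gcd(n,4)>1$. For $n\ge 1$, $\sigma_{2,\chi_{4,2}}(n)=\sum_{d\mid n}\chi_{4,2}(d)d^2$, the sum being over positive divisors $d$ of $n$. *)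

theory Defs
  imports "HOL-Analysis.Analysis"
begin

text \<open>A partition is the list of its parts in weakly decreasing order; cells of its Young
  diagram are pairs (row, column), both counted from 0.\<close>

definition is_partition :: "nat list \<Rightarrow> bool" where
  "is_partition xs \<longleftrightarrow> sorted_wrt (\<ge>) xs \<and> (\<forall>x\<in>set xs. x > 0)"

definition young_diagram :: "nat list \<Rightarrow> (nat \<times> nat) set" where
  "young_diagram xs = {(i, j). i < length xs \<and> j < xs ! i}"

definition hook :: "nat list \<Rightarrow> nat \<times> nat \<Rightarrow> (nat \<times> nat) set" where
  "hook xs c = {(i, j) \<in> young_diagram xs.
     (i = fst c \<and> j \<ge> snd c) \<or> (j = snd c \<and> i \<ge> fst c)}"

definition hook_length :: "nat list \<Rightarrow> nat \<times> nat \<Rightarrow> nat" where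
  "hook_length xs c = card (hook xs c)"

definition is_core :: "nat \<Rightarrow> nat list \<Rightarrow> bool" where
  "is_core t xs \<longleftrightarrow> (\<forall>c\<in>young_diagram xs. \<not> t dvd hook_length xs c)"

definition is_partition_tuple :: "nat \<Rightarrow> nat \<Rightarrow> nat list list \<Rightarrow> bool" where
  "is_partition_tuple k n ls \<longleftrightarrow>
     length ls = k \<and> (\<forall>xs\<in>set ls. is_partition xs) \<and> (\<Sum>xs\<leftarrow>ls. sum_list xs) = n"

definition core_tuple_count :: "nat \<Rightarrow> nat \<Rightarrow> nat \<Rightarrow> nat" where
  "core_tuple_count t k n =
     card {ls. is_partition_tuple k n ls \<and> (\<forall>xs\<in>set ls. is_core t xs)}"

text \<open>The factor q^(1/24) means \<open>exp (2 \<pi> \<i> \<tau> / 24)\<close>,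
  not the principal root of q. Only values with \<open>Im \<tau> > 0\<close> are meaningful.\<close>

definition nome :: "complex \<Rightarrow> complex" where
  "nome \<tau> = exp (2 * of_real pi * \<i> * \<tau>)"

definition dedekind_eta :: "complex \<Rightarrow> complex" where
  "dedekind_eta \<tau> = nome (\<tau> / 24) * (\<Prod>m. 1 - nome \<tau> ^ Suc m)"

definition chi_4_2 :: "int \<Rightarrow> int" where
  "chi_4_2 n = (if n mod 4 = 1 then 1 else if n mod 4 = 3 then - 1 else 0)"

definition sigma_char :: "nat \<Rightarrow> (int \<Rightarrow> int) \<Rightarrow> nat \<Rightarrow> int" where
  "sigma_char r ch n = (\<Sum>d | d dvd n. ch (int d) * int d ^ r)"

end

theory Submission
  imports Defs
begin

text \<open>
  Throughout, \<open>\<phi>(q) = \<Sum> q^(n^2)\<close> over all integers \<open>n\<close>, \<open>\<psi>(q) = \<Sum> q^(n(n+1)/2)\<close> over \<open>n \<ge> 0\<close>, \<open>(q)\<close>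
  stands for the product of all \<open>1 - q^m\<close> with \<open>m \<ge> 1\<close>, and \<open>\<chi>\<close> for the character modulo 4.

  \<^emph>\<open>Counting cores.\<close> A partition is encoded by its beta numbers, a finite set of positive integers.
  The hook lengths in a row are the differences between its beta number and the smaller integers
  outside the set, so a partition is 4-core iff its set is closed under subtracting 4 where possible
  (\<open>is_core_iff_beta_set\<close>). Such a set consists of three runners of an abacus, and the size of the
  partition is a quadratic polynomial in the lengths of the runners. A change of variables
  diagonalises it, so that the 4-cores have the generating function \<open>\<psi>(q) \<psi>(q^2)^2\<close>
  (\<open>four_core_generating_function\<close>); pairs of 4-cores have its square.

  \<^emph>\<open>What remains.\<close> Put \<open>Q = x^4\<close>. Since \<open>\<eta>(4\<tau>)^6 = x (Q)^6\<close> for \<open>x = exp(2\<pi>i\<tau>)\<close>, the theorem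
  compares coefficients in \<open>\<Sum> \<sigma>(N) x^N = x (Q)^6 + 32 x^5 \<psi>(Q)^2 \<psi>(Q^2)^4\<close>, the sum being over
  \<open>N \<equiv> 1 (mod 4)\<close>. Gauss's product for \<open>\<psi>\<close> and elementary dissections of \<open>\<phi>\<close> and \<open>\<psi>\<close> give
  \<open>(Q)^6 = \<psi>(Q)^2 \<phi>(-Q)^4\<close> (\<open>euler_prod_power6\<close>), and the same dissections show that the right-hand
  side is the part of \<open>x \<psi>(x^4)^2 \<phi>(x^2)^4\<close> with exponents \<open>\<equiv> 1 (mod 4)\<close> (\<open>weighted_sech_filtered\<close>).
  So it is enough to prove \<open>\<Sum> x^N (\<Sum>d|N. \<chi>(N/d) d^2) = x \<psi>(x^4)^2 \<phi>(x^2)^4\<close>, summed over odd \<open>N\<close>: if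
  \<open>N \<equiv> 1 (mod 4)\<close> then \<open>\<chi>(N/d) = \<chi>(d)\<close>. This is a form of Jacobi's theorem on sums of six squares.

  \<^emph>\<open>Six squares from hyperbolic functions.\<close> With \<open>x = exp(-t)\<close>, the left-hand side is a quarter of
  \<open>\<Sum> c^2 / cosh(ct)\<close> over all odd integers \<open>c\<close>. The addition formulas write \<open>sech a sech b\<close> and
  \<open>sech a csch b\<close> as a function of \<open>a + b\<close> times a sum of two values of \<open>tanh\<close> or \<open>coth\<close>. Hence, in
  a product of two series of such terms, the terms with \<open>a + b\<close> fixed telescope, and the product is
  again a series of the same kind. Two such products yield
  \<open>\<Sum> c^2 sech(ct) = (\<Sum> sech(nt))^2 (\<Sum> sech(ct))\<close> with \<open>n\<close> even and \<open>c\<close> odd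
  (\<open>sech_odd_square_weights\<close>).

  \<^emph>\<open>Two squares.\<close> It remains to see that \<open>f(x) = \<Sum> sech(nt)\<close>, over all integers \<open>n\<close>, equals \<open>\<phi>(x)^2\<close>
  (\<open>sech_series_eq_phi_square\<close>): its even and odd parts are the two series on the right above. The
  square of \<open>f\<close> is computed by the same telescoping as a series in divisor sums (Jacobi's four
  squares series), from which \<open>f(x)^2 + f(-x)^2 = 4 f(x^2)^2 - 2 f(-x^2)^2\<close>. Moreover
  \<open>f(x) + f(-x) = 2 f(x^2)\<close>. Both equations also hold for \<open>\<phi>^2\<close>, and they determine all coefficients
  of a power series \<open>1 + 4x + \<dots>\<close> (\<open>functional_equations_determine_series\<close>).
\<close>

section \<open>Infinite sums\<close>

lemma has_sum_int_split:
  fixes f :: "int \<Rightarrow> 'a :: {topological_comm_monoid_add, t2_space}"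
  assumes "((\<lambda>n. f (int n)) has_sum a) UNIV" "((\<lambda>n. f (- int (Suc n))) has_sum b) UNIV"
  shows "(f has_sum (a + b)) UNIV"
proof -
  have 1: "(f has_sum a) {0..}"
    using assms(1) by (subst has_sum_reindex_bij_witness[of _ int nat "UNIV" "\<lambda>n. f (int n)" f a a]) auto
  have 2: "(f has_sum b) {..<0}"
    using assms(2)
    by (subst has_sum_reindex_bij_witness[of "{..<0}" "\<lambda>n. - int (Suc n)" "\<lambda>m. nat (- m - 1)"
          UNIV "\<lambda>n. f (- int (Suc n))" f b b]) auto
  have "(f has_sum (a + b)) ({0..} \<union> {..<0})"
    by (intro has_sum_Un_disjoint 1 2) auto
  moreover have "{0..} \<union> {..<0} = (UNIV :: int set)" by auto
  ultimately show ?thesis by simp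
qed

text \<open>
  Complex sums over arbitrary index sets converge absolutely, so the product is a double series that
  may afterwards be summed along any partition of the index set.
\<close>

lemma has_sum_times_complex:
  fixes f g :: "_ \<Rightarrow> complex"
  assumes f: "(f has_sum a) A" and g: "(g has_sum b) B"
  shows "((\<lambda>(i, j). f i * g j) has_sum (a * b)) (A \<times> B)"
proof -
  have nf: "(\<lambda>i. norm (f i)) summable_on A" and ng: "(\<lambda>i. norm (g i)) summable_on B"
    using f g summable_on_iff_abs_summable_on_complex by (blast dest: has_sum_imp_summable)+
  obtain c where c: "((\<lambda>j. norm (g j)) has_sum c) B" using ng by (auto simp: summable_on_def)
  have "(\<lambda>p. norm (f (fst p) * g (snd p))) summable_on A \<times> B"
    by (rule summable_on_SigmaI[where g = "\<lambda>i. norm (f i) * c"])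
       (auto simp: norm_mult intro!: has_sum_cmult_right[OF c] summable_on_cmult_left nf)
  then have s: "(\<lambda>(i, j). f i * g j) summable_on A \<times> B"
    using abs_summable_summable by (fastforce simp: case_prod_unfold)
  show ?thesis
    by (rule has_sum_SigmaI[where g = "\<lambda>i. f i * b"])
       (auto intro!: has_sum_cmult_right[OF g] has_sum_cmult_left[OF f] s)
qed

lemma summable_square_geometric:
  fixes r :: real assumes "0 \<le> r" "r < 1"
  shows "summable (\<lambda>n. (1 + real n ^ 2) * r ^ n)"
proof -
  have "(\<lambda>n. (1 + real n ^ 2) / (1 + real (Suc n) ^ 2)) \<longlonglongrightarrow> 1" by real_asymp
  then have "conv_radius (\<lambda>n. 1 + real n ^ 2) = 1"
    by (intro conv_radius_ratio_limit_nonzero[of _ 1]) (auto simp: one_ereal_def)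
  then show ?thesis using assms by (intro summable_in_conv_radius) (auto simp: one_ereal_def)
qed

lemma summable_int_square_geometric:
  fixes r :: real assumes "0 \<le> r" "r < 1"
  shows "(\<lambda>n::int. (1 + of_int n ^ 2) * r ^ nat \<bar>n\<bar>) summable_on UNIV"
proof -
  have s: "summable (\<lambda>n. (1 + real n ^ 2) * r ^ n)" by (rule summable_square_geometric[OF assms])
  have "(\<lambda>n. (1 + real n ^ 2) * r ^ n) summable_on UNIV"
    using s assms by (subst summable_on_UNIV_nonneg_real_iff) auto
  moreover have "(\<lambda>n. (1 + real (Suc n) ^ 2) * r ^ (Suc n)) summable_on UNIV"
    using s assms unfolding summable_Suc_iff[of "\<lambda>n. (1 + real n ^ 2) * r ^ n", symmetric]
    by (subst summable_on_UNIV_nonneg_real_iff) auto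
  ultimately obtain a b where
      "((\<lambda>n. (1 + real n ^ 2) * r ^ n) has_sum a) UNIV" "((\<lambda>n. (1 + real (Suc n) ^ 2) * r ^ (Suc n))
          has_sum b) UNIV"
    by (auto simp: summable_on_def)
  then have "((\<lambda>n::int. (1 + of_int n ^ 2) * r ^ nat \<bar>n\<bar>) has_sum (a + b)) UNIV"
    by (intro has_sum_int_split)
       (simp_all del: of_nat_Suc power_Suc)
  then show ?thesis by (rule has_sum_imp_summable)
qed

text \<open>
  The comparison series for all bilateral series below. The quadratic weight leaves room for the
  factors \<open>n\<close> and \<open>n^2\<close> that occur in front of the hyperbolic terms.
\<close>

lemma summable_int_geometric_bound:
  fixes f :: "int \<Rightarrow> complex"
  assumes "0 \<le> r" "r < 1" and b: "\<And>n. norm (f n) \<le> C * ((1 + of_int n ^ 2) * r ^ nat \<bar>n\<bar>)"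
  shows "f summable_on A"
proof -
  have "(\<lambda>n::int. C * ((1 + of_int n ^ 2) * r ^ nat \<bar>n\<bar>)) summable_on UNIV"
    by (intro summable_on_cmult_right summable_int_square_geometric assms)
  then have "(\<lambda>n. norm (f n)) summable_on UNIV"
    by (rule Infinite_Sum.abs_summable_on_comparison_test') (use b in auto)
  then have "f summable_on UNIV" by (rule Infinite_Sum.abs_summable_summable)
  then show ?thesis by (rule summable_on_subset) auto
qed

text \<open>
  The bilateral telescoping sum: a shift by \<open>k\<close> is a composition of \<open>k\<close> unit shifts, each of which
  contributes the total increase \<open>p - q\<close> of \<open>h\<close>.
\<close>

lemma telescoping_int:
  fixes h :: "int \<Rightarrow> complex"
  assumes s: "(\<lambda>i. h i - h (i - 1)) summable_on UNIV"
    and top: "(h \<longlongrightarrow> p) at_top" and bot: "(h \<longlongrightarrow> q) at_bot"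
  shows "((\<lambda>i. h i - h (i - k)) has_sum (of_int k * (p - q))) UNIV"
proof -
  have one: "((\<lambda>i. h i - h (i - 1)) has_sum (p - q)) UNIV"
  proof -
    have "(\<lambda>n. h (int n) - h (int n - 1)) summable_on UNIV"
      using summable_on_reindex[of int UNIV "\<lambda>i. h i - h (i - 1)"] summable_on_subset[OF s, of "range int"]
      by (auto simp: o_def)
    moreover have "(\<lambda>n. h (int n) - h (int n - 1)) sums (p - h (-1))"
    proof -
      have "(\<lambda>n. h (int n - 1)) \<longlonglongrightarrow> p"
        by (rule filterlim_compose[OF top]) real_asymp
      then have "(\<lambda>n. h (int (Suc n) - 1) - h (int n - 1)) sums (p - h (int 0 - 1))"
        by (rule telescope_sums)
      then show ?thesis by simp
    qed
    ultimately have 1: "((\<lambda>n. h (int n) - h (int n - 1)) has_sum (p - h (-1))) UNIV"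
      by (metis has_sum_imp_sums has_sum_infsum sums_unique2)
    have "(\<lambda>n. h (- int (Suc n)) - h (- int (Suc n) - 1)) summable_on UNIV"
      using summable_on_reindex[of "\<lambda>n. - int (Suc n)" UNIV "\<lambda>i. h i - h (i
          - 1)"] summable_on_subset[OF s, of "range (\<lambda>n. - int (Suc n))"]
      by (auto simp: o_def inj_def)
    moreover have "(\<lambda>n. h (- int (Suc n)) - h (- int (Suc n) - 1)) sums (h (-1) - q)"
    proof -
      have "(\<lambda>n. h (- int (Suc n))) \<longlonglongrightarrow> q"
        by (rule filterlim_compose[OF bot]) real_asymp
      from telescope_sums'[OF this] show ?thesis by (simp add: algebra_simps)
    qed
    ultimately have 2: "((\<lambda>n. h (- int (Suc n)) - h (- int (Suc n) - 1)) has_sum (h (-1) - q)) UNIV"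
      by (metis has_sum_imp_sums has_sum_infsum sums_unique2)
    from has_sum_int_split[of "\<lambda>i. h i - h (i - 1)", OF 1 2] show ?thesis by simp
  qed
  have shift: "((\<lambda>i. g (i + c)) has_sum S) UNIV \<longleftrightarrow> (g has_sum S) UNIV" for g :: "int \<Rightarrow> complex" and c S
    by (rule has_sum_reindex_bij_witness[of _ "\<lambda>i. i - c" "\<lambda>i. i + c"]) auto
  have nat: "((\<lambda>i. h i - h (i - int j)) has_sum (of_nat j * (p - q))) UNIV" for j
  proof (induction j)
    case (Suc j)
    have "((\<lambda>i. h (i - int j) - h (i - int j - 1)) has_sum (p - q)) UNIV"
      using one shift[of "\<lambda>i. h i - h (i - 1)" "- int j"] by simp
    from has_sum_add[OF Suc this] show ?case by (simp add: algebra_simps)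
  qed simp
  show ?thesis
  proof (cases "k \<ge> 0")
    case True then show ?thesis using nat[of "nat k"] by simp
  next
    case False
    have "((\<lambda>i. h i - h (i + k)) has_sum (of_int (-k) * (p - q))) UNIV"
      using nat[of "nat (-k)"] False by simp
    then have "((\<lambda>i. h (i - k) - h i) has_sum (of_int (-k) * (p - q))) UNIV"
      using shift[of "\<lambda>i. h i - h (i + k)" "-k"] by simp
    from has_sum_uminusI[OF this] show ?thesis by simp
  qed
qed

lemma has_sum_diff:
  fixes f g :: "'a \<Rightarrow> complex"
  assumes "(f has_sum a) A" "(g has_sum b) A"
  shows "((\<lambda>i. f i - g i) has_sum (a - b)) A"
  using has_sum_add[OF assms(1) has_sum_uminusI[OF assms(2)]] by simp

lemma even_has_sum_int:
  fixes F :: "int \<Rightarrow> complex"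
  assumes "\<And>n. F (- n) = F n" and "((\<lambda>n. F (int (Suc n))) has_sum S) UNIV"
  shows "(F has_sum (F 0 + 2 * S)) UNIV"
proof -
  have "((\<lambda>n. F (int n)) has_sum (F 0 + S)) UNIV"
  proof -
    have "((\<lambda>n. F (int n)) has_sum S) {1..}"
      by (rule iffD1[OF has_sum_reindex_bij_witness[where j = Suc and i = "\<lambda>n. n - 1"] assms(2)]) auto
    then have "((\<lambda>n. F (int n)) has_sum (F (int 0) + S)) (insert 0 {1..})" by (intro has_sum_insert) auto
    moreover have "insert 0 {1..} = (UNIV :: nat set)" by auto
    ultimately show ?thesis by simp
  qed
  moreover have "((\<lambda>n. F (- int (Suc n))) has_sum S) UNIV" using assms by (simp only:)
  ultimately have "(F has_sum (F 0 + S + S)) UNIV" by (rule has_sum_int_split)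
  then show ?thesis by (simp add: add.assoc)
qed

lemma has_sum_even_odd_int:
  fixes F :: "int \<Rightarrow> 'a :: {topological_comm_monoid_add, t2_space}"
  assumes "((\<lambda>n. F (2 * n)) has_sum S) UNIV" and "((\<lambda>n. F (2 * n + 1)) has_sum T) UNIV"
  shows "(F has_sum (S + T)) UNIV"
proof -
  have 0: "(F has_sum S) {n. even n}"
    by (rule iffD1[OF has_sum_reindex_bij_witness[where j = "\<lambda>n. 2 * n" and i
        = "\<lambda>n. n div 2"] assms(1)]) auto
  have 1: "(F has_sum T) {n. odd n}"
    by (rule iffD1[OF has_sum_reindex_bij_witness[where j = "\<lambda>n. 2 * n + 1" and i
        = "\<lambda>n. n div 2"] assms(2)]) auto
  have "(F has_sum (S + T)) ({n. even n} \<union> {n. odd n})"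
    by (intro has_sum_Un_disjoint 0 1) auto
  moreover have "{n. even n} \<union> {n. odd n} = (UNIV :: int set)" by auto
  ultimately show ?thesis by simp
qed

text \<open>
  Turns the coefficients that arise by collecting terms of weight 1 into cardinalities. For an
  infinite set both sides are 0 by convention.
\<close>

lemma infsum_one: "(\<Sum>\<^sub>\<infinity>i\<in>S. 1) = (of_nat (card S) :: complex)"
proof (cases "finite S")
  case False
  have "\<not> (\<lambda>i. 1 :: complex) summable_on S"
  proof
    assume "(\<lambda>i. 1 :: complex) summable_on S"
    then have s: "(\<lambda>i. 1 :: real) summable_on S"
      by (simp add: summable_on_iff_abs_summable_on_complex)
    obtain m where m: "infsum (\<lambda>i. 1 :: real) S < real m" using reals_Archimedean2 by blast
    obtain T where T: "T \<subseteq> S" "finite T" "card T = m" using infinite_arbitrarily_large[OF False] by blast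
    have "sum (\<lambda>i. 1 :: real) T \<le> infsum (\<lambda>i. 1) S"
      using T by (intro finite_sum_le_infsum s) auto
    then show False using m T by simp
  qed
  then show ?thesis using False by (simp add: infsum_not_exists)
qed simp

lemma norm_power_Suc_less_1: "norm (x::complex) < 1 \<Longrightarrow> norm (x ^ Suc k) < 1"
  unfolding norm_power by (rule le_less_trans[OF power_Suc_le_self]) auto

lemma geometric_has_sum:
  fixes y :: complex
  assumes "norm y < 1"
  shows "((\<lambda>j. y ^ Suc j) has_sum (y / (1 - y))) UNIV"
proof (rule norm_summable_imp_has_sum)
  show "(\<lambda>j. y ^ Suc j) sums (y / (1 - y))"
    using sums_mult[OF geometric_sums[OF assms], of y] by simp
  show "summable (\<lambda>j. norm (y ^ Suc j))"
    using assms summable_mult[OF summable_geometric[of "norm y"], of "norm y"]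
        by (simp add: norm_mult norm_power)
qed

lemma geometric_derivative_has_sum:
  fixes y :: complex
  assumes "norm y < 1"
  shows "((\<lambda>k. of_nat (Suc k) * y ^ Suc k) has_sum (y / (1 - y) ^ 2)) UNIV"
proof (rule norm_summable_imp_has_sum)
  have s: "(\<lambda>k. of_nat (Suc k) * z ^ Suc k) sums (z / (1 - z) ^ 2)" if "norm z < 1"
      for z :: "'a :: {real_normed_field, banach}"
    using sums_mult[OF geometric_deriv_sums[OF that], of z] by (simp add: mult_ac)
  show "(\<lambda>k. of_nat (Suc k) * y ^ Suc k) sums (y / (1 - y) ^ 2)" by (rule s[OF assms])
  show "summable (\<lambda>k. norm (of_nat (Suc k) * y ^ Suc k))"
    using sums_summable[OF s[of "norm y"]] assms
        by (simp add: norm_mult norm_power del: of_nat_Suc power_Suc)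
qed

section \<open>Beta numbers and cores\<close>

definition beta_num :: "nat list \<Rightarrow> nat \<Rightarrow> nat" where
  "beta_num xs i = xs ! i + (length xs - 1 - i)"

definition beta_set :: "nat list \<Rightarrow> nat set" where
  "beta_set xs = beta_num xs ` {..<length xs}"

text \<open>The \<open>j\<close>-th part of the conjugate partition.\<close>

definition column_length :: "nat list \<Rightarrow> nat \<Rightarrow> nat" where
  "column_length xs j = card {i. i < length xs \<and> j < xs ! i}"

lemma partition_nth_mono:
  assumes "is_partition xs" "i \<le> j" "j < length xs"
  shows "xs ! j \<le> xs ! i"
  using assms by (cases "i = j") (auto simp: is_partition_def sorted_wrt_iff_nth_less)

lemma partition_nth_pos: "is_partition xs \<Longrightarrow> i < length xs \<Longrightarrow> xs ! i > 0"
  by (auto simp: is_partition_def)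

lemma beta_num_strict_antimono:
  assumes "is_partition xs" "i < j" "j < length xs"
  shows "beta_num xs j < beta_num xs i"
  using partition_nth_mono[of xs i j] assms by (simp add: beta_num_def)

lemma inj_on_beta_num: "is_partition xs \<Longrightarrow> inj_on (beta_num xs) {..<length xs}"
  by (rule inj_onI) (metis beta_num_strict_antimono lessThan_iff less_irrefl linorder_neqE_nat)

lemma column_length_eq:
  assumes "is_partition xs"
  shows "{i. i < length xs \<and> j < xs ! i} = {..<column_length xs j}"
proof -
  let ?A = "{i. i < length xs \<and> j < xs ! i}"
  have fin: "finite ?A" by simp
  have down: "i' \<in> ?A" if "i \<in> ?A" "i' \<le> i" for i i'
    using that partition_nth_mono[OF assms, of i' i] by auto
  show ?thesis
  proof (cases "?A = {}")
    case True show ?thesis unfolding column_length_def True by simp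
  next
    case False
    have "?A = {..Max ?A}"
      using down[OF Max_in[OF fin False]] Max_ge[OF fin] by blast
    moreover from this have "card ?A = Suc (Max ?A)" by (metis card_atMost)
    ultimately show ?thesis unfolding column_length_def by (metis lessThan_Suc_atMost)
  qed
qed

lemma less_column_length_iff:
  assumes "is_partition xs"
  shows "i < column_length xs j \<longleftrightarrow> i < length xs \<and> j < xs ! i"
  using column_length_eq[OF assms, of j] by auto

lemma column_length_le: "is_partition xs \<Longrightarrow> column_length xs j \<le> length xs"
  using less_column_length_iff[of xs "length xs" j] by (meson less_irrefl not_le_imp_less)

text \<open>
  The number \<open>j + (length xs - column_length xs j)\<close> is a gap of the beta set that depends on the
  column only: the hook of a cell measures the distance from the beta number of its row down to the
  gap of its column. The next two lemmas show that the columns account for all gaps below a beta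
  number.
\<close>

lemma hook_length_eq:
  assumes p: "is_partition xs" and c: "(i, j) \<in> young_diagram xs"
  shows "hook_length xs (i, j) + (j + (length xs - column_length xs j)) = beta_num xs i"
proof -
  have ij: "i < length xs" "j < xs ! i" using c by (auto simp: young_diagram_def)
  have "hook xs (i, j) = {i} \<times> {j..<xs ! i} \<union> {Suc i..<column_length xs j} \<times> {j}"
    using ij by (auto simp: hook_def young_diagram_def less_column_length_iff[OF p])
  moreover have "card \<dots> = card ({i} \<times> {j..<xs ! i}) + card ({Suc i..<column_length xs j} \<times> {j})"
    by (rule card_Un_disjoint) auto
  ultimately have "hook_length xs (i, j) = (xs ! i - j) + (column_length xs j - Suc i)"
    by (simp add: hook_length_def)
  moreover have "i < column_length xs j" using ij less_column_length_iff[OF p] by simp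
  ultimately show ?thesis using ij column_length_le[OF p, of j] by (simp add: beta_num_def)
qed

lemma gap_notin_beta_set:
  assumes p: "is_partition xs"
  shows "j + (length xs - column_length xs j) \<notin> beta_set xs"
proof
  assume "j + (length xs - column_length xs j) \<in> beta_set xs"
  then obtain i where i: "i < length xs" "j + (length xs - column_length xs j) = beta_num xs i"
    by (auto simp: beta_set_def)
  then show False
    using less_column_length_iff[OF p, of i j] column_length_le[OF p, of j]
    by (cases "j < xs ! i") (auto simp: beta_num_def)
qed

text \<open>
  If \<open>r\<close> beta numbers exceed \<open>y\<close>, then \<open>y - (length xs - r)\<close> of the integers below \<open>y\<close> are gaps;
  this number is the column that belongs to \<open>y\<close>.
\<close>

lemma gap_exists:
  assumes p: "is_partition xs" and i: "i < length xs" and y: "y < beta_num xs i" "y \<notin> beta_set xs"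
  obtains j where "j < xs ! i" "y = j + (length xs - column_length xs j)"
proof -
  \<comment> \<open>the beta numbers decrease, so \<open>r\<close> is the number of those that exceed \<open>y\<close>\<close>
  define r where "r = (LEAST r. r = length xs \<or> beta_num xs r < y)"
  have r: "r = length xs \<or> beta_num xs r < y" unfolding r_def by (rule LeastI[of _ "length xs"]) simp
  have r_le: "r \<le> length xs" unfolding r_def by (rule Least_le) simp
  have before: "y < beta_num xs k" if "k < r" for k
  proof -
    have "\<not> (k = length xs \<or> beta_num xs k < y)" using that unfolding r_def by (rule not_less_Least)
    moreover have "beta_num xs k \<noteq> y" using that r_le y by (auto simp: beta_set_def)
    ultimately show ?thesis by linarith
  qed
  have after: "\<not> i \<ge> r"
    using r beta_num_strict_antimono[OF p, of r i] i y by (cases "r = i") auto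
  have len: "length xs - r \<le> y"
  proof (cases "r = length xs")
    case False
    then have rl: "r < length xs" "beta_num xs r < y" using r r_le by auto
    then show ?thesis using partition_nth_pos[OF p rl(1)] by (simp add: beta_num_def)
  qed simp
  define j where "j = y - (length xs - r)"
  have "k < column_length xs j \<longleftrightarrow> k < r" for k
  proof
    assume "k < r"
    have "j < xs ! (r - 1)"
      using before[of "r - 1"] \<open>k < r\<close> r_le len by (simp add: beta_num_def j_def)
    also have "xs ! (r - 1) \<le> xs ! k" using \<open>k < r\<close> r_le by (intro partition_nth_mono p) auto
    finally show "k < column_length xs j" using \<open>k < r\<close> r_le by (simp add: less_column_length_iff[OF p])
  next
    assume "k < column_length xs j"
    then have k: "k < length xs" "j < xs ! k" by (auto simp: less_column_length_iff[OF p])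
    show "k < r"
    proof (rule ccontr)
      assume "\<not> k < r"
      then have rl: "r < length xs" "beta_num xs r < y" using k r by auto
      have "xs ! k \<le> xs ! r" using \<open>\<not> k < r\<close> k by (intro partition_nth_mono p) auto
      then show False using rl k len by (simp add: beta_num_def j_def)
    qed
  qed
  then have col: "column_length xs j = r" by (metis less_irrefl linorder_neqE_nat)
  show thesis
  proof (rule that[of j])
    show "j < xs ! i" using after col less_column_length_iff[OF p, of i j] by simp
    show "y = j + (length xs - column_length xs j)" unfolding col using len by (simp add: j_def)
  qed
qed

text \<open>
  If \<open>b - t\<close> is missing for a beta number \<open>b\<close>, the cell that belongs to this gap has hook length
  \<open>t\<close>. Conversely, closure under one step of length \<open>t\<close> gives closure under all multiples of \<open>t\<close>, so
  no gap lies at such a distance below a beta number.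
\<close>

lemma is_core_iff_beta_set:
  assumes p: "is_partition xs" and t: "t > 0"
  shows "is_core t xs \<longleftrightarrow> (\<forall>b\<in>beta_set xs. t \<le> b \<longrightarrow> b - t \<in> beta_set xs)"
proof safe
  fix b assume core: "is_core t xs" and b: "b \<in> beta_set xs" "t \<le> b"
  then obtain i where i: "i < length xs" "b = beta_num xs i" by (auto simp: beta_set_def)
  show "b - t \<in> beta_set xs"
  proof (rule ccontr)
    assume "b - t \<notin> beta_set xs"
    then obtain j where j: "j < xs ! i" "b - t = j + (length xs - column_length xs j)"
      using gap_exists[OF p i(1), of "b - t"] i b t by auto
    have c: "(i, j) \<in> young_diagram xs" using i j by (simp add: young_diagram_def)
    have "hook_length xs (i, j) = t" using hook_length_eq[OF p c] i j b by linarith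
    then show False using core c by (auto simp: is_core_def)
  qed
next
  assume closed: "\<forall>b\<in>beta_set xs. t \<le> b \<longrightarrow> b - t \<in> beta_set xs"
  have iter: "b - t * k \<in> beta_set xs" if "b \<in> beta_set xs" "t * k \<le> b" for b k
    using that(2)
  proof (induction k)
    case (Suc k)
    then have "b - t * k \<in> beta_set xs" "t \<le> b - t * k" by auto
    with closed have "b - t * k - t \<in> beta_set xs" by blast
    then show ?case by (simp add: algebra_simps)
  qed (use that in simp)
  show "is_core t xs" unfolding is_core_def
  proof safe
    fix i j assume c: "(i, j) \<in> young_diagram xs" and "t dvd hook_length xs (i, j)"
    then obtain k where k: "hook_length xs (i, j) = t * k" by (auto simp: dvd_def)
    have "beta_num xs i \<in> beta_set xs" using c by (auto simp: beta_set_def young_diagram_def)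
    moreover have e: "t * k + (j + (length xs - column_length xs j)) = beta_num xs i"
      using hook_length_eq[OF p c] k by simp
    ultimately have "beta_num xs i - t * k \<in> beta_set xs" by (intro iter) auto
    moreover have "beta_num xs i - t * k = j + (length xs - column_length xs j)" using e by linarith
    ultimately show False using gap_notin_beta_set[OF p] by simp
  qed
qed

text \<open>
  The inverse of \<open>beta_set\<close>: the \<open>k\<close>-th smallest beta number, counted from 0, exceeds its part by
  \<open>k\<close>.
\<close>

definition partition_of_set :: "nat set \<Rightarrow> nat list" where
  "partition_of_set X = map (\<lambda>i. sorted_list_of_set X ! (card X - 1 - i) - (card X - 1 - i)) [0..<card X]"

lemma image_reflect_lessThan: "(\<lambda>k. n - 1 - k) ` {..<n} = {..<n :: nat}"
proof (intro equalityI subsetI)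
  fix k assume "k \<in> {..<n}"
  then show "k \<in> (\<lambda>k. n - 1 - k) ` {..<n}" by (intro image_eqI[of _ _ "n - 1 - k"]) auto
qed auto

lemma sorted_positive_nth:
  assumes "finite X" "0 \<notin> X" "k < card X"
  shows "k < sorted_list_of_set X ! k"
  using assms(3)
proof (induction k)
  case 0
  then have "sorted_list_of_set X ! 0 \<in> set (sorted_list_of_set X)" by (intro nth_mem) simp
  then show ?case using assms by (auto intro: gr0I)
next
  case (Suc k)
  have "sorted_list_of_set X ! k < sorted_list_of_set X ! Suc k"
    using strict_sorted_list_of_set[of X] Suc.prems by (simp add: sorted_wrt_iff_nth_less)
  with Suc show ?case by simp
qed

lemma
  assumes X: "finite X" "0 \<notin> X"
  shows is_partition_partition_of_set: "is_partition (partition_of_set X)"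
    and beta_set_partition_of_set: "beta_set (partition_of_set X) = X"
proof -
  let ?l = "sorted_list_of_set X" and ?n = "card X"
  have inc: "?l ! i < ?l ! j" if "i < j" "j < ?n" for i j
    using strict_sorted_list_of_set[of X] that by (simp add: sorted_wrt_iff_nth_less)
  have gap: "?l ! i - i \<le> ?l ! j - j" if "i \<le> j" "j < ?n" for i j
    using that
  proof (induction j)
    case (Suc j)
    show ?case
    proof (cases "i = Suc j")
      case False
      then have "?l ! i - i \<le> ?l ! j - j" using Suc by simp
      moreover have "?l ! j - j \<le> ?l ! Suc j - Suc j"
        using inc[of j "Suc j"] Suc.prems by simp
      ultimately show ?thesis by simp
    qed simp
  qed simp
  have len: "length (partition_of_set X) = ?n" by (simp add: partition_of_set_def)
  have nth: "partition_of_set X ! i = ?l ! (?n - 1 - i) - (?n - 1 - i)" if "i < ?n" for i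
    using that by (simp add: partition_of_set_def)
  have "partition_of_set X ! j \<le> partition_of_set X ! i" if "i < j" "j < ?n" for i j
    using that by (simp only: nth less_trans[OF that]) (rule gap, auto)
  moreover have "partition_of_set X ! i > 0" if "i < ?n" for i
    using that sorted_positive_nth[OF X, of "?n - 1 - i"] by (simp only: nth) simp
  ultimately show "is_partition (partition_of_set X)"
    by (auto simp: is_partition_def sorted_wrt_iff_nth_less len in_set_conv_nth)
  have "beta_num (partition_of_set X) i = ?l ! (?n - 1 - i)" if "i < ?n" for i
    using sorted_positive_nth[OF X, of "?n - 1 - i"] that by (simp add: beta_num_def partition_of_set_def)
  then have "beta_set (partition_of_set X) = (\<lambda>i. ?l ! (?n - 1 - i)) ` {..<?n}"
    unfolding beta_set_def by (intro image_cong) (auto simp: partition_of_set_def)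
  also have "\<dots> = (!) ?l ` {..<?n}"
    unfolding image_image[of "(!) ?l" "\<lambda>i. ?n - 1 - i", symmetric] image_reflect_lessThan ..
  also have "\<dots> = set ?l" by (auto simp: in_set_conv_nth image_iff)
  also have "\<dots> = X" using X by simp
  finally show "beta_set (partition_of_set X) = X" .
qed

lemma card_beta_set: "is_partition xs \<Longrightarrow> card (beta_set xs) = length xs"
  unfolding beta_set_def by (simp add: card_image inj_on_beta_num)

lemma zero_notin_beta_set: "is_partition xs \<Longrightarrow> 0 \<notin> beta_set xs"
  using partition_nth_pos by (fastforce simp: beta_set_def beta_num_def)

lemma partition_of_set_beta_set:
  assumes p: "is_partition xs"
  shows "partition_of_set (beta_set xs) = xs"
proof -
  let ?n = "length xs"
  define l where "l = map (\<lambda>k. beta_num xs (?n - 1 - k)) [0..<?n]"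
  have "sorted_wrt (<) l"
    using beta_num_strict_antimono[OF p] by (auto simp: l_def sorted_wrt_iff_nth_less)
  moreover have "set l = beta_set xs"
  proof -
    have "set l = beta_num xs ` (\<lambda>k. ?n - 1 - k) ` {..<?n}"
      by (simp add: l_def image_image atLeast0LessThan)
    then show ?thesis unfolding image_reflect_lessThan beta_set_def .
  qed
  ultimately have "sorted_list_of_set (beta_set xs) = l"
    by (metis finite_set sorted_list_of_set.idem_if_sorted_distinct strict_sorted_iff)
  then show ?thesis
    unfolding partition_of_set_def card_beta_set[OF p]
    by (intro nth_equalityI) (auto simp: l_def beta_num_def)
qed

lemma sum_beta_set:
  assumes p: "is_partition xs"
  shows "2 * \<Sum>(beta_set xs) = 2 * sum_list xs + length xs * (length xs - 1)"
proof -
  have "\<Sum>(beta_set xs) = (\<Sum>i<length xs. beta_num xs i)"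
    unfolding beta_set_def by (subst sum.reindex[OF inj_on_beta_num[OF p]]) simp
  also have "\<dots> = (\<Sum>i<length xs. xs ! i) + (\<Sum>i<length xs. length xs - 1 - i)"
    unfolding beta_num_def by (rule sum.distrib)
  also have "(\<Sum>i<length xs. xs ! i) = sum_list xs" by (simp add: sum_list_sum_nth atLeast0LessThan)
  also have "(\<Sum>i<length xs. length xs - 1 - i) = (\<Sum>i<length xs. i)"
    using sum.nat_diff_reindex[of "\<lambda>i. i" "length xs"] by simp
  also have "2 * (sum_list xs + (\<Sum>i<length xs. i)) = 2 * sum_list xs + length xs * (length xs - 1)"
  proof -
    have "2 * (\<Sum>i<n. i) = n * (n - 1)" for n :: nat
    proof (induction n)
      case (Suc n) then show ?case by (cases n) auto
    qed simp
    then show ?thesis by simp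
  qed
  finally show ?thesis .
qed

text \<open>
  An abacus with four runners. The runner of the multiples of 4 is empty because 0 is not a beta
  number of a list of positive parts.
\<close>

definition runners :: "nat \<times> nat \<times> nat \<Rightarrow> nat set" where
  "runners = (\<lambda>(a, b, c). (\<lambda>j. 4 * j + 1) ` {..<a} \<union> (\<lambda>j. 4 * j + 2) ` {..<b} \<union> (\<lambda>j. 4 * j + 3) ` {..<c})"

lemma mem_runners:
  "4 * j + 1 \<in> runners (a, b, c) \<longleftrightarrow> j < a" "4 * j + 2 \<in> runners (a, b, c) \<longleftrightarrow> j < b"
  "4 * j + 3 \<in> runners (a, b, c) \<longleftrightarrow> j < c" "4 * j \<notin> runners (a, b, c)"
  by (auto simp: runners_def) presburger+

lemma inj_runners: "inj runners"
proof (rule injI, clarsimp)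
  fix a b c a' b' c' assume "runners (a, b, c) = runners (a', b', c')"
  then have "j < a \<longleftrightarrow> j < a'" "j < b \<longleftrightarrow> j < b'" "j < c \<longleftrightarrow> j < c'" for j
    by (metis mem_runners(1), metis mem_runners(2), metis mem_runners(3))
  then show "a = a' \<and> b = b' \<and> c = c'" by (metis less_irrefl linorder_neqE_nat)
qed

lemma finite_runners: "finite (runners p)"
  by (auto simp: runners_def split: prod.split)

lemma card_sum_runners:
  "card (runners (a, b, c)) = a + b + c"
  "int (\<Sum>(runners (a, b, c))) = 2 * int a ^ 2 - int a + 2 * int b ^ 2 + 2 * int c ^ 2 + int c"
proof -
  let ?A = "(\<lambda>j. 4 * j + 1) ` {..<a}" and ?B = "(\<lambda>j. 4 * j + 2) ` {..<b}" and ?C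
      = "(\<lambda>j. 4 * j + 3) ` {..<c::nat}"
  have dj: "(?A \<union> ?B) \<inter> ?C = {}" "?A \<inter> ?B = {}" by auto presburger+
  have inj: "inj_on (\<lambda>j. 4 * j + r) S" for r :: nat and S by (auto simp: inj_on_def)
  have "card (?A \<union> ?B \<union> ?C) = card (?A \<union> ?B) + card ?C"
    by (intro card_Un_disjoint dj) simp_all
  also have "card (?A \<union> ?B) = card ?A + card ?B"
    by (intro card_Un_disjoint dj) simp_all
  finally show "card (runners (a, b, c)) = a + b + c"
    unfolding runners_def prod.case card_image[OF inj] card_lessThan .
  have s: "int (\<Sum>j<m. 4 * j + r) = 2 * int m ^ 2 - 2 * int m + int r * int m" for m r :: nat
    by (induction m) (auto simp: algebra_simps power2_eq_square)
  have "\<Sum>(?A \<union> ?B \<union> ?C) = \<Sum>(?A \<union> ?B) + \<Sum>?C"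
    by (intro sum.union_disjoint dj) simp_all
  also have "\<Sum>(?A \<union> ?B) = \<Sum>?A + \<Sum>?B"
    by (intro sum.union_disjoint dj) simp_all
  finally have total: "\<Sum>(runners (a, b, c)) = (\<Sum>j<a. 4 * j + 1) + (\<Sum>j<b. 4 * j + 2) + (\<Sum>j<c. 4 * j + 3)"
    unfolding runners_def prod.case sum.reindex[OF inj] o_def .
  show "int (\<Sum>(runners (a, b, c))) = 2 * int a ^ 2 - int a + 2 * int b ^ 2 + 2 * int c ^ 2 + int c"
    unfolding total of_nat_add s by simp
qed

lemma runners_closed:
  assumes "b \<in> runners p" "4 \<le> b"
  shows "b - 4 \<in> runners p"
proof -
  have "b - 4 \<in> (\<lambda>j. 4 * j + r) ` {..<m}" if "b \<in> (\<lambda>j. 4 * j + r) ` {..<m}" "r < 4" for r m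
  proof -
    from that(1) obtain j where j: "b = 4 * j + r" "j < m" by auto
    then show ?thesis using assms(2) that(2) by (intro image_eqI[of _ _ "j - 1"]) auto
  qed
  from this[of 1] this[of 2] this[of 3] show ?thesis
    using assms(1) unfolding runners_def by (auto split: prod.splits simp del: image_iff)
qed

lemma runners_surj:
  assumes X: "finite X" "0 \<notin> X" and closed: "\<And>b. b \<in> X \<Longrightarrow> 4 \<le> b \<Longrightarrow> b - 4 \<in> X"
  shows "\<exists>p. X = runners p"
proof -
  have ex: "\<exists>a. \<forall>j. 4 * j + r \<in> X \<longleftrightarrow> j < a" for r
  proof -
    have down: "4 * j + r \<in> X" if "4 * (j + d) + r \<in> X" for j d
      using that
    proof (induction d)
      case (Suc d)
      have "4 * (j + Suc d) + r - 4 = 4 * (j + d) + r" by simp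
      moreover have "4 * (j + Suc d) + r - 4 \<in> X" by (rule closed[OF Suc.prems]) simp
      ultimately show ?case using Suc.IH by (simp only:)
    qed simp
    have "finite ((\<lambda>j. 4 * j + r) -` X)" by (intro finite_vimageI X) (auto simp: inj_def)
    then obtain m where m: "4 * m + r \<notin> X" using infinite_UNIV_nat by (metis UNIV_eq_I vimageI)
    define a where "a = (LEAST m. 4 * m + r \<notin> X)"
    have a: "4 * a + r \<notin> X" unfolding a_def by (rule LeastI[of _ m]) (rule m)
    have "4 * j + r \<in> X \<longleftrightarrow> j < a" for j
    proof
      assume "4 * j + r \<in> X"
      then show "j < a" using a down[of a "j - a"] by (cases "j < a") auto
    next
      assume "j < a"
      then show "4 * j + r \<in> X" unfolding a_def using not_less_Least by blast
    qed
    then show ?thesis by blast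
  qed
  obtain a where a: "\<And>j. 4 * j + 1 \<in> X \<longleftrightarrow> j < a" using ex[of 1] by blast
  obtain b where b: "\<And>j. 4 * j + 2 \<in> X \<longleftrightarrow> j < b" using ex[of 2] by blast
  obtain c where c: "\<And>j. 4 * j + 3 \<in> X \<longleftrightarrow> j < c" using ex[of 3] by blast
  obtain z where z: "\<And>j. 4 * j + 0 \<in> X \<longleftrightarrow> j < z" using ex[of 0] by blast
  have z': "4 * j \<notin> X" for j using z[of 0] z[of j] X by auto
  have "n \<in> X \<longleftrightarrow> n \<in> runners (a, b, c)" for n
  proof -
    have "n = 4 * (n div 4) + n mod 4" by simp
    moreover have "n mod 4 = 0 \<or> n mod 4 = 1 \<or> n mod 4 = 2 \<or> n mod 4 = 3" by presburger
    ultimately obtain j where "n = 4 * j \<or> n = 4 * j + 1 \<or> n = 4 * j + 2 \<or> n = 4 * j + 3"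
        by (metis add.right_neutral)
    then show ?thesis using a b c z' mem_runners by metis
  qed
  then show ?thesis by blast
qed

definition core_of :: "nat \<times> nat \<times> nat \<Rightarrow> nat list" where
  "core_of p = partition_of_set (runners p)"

lemma bij_betw_core_of: "bij_betw core_of UNIV {xs. is_partition xs \<and> is_core 4 xs}"
proof -
  have z: "0 \<notin> runners p" for p using mem_runners(4)[of 0] by (cases p) auto
  note P = is_partition_partition_of_set[OF finite_runners z] beta_set_partition_of_set[OF finite_runners z]
  show ?thesis unfolding bij_betw_def
  proof
    show "inj core_of"
      by (rule injI) (metis P(2) core_of_def injD inj_runners)
    show "range core_of = {xs. is_partition xs \<and> is_core 4 xs}"
    proof safe
      fix p show "is_partition (core_of p)" unfolding core_of_def by (rule P)
      show "is_core 4 (core_of p)"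
        unfolding core_of_def using runners_closed[of _ p]
            by (subst is_core_iff_beta_set[OF P(1)]) (auto simp: P(2))
    next
      fix xs assume p: "is_partition xs" "is_core 4 xs"
      have "\<exists>p. beta_set xs = runners p"
        using p is_core_iff_beta_set[of xs 4]
            by (intro runners_surj zero_notin_beta_set) (auto simp: beta_set_def)
      then obtain q where "beta_set xs = runners q" by blast
      then have "xs = core_of q"
        using partition_of_set_beta_set[OF p(1)] by (simp add: core_of_def)
      then show "xs \<in> range core_of" by simp
    qed
  qed
qed

lemma sum_list_core_of:
  "2 * int (sum_list (core_of (a, b, c))) =
    2 * (2 * int a ^ 2 - int a + 2 * int b ^ 2 + 2 * int c ^ 2 + int c) - (int a + int b + int c)
        * (int a + int b + int c - 1)"
proof -
  let ?X = "runners (a, b, c)"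
  have z: "0 \<notin> ?X" using mem_runners(4)[of 0] by auto
  note P = is_partition_partition_of_set[OF finite_runners z] beta_set_partition_of_set[OF finite_runners z]
  have len: "length (core_of (a, b, c)) = a + b + c"
    by (simp add: core_of_def partition_of_set_def card_sum_runners)
  have "2 * \<Sum>?X = 2 * sum_list (core_of (a, b, c)) + (a + b + c) * (a + b + c - 1)"
    using sum_beta_set[OF P(1)] len by (simp add: P(2) core_of_def)
  from arg_cong[of _ _ int, OF this]
  have "2 * int (\<Sum>?X) = 2 * int (sum_list (core_of (a, b, c))) + int ((a + b + c) * (a + b + c - 1))"
    by (simp only: of_nat_add of_nat_mult[of 2] of_nat_numeral)
  moreover have "int ((a + b + c) * (a + b + c - 1))
      = (int a + int b + int c) * (int a + int b + int c - 1)"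
    by (cases "a + b + c = 0") (auto simp: of_nat_diff)
  ultimately show ?thesis unfolding card_sum_runners by linarith
qed

section \<open>Ramanujan's theta functions\<close>

text \<open>
  The series are evaluated at powers of \<open>x\<close> and their negatives only, which stay in the punctured
  unit disc. The origin is excluded because exponents of both signs occur.
\<close>

lemma unit_disc_power:
  fixes x :: complex
  assumes "x \<noteq> 0" "norm x < 1" "n > 0"
  shows "x ^ n \<noteq> 0" "norm (x ^ n) < 1" "- (x ^ n) \<noteq> 0" "norm (- (x ^ n)) < 1"
  using assms by (auto simp: norm_power power_less_one_iff)

lemma powi_summable:
  fixes x :: complex
  assumes x: "x \<noteq> 0" "norm x < 1" and e: "\<And>n. e n \<ge> \<bar>n\<bar> - 1"
  shows "(\<lambda>n. x powi e n) summable_on A"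
proof (rule summable_int_geometric_bound[of "norm x" _ "1 / norm x"])
  fix n
  have "norm (x powi e n) \<le> norm x powi (\<bar>n\<bar> - 1)"
    unfolding norm_power_int using e[of n] x by (intro power_int_decreasing) auto
  also have "\<dots> = 1 / norm x * norm x ^ nat \<bar>n\<bar>"
  proof -
    obtain N where "\<bar>n\<bar> = int N" by (metis abs_ge_zero nonneg_int_cases)
    then show ?thesis using x by (simp add: power_int_diff)
  qed
  also have "\<dots> \<le> 1 / norm x * ((1 + of_int n ^ 2) * norm x ^ nat \<bar>n\<bar>)"
    using x by (intro mult_left_mono mult_le_cancel_right1[THEN iffD2]) auto
  finally show "norm (x powi e n) \<le> 1 / norm x * ((1 + of_int n ^ 2) * norm x ^ nat \<bar>n\<bar>)" .
qed (use x in auto)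

text \<open>
  Triangular numbers with an integer index: negative indices repeat the values at the nonnegative
  ones.
\<close>

definition tri :: "int \<Rightarrow> int" where "tri n = n * (n + 1) div 2"

lemma two_tri: "2 * tri n = n * (n + 1)"
  by (simp add: tri_def)

lemma tri_reflect: "tri (- n - 1) = tri n"
  by (simp add: tri_def algebra_simps)

lemma abs_le_tri: "\<bar>n\<bar> - 1 \<le> tri n"
proof -
  have "2 * (\<bar>n\<bar> - 1) \<le> n * (n + 1)"
  proof (cases "n \<ge> 0")
    case True
    then have "n * (n + 1) - 2 * (\<bar>n\<bar> - 1) = n * (n - 1) + 2" by (simp add: algebra_simps)
    moreover have "n * (n - 1) \<ge> 0" using True by (cases "n = 0") auto
    ultimately show ?thesis by linarith
  next
    case False
    then have "n * (n + 1) - 2 * (\<bar>n\<bar> - 1) = (- n - 1) * (- n - 2)" by (simp add: algebra_simps)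
    moreover have "(- n - 1) * (- n - 2) \<ge> 0" using False by (cases "n = - 1") auto
    ultimately show ?thesis by linarith
  qed
  then show ?thesis unfolding two_tri[symmetric] by simp
qed

lemma abs_le_square: "\<bar>n\<bar> - 1 \<le> (n::int) ^ 2"
proof -
  have "0 \<le> (2 * \<bar>n\<bar> - 1) ^ 2" by simp
  then show ?thesis by (simp add: power2_diff)
qed

definition phi :: "complex \<Rightarrow> complex" where
  "phi x = (\<Sum>\<^sub>\<infinity>n::int. x powi (n ^ 2))"

definition psi :: "complex \<Rightarrow> complex" where
  "psi x = (\<Sum>\<^sub>\<infinity>n::nat. x ^ (n * (n + 1) div 2))"

lemma has_sum_phi:
  assumes "x \<noteq> 0" "norm x < 1"
  shows "((\<lambda>n. x powi (n ^ 2)) has_sum phi x) UNIV"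
  unfolding phi_def by (intro has_sum_infsum powi_summable assms abs_le_square)

lemma powi_tri_of_nat: "x powi tri (int n) = x ^ (n * (n + 1) div 2)"
proof -
  have "tri (int n) = int (n * (n + 1) div 2)"
    by (simp add: tri_def zdiv_int algebra_simps)
  then show ?thesis by (simp only: power_int_of_nat)
qed

lemma has_sum_psi:
  assumes x: "x \<noteq> 0" "norm x < 1"
  shows "((\<lambda>n. x ^ (n * (n + 1) div 2)) has_sum psi x) UNIV"
proof -
  have "(\<lambda>n. x powi tri n) summable_on range int"
    by (intro powi_summable x abs_le_tri)
  then have "(\<lambda>n. x powi tri (int n)) summable_on UNIV"
    by (subst (asm) summable_on_reindex) (auto simp: o_def)
  then show ?thesis unfolding powi_tri_of_nat psi_def by (rule has_sum_infsum)
qed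

lemma has_sum_psi_int:
  assumes x: "x \<noteq> 0" "norm x < 1"
  shows "((\<lambda>n. x powi tri n) has_sum (2 * psi x)) UNIV"
proof -
  have "((\<lambda>n. x powi tri n) has_sum (psi x + psi x)) UNIV"
  proof (rule has_sum_int_split)
    show "((\<lambda>n. x powi tri (int n)) has_sum psi x) UNIV"
      unfolding powi_tri_of_nat by (rule has_sum_psi[OF x])
    moreover have "tri (- int (Suc n)) = tri (int n)" for n
    proof -
      have "- int (Suc n) = - int n - 1" by simp
      then show ?thesis using tri_reflect[of "int n"] by (simp only:)
    qed
    ultimately show "((\<lambda>n. x powi tri (- int (Suc n))) has_sum psi x) UNIV" by simp
  qed
  then show ?thesis by simp
qed

text \<open>
  The pairs \<open>(u + v, u - v)\<close> are those with even coordinate sum, and \<open>(u + v + 1, u - v)\<close> runs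
  through the others. All theta function identities below come from this change of variables, which
  turns \<open>m^2 + n^2\<close> into \<open>2 u^2 + 2 v^2\<close>.
\<close>

lemma has_sum_parity_lattice:
  fixes F :: "int \<times> int \<Rightarrow> 'a :: {topological_comm_monoid_add, t2_space}"
  assumes "((\<lambda>(u, v). F (u + v, u - v)) has_sum S) UNIV"
    and "((\<lambda>(u, v). F (u + v + 1, u - v)) has_sum T) UNIV"
  shows "(F has_sum (S + T)) UNIV"
proof -
  have 0: "(F has_sum S) {(m, n). even (m + n)}"
    by (rule iffD1[OF has_sum_reindex_bij_witness[where j = "\<lambda>(u, v). (u + v, u - v)"
          and i = "\<lambda>(m, n). ((m + n) div 2, (m - n) div 2)"] assms(1)]) (auto elim!: evenE, presburger+)
  have 1: "(F has_sum T) {(m, n). odd (m + n)}"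
    by (rule iffD1[OF has_sum_reindex_bij_witness[where j = "\<lambda>(u, v). (u + v + 1, u - v)"
          and i = "\<lambda>(m, n). ((m + n - 1) div 2, (m - n
              - 1) div 2)"] assms(2)]) (auto elim!: oddE, presburger+)
  have "(F has_sum (S + T)) ({(m, n). even (m + n)} \<union> {(m, n). odd (m + n)})"
    by (intro has_sum_Un_disjoint 0 1) auto
  moreover have "{(m, n). even (m + n)} \<union> {(m, n). odd (m + n)} = (UNIV :: (int \<times> int) set)" by auto
  ultimately show ?thesis by simp
qed

lemma powi_lattice_even:
  fixes x :: complex
  assumes "x \<noteq> 0"
  shows "(x ^ 2) powi (u ^ 2) * (x ^ 2) powi (v ^ 2) = x powi ((u + v) ^ 2) * x powi ((u - v) ^ 2)"
proof -
  have "2 * u ^ 2 + 2 * v ^ 2 = (u + v) ^ 2 + (u - v) ^ 2"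
    by (simp add: power2_eq_square algebra_simps)
  then show ?thesis unfolding power_int_power using assms by (simp flip: power_int_add)
qed

lemma powi_lattice_odd:
  fixes x :: complex
  assumes "x \<noteq> 0"
  shows "x * ((x ^ 4) powi tri u * (x ^ 4) powi tri v) = x powi ((u + v + 1) ^ 2) * x powi ((u - v) ^ 2)"
proof -
  have "x * ((x ^ 4) powi tri u * (x ^ 4) powi tri v) = x powi (1 + (4 * tri u + 4 * tri v))"
    unfolding power_int_power using assms by (simp add: power_int_add)
  moreover have "1 + (4 * tri u + 4 * tri v) = (u + v + 1) ^ 2 + (u - v) ^ 2"
    using two_tri[of u] two_tri[of v] by (simp add: power2_eq_square algebra_simps)
  ultimately show ?thesis using assms by (simp add: power_int_add)
qed

lemma phi_square:
  assumes x: "x \<noteq> 0" "norm x < 1"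
  shows "phi x ^ 2 = phi (x ^ 2) ^ 2 + 4 * x * psi (x ^ 4) ^ 2"
proof -
  let ?F = "\<lambda>(m, n). x powi (m ^ 2) * x powi (n ^ 2)"
  have 0: "((\<lambda>(u, v). ?F (u + v, u - v)) has_sum (phi (x ^ 2) * phi (x ^ 2))) UNIV"
  proof -
    have "((\<lambda>(u, v). (x ^ 2) powi (u ^ 2) * (x ^ 2) powi (v ^ 2))
        has_sum (phi (x ^ 2) * phi (x ^ 2))) (UNIV \<times> UNIV)"
      by (intro has_sum_times_complex has_sum_phi unit_disc_power x) simp_all
    then show ?thesis by (simp add: powi_lattice_even[OF x(1)])
  qed
  have 1: "((\<lambda>(u, v). ?F (u + v + 1, u - v)) has_sum (x * (2 * psi (x ^ 4) * (2 * psi (x ^ 4))))) UNIV"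
  proof -
    have "((\<lambda>p. x * (case p of (u, v) \<Rightarrow> (x ^ 4) powi tri u * (x ^ 4) powi tri v)) has_sum
        (x * (2 * psi (x ^ 4) * (2 * psi (x ^ 4))))) (UNIV \<times> UNIV)"
      by (intro has_sum_cmult_right has_sum_times_complex has_sum_psi_int unit_disc_power x) simp_all
    then show ?thesis by (simp add: powi_lattice_odd[OF x(1)] case_prod_unfold)
  qed
  have "(?F has_sum (phi x * phi x)) (UNIV \<times> UNIV)"
    by (intro has_sum_times_complex has_sum_phi x)
  with has_sum_parity_lattice[OF 0 1]
  have "phi x * phi x = phi (x ^ 2) * phi (x ^ 2) + x * (2 * psi (x ^ 4) * (2 * psi (x ^ 4)))"
    using has_sum_unique by fastforce
  then show ?thesis by (simp add: power2_eq_square)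
qed

lemma minus_powi_square: "(- x) powi (n ^ 2) = (if even n then 1 else -1) * x powi (n ^ 2)"
  for x :: complex
  by (simp add: power_int_minus_left)

text \<open>
  On the pairs with odd sum the sign \<open>(-1)^(u - v)\<close> factors, and each factor vanishes because
  \<open>u \<mapsto> -1 - u\<close> preserves triangular numbers and changes the parity of \<open>u\<close>.
\<close>

lemma phi_times_phi_minus:
  assumes x: "x \<noteq> 0" "norm x < 1"
  shows "phi x * phi (- x) = phi (- (x ^ 2)) ^ 2"
proof -
  let ?F = "\<lambda>(m, n). x powi (m ^ 2) * (- x) powi (n ^ 2)"
  have 0: "((\<lambda>(u, v). ?F (u + v, u - v)) has_sum (phi (- (x ^ 2)) * phi (- (x ^ 2)))) UNIV"
  proof -
    have "((\<lambda>(u, v). (- (x ^ 2)) powi (u ^ 2) * (- (x ^ 2)) powi (v ^ 2))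
        has_sum (phi (- (x ^ 2)) * phi (- (x ^ 2)))) (UNIV \<times> UNIV)"
      by (intro has_sum_times_complex has_sum_phi unit_disc_power x) simp_all
    moreover have "(- (x ^ 2)) powi (u ^ 2) * (- (x ^ 2)) powi (v ^ 2)
        = x powi ((u + v) ^ 2) * (- x) powi ((u - v) ^ 2)" for u v
      unfolding minus_powi_square using powi_lattice_even[OF x(1), of u v] by auto
    ultimately show ?thesis by simp
  qed
  have 1: "((\<lambda>(u, v). ?F (u + v + 1, u - v)) has_sum 0) UNIV"
  proof -
    let ?g = "\<lambda>u. (if even u then 1 else -1) * (x ^ 4) powi tri u"
    have g: "(?g has_sum 0) UNIV"
    proof -
      have "(\<lambda>u. norm (?g u)) summable_on UNIV"
      proof -
        have "norm (?g u) = norm ((x ^ 4) powi tri u)" for u by simp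
        moreover have "(\<lambda>u. norm ((x ^ 4) powi tri u)) summable_on UNIV"
          using powi_summable[of "x ^ 4" tri UNIV] unit_disc_power[OF x, of 4] abs_le_tri
          by (simp add: summable_on_iff_abs_summable_on_complex)
        ultimately show ?thesis by (simp only:)
      qed
      then have "?g summable_on UNIV" by (rule Infinite_Sum.abs_summable_summable)
      then obtain z where z: "(?g has_sum z) UNIV" by (auto simp: summable_on_def)
      have "((\<lambda>u. ?g (- u - 1)) has_sum z) UNIV"
        by (rule iffD2[OF has_sum_reindex_bij_witness[where j = "\<lambda>u. - u - 1" and i
            = "\<lambda>u. - u - 1"] z]) auto
      moreover have "?g (- u - 1) = - ?g u" for u by (auto simp: tri_reflect)
      ultimately have "((\<lambda>u. - ?g u) has_sum z) UNIV" by simp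
      with has_sum_uminusI[OF z] have "z = - z" by (metis has_sum_unique)
      then show ?thesis using z by simp
    qed
    have "((\<lambda>p. x * (case p of (u, v) \<Rightarrow> ?g u * ?g v)) has_sum (x * (0 * 0))) (UNIV \<times> UNIV)"
      by (intro has_sum_cmult_right has_sum_times_complex g)
    moreover have "x * (?g u * ?g v) = x powi ((u + v + 1) ^ 2) * (- x) powi ((u - v) ^ 2)" for u v
      unfolding minus_powi_square using powi_lattice_odd[OF x(1), of u v] by auto
    ultimately show ?thesis by (simp add: case_prod_unfold)
  qed
  have "(?F has_sum (phi x * phi (- x))) (UNIV \<times> UNIV)"
    by (intro has_sum_times_complex has_sum_phi) (use x in auto)
  with has_sum_parity_lattice[OF 0 1]
  have "phi x * phi (- x) = phi (- (x ^ 2)) * phi (- (x ^ 2)) + 0"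
    using has_sum_unique by fastforce
  then show ?thesis by (simp add: power2_eq_square)
qed

lemma psi_square:
  assumes x: "x \<noteq> 0" "norm x < 1"
  shows "psi x ^ 2 = phi x * psi (x ^ 2)"
proof -
  let ?F = "\<lambda>(m, n). x powi tri m * x powi tri n"
  have 0: "((\<lambda>(u, v). ?F (u + v, u - v)) has_sum (2 * psi (x ^ 2) * phi x)) UNIV"
  proof -
    have "((\<lambda>(u, v). (x ^ 2) powi tri u * x powi (v ^ 2)) has_sum (2 * psi (x ^ 2) * phi x)) (UNIV \<times> UNIV)"
      by (intro has_sum_times_complex has_sum_psi_int has_sum_phi unit_disc_power x) simp_all
    moreover have "(x ^ 2) powi tri u * x powi (v ^ 2) = x powi tri (u + v) * x powi tri (u - v)" for u v
    proof -
      have "2 * tri u + v ^ 2 = tri (u + v) + tri (u - v)"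
        using two_tri[of u] two_tri[of "u + v"] two_tri[of "u - v"]
            by (simp add: power2_eq_square algebra_simps)
      then show ?thesis unfolding power_int_power using x by (simp flip: power_int_add)
    qed
    ultimately show ?thesis by simp
  qed
  have 1: "((\<lambda>(u, v). ?F (u + v + 1, u - v)) has_sum (phi x * (2 * psi (x ^ 2)))) UNIV"
  proof -
    have "((\<lambda>u. x powi ((u + 1) ^ 2)) has_sum phi x) UNIV"
      by (rule iffD2[OF has_sum_reindex_bij_witness[where j = "\<lambda>u. u + 1" and i
          = "\<lambda>u. u - 1"] has_sum_phi[OF x]]) auto
    then have "((\<lambda>(u, v). x powi ((u + 1) ^ 2) * (x ^ 2) powi tri v)
        has_sum (phi x * (2 * psi (x ^ 2)))) (UNIV \<times> UNIV)"
      by (intro has_sum_times_complex has_sum_psi_int unit_disc_power x) simp_all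
    moreover have "x powi ((u + 1) ^ 2) * (x ^ 2) powi tri v
        = x powi tri (u + v + 1) * x powi tri (u - v)" for u v
    proof -
      have "(u + 1) ^ 2 + 2 * tri v = tri (u + v + 1) + tri (u - v)"
        using two_tri[of v] two_tri[of "u + v + 1"] two_tri[of "u - v"]
            by (simp add: power2_eq_square algebra_simps)
      then show ?thesis unfolding power_int_power using x by (simp flip: power_int_add)
    qed
    ultimately show ?thesis by simp
  qed
  have "(?F has_sum (2 * psi x * (2 * psi x))) (UNIV \<times> UNIV)"
    by (intro has_sum_times_complex has_sum_psi_int x)
  with has_sum_parity_lattice[OF 0 1]
  have "2 * psi x * (2 * psi x) = 2 * psi (x ^ 2) * phi x + phi x * (2 * psi (x ^ 2))"
    using has_sum_unique by fastforce
  then show ?thesis by (simp add: power2_eq_square)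
qed

section \<open>The generating function of the 4-cores\<close>

text \<open>
  The product \<open>d (d + 1)\<close> has the same value at \<open>d\<close> and at \<open>-1 - d\<close>. Folding identifies the two;
  since they have opposite parity, \<open>d\<close> can be recovered from its parity.
\<close>

definition fold_int :: "int \<Rightarrow> nat" where
  "fold_int d = (if d \<ge> 0 then nat d else nat (- d - 1))"

text \<open>The preimage of \<open>f\<close> under folding that has the parity of \<open>s\<close>.\<close>

definition unfold_int :: "int \<Rightarrow> nat \<Rightarrow> int" where
  "unfold_int s f = (if even (int f - s) then int f else - int f - 1)"

text \<open>
  For runner lengths \<open>a, b, c\<close> the first free positions on the four runners are \<open>0\<close>, \<open>4a+1\<close>, \<open>4b+2\<close>,
  \<open>4c+3\<close>; the size of the partition is determined by their distances from their mean. Up to scaling,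
  the coordinates are the difference between the sums of the pairs \<open>{0, 4b+2}\<close> and \<open>{4a+1, 4c+3}\<close>,
  and the differences within the pairs. An odd number of beta numbers exchanges the two pairs when
  the positions are shifted to a fixed mean, whence the two cases.
\<close>

definition to_lattice :: "nat \<times> nat \<times> nat \<Rightarrow> int \<times> nat \<times> nat" where
  "to_lattice = (\<lambda>(a, b, c). if even (a + b + c)
     then ((int b - int a - int c) div 2, b, fold_int (int c - int a))
     else ((int a + int c + 1 - int b) div 2, fold_int (int c - int a), b))"

text \<open>
  The pair that contains the smallest of the four positions is the pair of runners \<open>0\<close> and \<open>b\<close>; this
  decides between the two cases of \<open>to_lattice\<close>.
\<close>

definition of_lattice :: "int \<times> nat \<times> nat \<Rightarrow> nat \<times> nat \<times> nat" where
  "of_lattice = (\<lambda>(k, m, n).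
     let (s, b, f) = (if int n \<le> int m - 2 * k then (int m - 2 * k, m, n) else (2 * k - 1 + int n, n, m));
         d = unfold_int s f
     in (nat ((s - d) div 2), b, nat ((s + d) div 2)))"

lemma fold_int_le: "\<bar>d\<bar> \<le> s \<Longrightarrow> even (d - s) \<Longrightarrow> int (fold_int d) \<le> s"
  by (auto simp: fold_int_def)

lemma unfold_fold_int:
  assumes "even (d - s)"
  shows "unfold_int s (fold_int d) = d"
proof -
  have "int (fold_int d) = (if d \<ge> 0 then d else - d - 1)" by (simp add: fold_int_def)
  then show ?thesis unfolding unfold_int_def using assms by auto
qed

lemma fold_unfold_int: "fold_int (unfold_int s f) = f"
  by (auto simp: fold_int_def unfold_int_def)

lemma unfold_int_parity: "even (unfold_int s f - s)"
  by (auto simp: unfold_int_def)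

lemma unfold_int_le: "int f \<le> s \<Longrightarrow> \<bar>unfold_int s f\<bar> \<le> s"
  unfolding unfold_int_def by presburger

lemma of_lattice_to_lattice: "of_lattice (to_lattice p) = p"
proof -
  obtain a b c where p: "p = (a, b, c)" by (cases p)
  define s d where "s = int a + int c" and "d = int c - int a"
  have sd: "\<bar>d\<bar> \<le> s" "even (d - s)" by (auto simp: s_def d_def)
  have ac: "nat ((s - d) div 2) = a" "nat ((s + d) div 2) = c" by (auto simp: s_def d_def)
  note le = fold_int_le[OF sd] and un = unfold_fold_int[OF sd(2)]
  show ?thesis
  proof (cases "even (a + b + c)")
    case True
    define k where "k = (int b - int a - int c) div 2"
    have k: "int b - 2 * k = s" using True by (simp add: k_def s_def) presburger
    have "to_lattice p = (k, b, fold_int d)" using True by (simp add: p to_lattice_def k_def d_def)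
    then show ?thesis using le k by (simp add: of_lattice_def Let_def un ac p)
  next
    case False
    define k where "k = (int a + int c + 1 - int b) div 2"
    have k: "2 * k - 1 + int b = s" using False by (simp add: k_def s_def) presburger
    have "to_lattice p = (k, fold_int d, b)" using False by (simp add: p to_lattice_def k_def d_def)
    moreover have "\<not> int b \<le> int (fold_int d) - 2 * k" using le k by linarith
    ultimately show ?thesis using k by (simp add: of_lattice_def Let_def un ac p)
  qed
qed

lemma to_lattice_of_lattice: "to_lattice (of_lattice q) = q"
proof -
  obtain k m n where q: "q = (k, m, n)" by (cases q)
  have *: "\<exists>a c. of_lattice q = (a, b, c) \<and> int a + int c = s \<and> fold_int (int c - int a) = f"
    if "(if int n \<le> int m - 2 * k then (int m - 2 * k, m, n) else (2 * k - 1 + int n, n, m))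
        = (s, b, f)" for s b f
  proof -
    define d where "d = unfold_int s f"
    have f: "int f \<le> s" using that by (auto split: if_splits)
    have ds: "even (d - s)" "\<bar>d\<bar> \<le> s" unfolding d_def by (intro unfold_int_parity unfold_int_le f)+
    then have "int (nat ((s - d) div 2)) + int (nat ((s + d) div 2)) = s"
      "int (nat ((s + d) div 2)) - int (nat ((s - d) div 2)) = d" by auto presburger+
    moreover have "of_lattice q = (nat ((s - d) div 2), b, nat ((s + d) div 2))"
      using that by (simp add: q of_lattice_def d_def Let_def)
    moreover have "fold_int d = f" unfolding d_def by (rule fold_unfold_int)
    ultimately show ?thesis by metis
  qed
  show ?thesis
  proof (cases "int n \<le> int m - 2 * k")
    case True
    then obtain a c where ac: "of_lattice q = (a, m, c)" "int a + int c
        = int m - 2 * k" "fold_int (int c - int a) = n"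
      using *[of "int m - 2 * k" m n] by auto
    have "even (a + m + c)" "(int m - int a - int c) div 2 = k" using ac(2) by presburger+
    then show ?thesis using ac by (simp add: to_lattice_def q)
  next
    case False
    then obtain a c where ac: "of_lattice q = (a, n, c)" "int a + int c
        = 2 * k - 1 + int n" "fold_int (int c - int a) = m"
      using *[of "2 * k - 1 + int n" n m] by auto
    have "odd (a + n + c)" "(int a + int c + 1 - int n) div 2 = k" using ac(2) by presburger+
    then show ?thesis using ac by (simp add: to_lattice_def q)
  qed
qed

lemma fold_int_square: "int (fold_int d) * (int (fold_int d) + 1) = d * (d + 1)"
  by (auto simp: fold_int_def algebra_simps)

lemma size_to_lattice:
  assumes "to_lattice (a, b, c) = (k, m, n)"
  shows "int (sum_list (core_of (a, b, c))) = 2 * k ^ 2 - k + int m * (int m + 1) + int n * (int n + 1)"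
proof -
  define d where "d = int c - int a"
  have "2 * int (sum_list (core_of (a, b, c)))
      = 2 * (2 * k ^ 2 - k + int m * (int m + 1) + int n * (int n + 1))"
  proof (cases "even (a + b + c)")
    case True
    then have e: "k = (int b - int a - int c) div 2" "m = b" "n = fold_int d" using assms
        by (auto simp: to_lattice_def d_def)
    have b: "int b = int a + int c + 2 * k" using True unfolding e(1) by presburger
    show ?thesis unfolding sum_list_core_of e(3) fold_int_square unfolding e(2) d_def b
      by (simp add: power2_eq_square algebra_simps)
  next
    case False
    then have e: "k = (int a + int c + 1 - int b) div 2" "m = fold_int d" "n = b" using assms
        by (auto simp: to_lattice_def d_def)
    have b: "int b = int a + int c + 1 - 2 * k" using False unfolding e(1) by presburger
    show ?thesis unfolding sum_list_core_of e(2) fold_int_square unfolding e(3) d_def b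
      by (simp add: power2_eq_square algebra_simps)
  qed
  then show ?thesis by simp
qed

lemma has_sum_psi_index_int:
  assumes x: "x \<noteq> 0" "norm x < 1"
  shows "((\<lambda>k. x powi (2 * k ^ 2 - k)) has_sum psi x) UNIV"
proof -
  have "((\<lambda>n. x powi tri (int n)) has_sum psi x) UNIV"
    unfolding powi_tri_of_nat by (rule has_sum_psi[OF x])
  then show ?thesis
  proof (rule iffD2[OF has_sum_reindex_bij_witness[where
      j = "\<lambda>k. if k \<ge> 1 then nat (2 * k - 1) else nat (- 2 * k)" and
      i = "\<lambda>n. if even n then - int (n div 2) else int (n div 2) + 1"], rotated -1])
    fix k :: int
    have "tri (int (if k \<ge> 1 then nat (2 * k - 1) else nat (- 2 * k))) = 2 * k ^ 2 - k"
      using two_tri[of "int (if k \<ge> 1 then nat (2 * k - 1) else nat (- 2 * k))"]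
      by (auto simp: power2_eq_square algebra_simps split: if_splits)
    then show "x powi tri (int (if k \<ge> 1 then nat (2 * k - 1) else nat (- 2 * k))) = x powi (2 * k ^ 2 - k)"
      by simp
  next
    fix k :: int
    have "nat (2 * k - 1) = 2 * nat (k - 1) + 1" if "k \<ge> 1" using that by simp
    moreover have "nat (- 2 * k) = 2 * nat (- k)" by simp
    ultimately show "(if even (if k \<ge> 1 then nat (2 * k - 1) else nat (- 2 * k)) then
        - int ((if k \<ge> 1 then nat (2 * k - 1) else nat (- 2 * k)) div 2)
        else int ((if k \<ge> 1 then nat (2 * k - 1) else nat (- 2 * k)) div 2) + 1) = k"
      by (cases "k \<ge> 1") simp_all
  qed (auto elim!: evenE oddE)
qed

text \<open>
  After the change of variables the size is \<open>(2k^2 - k) + m(m+1) + n(n+1)\<close>, in independent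
  variables. The numbers \<open>2k^2 - k\<close> for integers \<open>k\<close> are the triangular numbers, each once.
\<close>

lemma four_core_generating_function:
  assumes x: "x \<noteq> 0" "norm x < 1"
  shows "((\<lambda>xs. x ^ sum_list xs) has_sum (psi x * psi (x ^ 2) ^ 2)) {xs. is_partition xs \<and> is_core 4 xs}"
proof -
  have e: "((\<lambda>m::nat. x ^ (m * (m + 1))) has_sum psi (x ^ 2)) UNIV"
  proof -
    have "((\<lambda>m. (x ^ 2) ^ (m * (m + 1) div 2)) has_sum psi (x ^ 2)) UNIV"
      by (intro has_sum_psi unit_disc_power x) simp_all
    moreover have "(x ^ 2) ^ (m * (m + 1) div 2) = x ^ (m * (m + 1))" for m :: nat
      unfolding power_mult[symmetric] by (rule arg_cong[of _ _ "power x"]) simp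
    ultimately show ?thesis by simp
  qed
  have "((\<lambda>(k, m, n). x powi (2 * k ^ 2 - k) * (x ^ (m * (m + 1)) * x ^ (n * (n + 1)))) has_sum
      (psi x * (psi (x ^ 2) * psi (x ^ 2)))) (UNIV \<times> UNIV \<times> UNIV)"
    using has_sum_times_complex[OF has_sum_psi_index_int[OF x] has_sum_times_complex[OF e e]]
    by (simp add: case_prod_unfold)
  then have "((\<lambda>p. x ^ sum_list (core_of p)) has_sum (psi x * (psi (x ^ 2) * psi (x ^ 2)))) UNIV"
  proof (rule iffD2[OF has_sum_reindex_bij_witness[where j = to_lattice and i = of_lattice], rotated -1])
    fix p :: "nat \<times> nat \<times> nat"
    obtain a b c where p: "p = (a, b, c)" by (cases p)
    obtain k m n where q: "to_lattice p = (k, m, n)" by (cases "to_lattice p")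
    have "x ^ sum_list (core_of p) = x powi (2 * k ^ 2 - k + int (m * (m + 1)) + int (n * (n + 1)))"
    proof -
      have "int (sum_list (core_of p)) = 2 * k ^ 2 - k + int (m * (m + 1)) + int (n * (n + 1))"
        using size_to_lattice[of a b c k m n] p q by (simp add: algebra_simps)
      then show ?thesis by (simp only: flip: power_int_of_nat)
    qed
    also have "\<dots> = x powi (2 * k ^ 2 - k) * (x ^ (m * (m + 1)) * x ^ (n * (n + 1)))"
      by (simp only: power_int_add[OF disjI1[OF x(1)]] power_int_of_nat mult.assoc)
    finally show "(case to_lattice p of (k, m, n) \<Rightarrow> x powi (2 * k ^ 2 - k) * (x ^ (m * (m + 1))
        * x ^ (n * (n + 1)))) = x ^ sum_list (core_of p)"
      by (simp add: q)
  qed (auto simp: of_lattice_to_lattice to_lattice_of_lattice)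
  then show ?thesis
    using has_sum_reindex_bij_betw[OF bij_betw_core_of, of "\<lambda>xs. x ^ sum_list xs"]
        by (simp add: power2_eq_square)
qed

section \<open>Gauss's product for the triangular numbers\<close>

definition euler_prod :: "complex \<Rightarrow> complex" where
  "euler_prod x = (\<Prod>m. 1 - x ^ Suc m)"

definition euler_part :: "complex \<Rightarrow> nat \<Rightarrow> complex" where
  "euler_part x n = (\<Prod>k<n. 1 - x ^ Suc k)"

lemma one_minus_power_nonzero:
  fixes x :: complex
  assumes "norm x < 1" "n > 0"
  shows "1 - x ^ n \<noteq> 0"
proof
  assume "1 - x ^ n = 0"
  then have "norm (x ^ n) = 1" by simp
  moreover have "norm (x ^ n) < 1" using assms by (cases "x = 0") (auto simp: norm_power power_less_one_iff)
  ultimately show False by simp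
qed

lemma power_neq_one:
  fixes x :: complex
  shows "norm x < 1 \<Longrightarrow> n > 0 \<Longrightarrow> x ^ n \<noteq> 1"
  using one_minus_power_nonzero by fastforce

lemma euler_prod_convergent:
  fixes x :: complex
  assumes "norm x < 1"
  shows "convergent_prod (\<lambda>m. 1 - x ^ Suc m)"
proof -
  have "summable (\<lambda>m. norm (- (x ^ Suc m)))"
    using assms summable_mult[of "\<lambda>m. norm x ^ m" "norm x"] summable_geometric[of "norm x"]
    by (simp add: norm_mult norm_power)
  then have "abs_convergent_prod (\<lambda>m. 1 - x ^ Suc m)"
    by (intro summable_imp_abs_convergent_prod) simp
  then show ?thesis by (rule abs_convergent_prod_imp_convergent_prod)
qed

lemma euler_part_tendsto:
  assumes "norm x < 1"
  shows "euler_part x \<longlonglongrightarrow> euler_prod x"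
proof -
  have "(\<lambda>n. \<Prod>k\<le>n. 1 - x ^ Suc k) \<longlonglongrightarrow> euler_prod x"
    unfolding euler_prod_def by (intro convergent_prod_LIMSEQ euler_prod_convergent assms)
  then have "(\<lambda>n. euler_part x (Suc n)) \<longlonglongrightarrow> euler_prod x"
    unfolding euler_part_def lessThan_Suc_atMost .
  then show ?thesis by (simp only: filterlim_sequentially_Suc)
qed

lemma euler_prod_nonzero:
  assumes "norm x < 1"
  shows "euler_prod x \<noteq> 0"
  unfolding euler_prod_def using assms
  by (intro prodinf_nonzero euler_prod_convergent) (auto dest: power_neq_one simp del: power_Suc)

lemma euler_part_nonzero:
  assumes "norm x < 1"
  shows "euler_part x n \<noteq> 0"
  unfolding euler_part_def using assms
  by (auto dest: power_neq_one simp del: power_Suc)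

definition odd_part :: "complex \<Rightarrow> nat \<Rightarrow> complex" where
  "odd_part x n = (\<Prod>k<n. 1 - x ^ (2 * k + 1))"

lemma euler_part_double: "euler_part x (2 * n) = euler_part (x ^ 2) n * odd_part x n"
proof (induction n)
  case (Suc n)
  have "(x ^ 2) ^ Suc n = x ^ (2 * n + 2)"
    unfolding power_mult[symmetric] by (rule arg_cong[of _ _ "power x"]) simp
  with Suc show ?case by (simp add: euler_part_def odd_part_def algebra_simps)
qed (simp add: euler_part_def odd_part_def)

lemma odd_part_nonzero:
  assumes "norm x < 1"
  shows "odd_part x n \<noteq> 0"
  unfolding odd_part_def using assms
  by (auto dest: power_neq_one simp del: power_Suc)

lemma odd_part_mult_minus: "odd_part x n * odd_part (- x) n = odd_part (x ^ 2) n"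
proof -
  have "(1 - x ^ (2 * k + 1)) * (1 - (- x) ^ (2 * k + 1)) = 1 - (x ^ 2) ^ (2 * k + 1)" for k
    by (simp add: algebra_simps flip: power_mult power_add)
  then show ?thesis by (simp add: odd_part_def flip: prod.distrib)
qed

text \<open>
  The factors with even exponent agree on both sides of \<open>x \<mapsto> -x\<close>, and those with odd exponent
  combine to the odd part of the product at \<open>x^2\<close>.
\<close>

lemma euler_prod_minus:
  assumes x: "x \<noteq> 0" "norm x < 1"
  shows "euler_prod x * euler_prod (- x) * euler_prod (x ^ 4) = euler_prod (x ^ 2) ^ 3"
proof -
  have d: "filterlim (\<lambda>n::nat. 2 * n) at_top at_top" by real_asymp
  note T = euler_part_tendsto
  have "(\<lambda>n. euler_part x (2 * n) * euler_part (- x) (2 * n) * euler_part (x ^ 4) n) \<longlonglongrightarrow>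
      euler_prod x * euler_prod (- x) * euler_prod (x ^ 4)"
    using x unit_disc_power[OF x, of 4] by (intro tendsto_mult filterlim_compose[OF T d] T) auto
  moreover have "(\<lambda>n. euler_part (x ^ 2) n ^ 2 * euler_part (x ^ 2) (2 * n)) \<longlonglongrightarrow> euler_prod (x ^ 2) ^ 2
      * euler_prod (x ^ 2)"
    using x unit_disc_power[OF x, of 2] by (intro tendsto_mult tendsto_power filterlim_compose[OF T d]
        T) auto
  moreover have "euler_part x (2 * n) * euler_part (- x) (2 * n) * euler_part (x ^ 4) n
      = euler_part (x ^ 2) n ^ 2 * euler_part (x ^ 2) (2 * n)" for n
  proof -
    have "euler_part (x ^ 2) (2 * n) = euler_part (x ^ 4) n * odd_part (x ^ 2) n"
      using euler_part_double[of "x ^ 2" n] by (simp flip: power_mult)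
    then show ?thesis
      using euler_part_double[of x n] euler_part_double[of "- x" n]
      by (simp add: power2_eq_square[of "euler_part _ _"] mult_ac flip: odd_part_mult_minus)
  qed
  ultimately have "euler_prod x * euler_prod (- x) * euler_prod (x ^ 4)
      = euler_prod (x ^ 2) ^ 2 * euler_prod (x ^ 2)"
    using LIMSEQ_unique by auto
  then show ?thesis by (simp add: power2_eq_square power3_eq_cube)
qed

text \<open>
  Partial products of the product of all \<open>(1 - x^(2k)) / (1 - x^(2k-1))\<close>, which Gauss showed to be
  \<open>\<psi>(x)\<close>.
\<close>

definition gauss_part :: "complex \<Rightarrow> nat \<Rightarrow> complex" where
  "gauss_part x n = euler_part (x ^ 2) n / odd_part x n"

lemma gauss_part_Suc: "gauss_part x (Suc n)
    = gauss_part x n * ((1 - x ^ (2 * n + 2)) / (1 - x ^ (2 * n + 1)))"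
proof -
  have "(x ^ 2) ^ Suc n = x ^ (2 * n + 2)"
    unfolding power_mult[symmetric] by (rule arg_cong[of _ _ "power x"]) simp
  then show ?thesis by (simp add: gauss_part_def euler_part_def odd_part_def)
qed

lemma gauss_part_nonzero:
  assumes x: "x \<noteq> 0" "norm x < 1" shows "gauss_part x n \<noteq> 0"
  using assms unit_disc_power[OF x, of 2] by (simp add: gauss_part_def euler_part_nonzero odd_part_nonzero)

text \<open>
  D. Shanks's finite form of Gauss's product. The summand \<open>s = 0\<close> on the right is the partial
  product itself and the other summands are of order \<open>x^(2n+1)\<close>. When \<open>n\<close> grows by one, every
  summand changes by the telescoping difference \<open>T (Suc s) - T s\<close>.
\<close>

lemma shanks_identity:
  assumes x: "x \<noteq> 0" "norm x < 1"
  shows "(\<Sum>k<2 * n. x ^ (k * (k + 1) div 2))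
      = (\<Sum>s<n. gauss_part x n / gauss_part x s * x ^ (s * (2 * n + 1)))"
proof (induction n)
  case (Suc n)
  let ?P = "gauss_part x"
  \<comment> \<open>the factor \<open>1 - x ^ (2 * s)\<close> makes \<open>T 0\<close> vanish\<close>
  define T where "T s = ?P n / ?P s * (1 - x ^ (2 * s)) * x ^ (s * (2 * n + 1)) / (1 - x ^ (2 * n
      + 1))" for s
  have nz: "1 - x ^ (2 * k + 1) \<noteq> 0" "1 - x ^ (2 * k + 2) \<noteq> 0" "?P k \<noteq> 0" for k
    using x by (simp_all only: one_minus_power_nonzero gauss_part_nonzero add_gr_0 zero_less_one
        zero_less_numeral simp_thms)
  have T': "T (Suc s) = ?P n / ?P s * (1 - x ^ (2 * s + 1)) * x ^ (s * (2 * n + 1)) * x ^ (2 * n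
      + 1) / (1 - x ^ (2 * n + 1))" for s
  proof -
    have "x ^ (Suc s * (2 * n + 1)) = x ^ (s * (2 * n + 1)) * x ^ (2 * n + 1)"
      by (simp only: mult_Suc power_add mult.commute)
    moreover have "?P n / ?P (Suc s) * (1 - x ^ (2 * Suc s)) = ?P n / ?P s * (1 - x ^ (2 * s + 1))"
      unfolding gauss_part_Suc using nz[of s] by (simp add: divide_simps)
    ultimately show ?thesis unfolding T_def by (simp only: mult.assoc)
  qed
  have step: "?P (Suc n) / ?P s * x ^ (s * (2 * Suc n + 1))
      = ?P n / ?P s * x ^ (s * (2 * n + 1)) + (T (Suc s) - T s)" for s
  proof -
    define a where "a = ?P n / ?P s * x ^ (s * (2 * n + 1))"
    have "x ^ (s * (2 * Suc n + 1)) = x ^ (s * (2 * n + 1)) * x ^ (2 * s)"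
      by (simp add: algebra_simps flip: power_add)
    then have "?P (Suc n) / ?P s * x ^ (s * (2 * Suc n + 1))
        = a * x ^ (2 * s) * (1 - x ^ (2 * n + 2)) / (1 - x ^ (2 * n + 1))"
      unfolding gauss_part_Suc a_def by (simp add: mult_ac)
    moreover have "T (Suc s) - T s = a * ((1 - x ^ (2 * s + 1)) * x ^ (2 * n + 1) - (1 - x ^ (2
        * s))) / (1 - x ^ (2 * n + 1))"
    proof -
      have "p * (1 - u) * X * y / D - p * (1 - w) * X / D = p * X * ((1 - u) * y - (1 - w)) / D"
        for p u X y D w :: complex
        by (simp add: algebra_simps flip: diff_divide_distrib)
      then show ?thesis unfolding T' unfolding T_def a_def by (simp only:)
    qed
    moreover have "x ^ (2 * s) * (1 - x ^ (2 * n + 2))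
        = (1 - x ^ (2 * n + 1)) + ((1 - x ^ (2 * s + 1)) * x ^ (2 * n + 1) - (1 - x ^ (2 * s)))"
      by (simp add: power_add power2_eq_square algebra_simps)
    ultimately show ?thesis using nz(1)[of n]
      by (simp only: mult.assoc distrib_left add_divide_distrib) (simp add: a_def add.commute)
  qed
  have "(\<Sum>s<Suc n. ?P (Suc n) / ?P s * x ^ (s * (2 * Suc n + 1))) =
      (\<Sum>s<Suc n. ?P n / ?P s * x ^ (s * (2 * n + 1))) + (T (Suc n) - T 0)"
    unfolding step sum.distrib by (simp only: sum_lessThan_telescope)
  also have "T 0 = 0" by (simp add: T_def)
  also have "T (Suc n) = x ^ (n * (2 * n + 1)) * x ^ (2 * n + 1)"
  proof -
    have "p / p * a * X * y / a = X * y" if "p \<noteq> 0" "a \<noteq> 0" for p a X y :: complex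
      using that by simp
    from this[OF nz(3,1)] show ?thesis unfolding T' .
  qed
  also have "\<dots> = x ^ ((n + 1) * (2 * n + 1))" by (simp add: algebra_simps flip: power_add)
  also have "(\<Sum>s<Suc n. ?P n / ?P s * x ^ (s * (2 * n + 1))) =
      (\<Sum>s<n. ?P n / ?P s * x ^ (s * (2 * n + 1))) + x ^ (n * (2 * n + 1))"
    using nz(3) by simp
  also note Suc.IH[symmetric]
  finally have "(\<Sum>s<Suc n. ?P (Suc n) / ?P s * x ^ (s * (2 * Suc n + 1))) =
     (\<Sum>k<2 * n. x ^ (k * (k + 1) div 2)) + x ^ (n * (2 * n + 1)) + x ^ ((n + 1) * (2 * n + 1))" by simp
  moreover have "n * (2 * n + 1) = 2 * n * (2 * n + 1) div 2" "(n + 1) * (2 * n + 1)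
      = Suc (2 * n) * (Suc (2 * n) + 1) div 2"
    by (simp_all add: algebra_simps)
  moreover have "2 * Suc n = Suc (Suc (2 * n))" by simp
  ultimately show ?case by (simp only: sum.lessThan_Suc)
qed simp

text \<open>
  The quotients of partial products are bounded since the product converges to a nonzero limit, so
  the summands with \<open>s > 0\<close> in Shanks's identity disappear in the limit.
\<close>

lemma psi_gauss_product:
  assumes x: "x \<noteq> 0" "norm x < 1"
  shows "psi x * euler_prod x = euler_prod (x ^ 2) ^ 2"
proof -
  define P where "P = gauss_part x"
  define L where "L = euler_prod (x ^ 2) ^ 2 / euler_prod x"
  have x2: "norm (x ^ 2) < 1" using unit_disc_power[OF x, of 2] by simp
  have d: "filterlim (\<lambda>n::nat. 2 * n) at_top at_top" by real_asymp
  have "(\<lambda>n. euler_part (x ^ 2) n ^ 2 / euler_part x (2 * n)) \<longlonglongrightarrow> L"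
    unfolding L_def using x x2
    by (intro tendsto_intros euler_part_tendsto filterlim_compose[OF euler_part_tendsto d]
        euler_prod_nonzero)
  moreover have "euler_part (x ^ 2) n ^ 2 / euler_part x (2 * n) = P n" for n
    unfolding euler_part_double P_def gauss_part_def using euler_part_nonzero[OF x2]
    by (simp add: power2_eq_square)
  ultimately have PL: "P \<longlonglongrightarrow> L" by simp
  have L: "L \<noteq> 0" using euler_prod_nonzero[of x] euler_prod_nonzero[OF x2] x by (simp add: L_def)
  obtain B where B: "\<And>n. norm (P n) \<le> B"
    using convergent_imp_Bseq[OF convergentI[OF PL]] by (auto simp: Bseq_def)
  obtain C where C: "\<And>n. norm (inverse (P n)) \<le> C"
    using convergent_imp_Bseq[OF convergentI[OF tendsto_inverse[OF PL L]]] by (auto simp: Bseq_def)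
  define S where "S n = (\<Sum>s<n. P n / P s * x ^ (s * (2 * n + 1)))" for n
  have P0: "P 0 = 1" by (simp add: P_def gauss_part_def euler_part_def odd_part_def)
  have bound: "norm (S n - P n) \<le> (B * C) * (real n * norm x ^ n)" if n: "n > 0" for n
  proof -
    obtain m where m: "n = Suc m" using n by (cases n) auto
    have "S n - P n = (\<Sum>s<m. P n / P (Suc s) * x ^ (Suc s * (2 * n + 1)))"
      unfolding S_def m sum.lessThan_Suc_shift by (simp add: P0)
    also have "norm \<dots> \<le> (\<Sum>s<m. (B * C) * norm x ^ n)"
    proof (rule sum_norm_le)
      fix s
      have "norm (P n * inverse (P (Suc s)) * x ^ (Suc s * (2 * n + 1))) \<le> (B * C) * norm x ^ n"
        unfolding norm_mult norm_power using B[of n] C[of "Suc s"] x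
        by (intro mult_mono power_decreasing mult_nonneg_nonneg) (auto intro: order_trans[OF norm_ge_zero])
      then show "norm (P n / P (Suc s) * x ^ (Suc s * (2 * n + 1))) \<le> (B * C) * norm x ^ n"
        by (simp only: divide_inverse)
    qed
    also have "\<dots> = (B * C) * (real m * norm x ^ n)" by simp
    also have "\<dots> \<le> (B * C) * (real n * norm x ^ n)"
      using order_trans[OF norm_ge_zero B[of 0]] order_trans[OF norm_ge_zero C[of 0]]
      by (intro mult_left_mono mult_right_mono mult_nonneg_nonneg) (auto simp: m)
    finally show ?thesis .
  qed
  have "(\<lambda>n. (B * C) * (real n * norm x ^ n)) \<longlonglongrightarrow> (B * C) * 0"
    using powser_times_n_limit_0[of "norm x"] x by (intro tendsto_intros) simp
  then have g: "(\<lambda>n. (B * C) * (real n * norm x ^ n)) \<longlonglongrightarrow> 0" by simp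
  have "(\<lambda>n. S n - P n) \<longlonglongrightarrow> 0"
  proof (rule Lim_null_comparison[OF _ g])
    show "\<forall>\<^sub>F n in sequentially. norm (S n - P n) \<le> (B * C) * (real n * norm x ^ n)"
      using eventually_gt_at_top[of 0] by eventually_elim (rule bound)
  qed
  from tendsto_add[OF this PL] have "S \<longlonglongrightarrow> L" by simp
  moreover have "S \<longlonglongrightarrow> psi x"
  proof -
    have "(\<lambda>n. \<Sum>k<n. x ^ (k * (k + 1) div 2)) \<longlonglongrightarrow> psi x"
      using has_sum_imp_sums[OF has_sum_psi[OF x]] by (simp add: sums_def)
    from filterlim_compose[OF this d] show ?thesis
      unfolding shanks_identity[OF x] S_def P_def .
  qed
  ultimately have "psi x = L" by (rule LIMSEQ_unique[rotated])
  then show ?thesis using euler_prod_nonzero[of x] x by (simp add: L_def)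
qed

text \<open>
  Everything on the right is a quotient of Euler products: \<open>\<psi>\<close> by Gauss, and \<open>\<phi>(-x^2)^2\<close> because
  \<open>psi_square\<close> at \<open>x\<close> and \<open>-x\<close> together with \<open>phi_times_phi_minus\<close> express it through \<open>\<psi>\<close>.
\<close>

lemma euler_prod_power6:
  assumes x: "x \<noteq> 0" "norm x < 1"
  shows "euler_prod (x ^ 2) ^ 6 = psi (x ^ 2) ^ 2 * phi (- (x ^ 2)) ^ 4"
proof -
  have x2: "x ^ 2 \<noteq> 0" "norm (x ^ 2) < 1" "norm (x ^ 4) < 1" and mx: "- x \<noteq> 0" "norm (- x) < 1"
    using unit_disc_power[OF x, of 2] unit_disc_power[OF x, of 4] x by auto
  define a b c d where "a = euler_prod x" and "b = euler_prod (- x)" and "c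
      = euler_prod (x ^ 2)" and "d = euler_prod (x ^ 4)"
  have nz: "a \<noteq> 0" "b \<noteq> 0" "c \<noteq> 0" "d \<noteq> 0"
    using x x2 mx by (simp_all add: a_def b_def c_def d_def euler_prod_nonzero)
  have "psi x * a = c ^ 2" "psi (- x) * b = c ^ 2" "psi (x ^ 2) * c = d ^ 2"
    using psi_gauss_product[OF x] psi_gauss_product[OF mx] psi_gauss_product[OF x2(1,2)]
    by (simp_all add: a_def b_def c_def d_def flip: power_mult)
  then have p: "psi x = c ^ 2 / a" "psi (- x) = c ^ 2 / b" "psi (x ^ 2) = d ^ 2 / c"
    using nz by (simp_all add: field_simps)
  have abd: "a * b * d = c ^ 3" using euler_prod_minus[OF x] by (simp add: a_def b_def c_def d_def)
  have "psi x ^ 2 * psi (- x) ^ 2 = phi (- (x ^ 2)) ^ 2 * psi (x ^ 2) ^ 2"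
    using psi_square[OF x] psi_square[OF mx] phi_times_phi_minus[OF x]
        by (simp add: power2_eq_square mult_ac)
  then have "phi (- (x ^ 2)) ^ 2 = (psi x * psi (- x)) ^ 2 / psi (x ^ 2) ^ 2"
  proof -
    have "psi (x ^ 2) ^ 2 \<noteq> 0" using nz p(3) by simp
    then show ?thesis using \<open>psi x ^ 2 * psi (- x) ^ 2 = _\<close>
      by (simp add: eq_divide_eq power_mult_distrib)
  qed
  moreover have "psi x * psi (- x) = c * d"
  proof -
    have "psi x * psi (- x) = c * c ^ 3 / (a * b)" unfolding p
        by (simp add: power2_eq_square power3_eq_cube)
    then show ?thesis unfolding abd[symmetric] using nz by simp
  qed
  ultimately have f: "phi (- (x ^ 2)) ^ 2 = (c ^ 2 / d) ^ 2"
    using nz unfolding p(3) by (simp add: power2_eq_square field_simps)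
  have "phi (- (x ^ 2)) ^ 4 = (phi (- (x ^ 2)) ^ 2) ^ 2" by simp
  also have "\<dots> = (c ^ 2 / d) ^ 4" unfolding f by simp
  finally have "psi (x ^ 2) ^ 2 * phi (- (x ^ 2)) ^ 4 = (d ^ 2 / c) ^ 2 * (c ^ 2 / d) ^ 4"
      by (simp add: p(3))
  also have "\<dots> = c ^ 6" using nz by (simp add: field_simps flip: power_mult power_add)
  finally show ?thesis by (simp add: c_def)
qed

section \<open>Hyperbolic Lambert series\<close>

text \<open>
  With \<open>x = exp(-t)\<close> the next three functions are \<open>1/cosh(nt)\<close>, \<open>1/sinh(nt)\<close> and \<open>tanh(nt)\<close>. They
  are written as rational functions of \<open>x\<close> because \<open>x\<close> ranges over the complex unit disc and \<open>-x\<close>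
  matters. The value of \<open>1/sinh\<close> at \<open>n = 0\<close> is 0 by division by zero, which drops that term from all
  series.
\<close>

definition lsech :: "complex \<Rightarrow> int \<Rightarrow> complex" where
  "lsech x n = 2 / (x powi n + x powi (-n))"

definition lcsch :: "complex \<Rightarrow> int \<Rightarrow> complex" where
  "lcsch x n = 2 / (x powi (-n) - x powi n)"

definition ltanh :: "complex \<Rightarrow> int \<Rightarrow> complex" where
  "ltanh x n = (x powi (-n) - x powi n) / (x powi (-n) + x powi n)"

lemma powi_norm_bounds:
  fixes x :: complex
  assumes x: "x \<noteq> 0" "norm x < 1" and n: "n \<noteq> 0"
  shows "norm (x powi n + x powi (-n)) \<ge> (1 - norm x) / norm x ^ nat \<bar>n\<bar>"
    and "norm (x powi (-n) - x powi n) \<ge> (1 - norm x) / norm x ^ nat \<bar>n\<bar>"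
proof -
  define N where "N = nat \<bar>n\<bar>"
  have N: "N \<ge> 1" using n by (auto simp: N_def)
  define r where "r = norm x"
  have r: "0 < r" "r < 1" using x by (auto simp: r_def)
  have "r ^ N * r ^ N \<le> r ^ 1 * 1"
    using r N by (intro mult_mono power_decreasing power_le_one) auto
  then have key: "(1 - r) / r ^ N \<le> inverse r ^ N - r ^ N"
    using r by (simp add: field_simps)
  have d: "n = int N \<or> n = - int N" by (auto simp: N_def)
  have "norm (x ^ N + inverse x ^ N) \<ge> inverse r ^ N - r ^ N"
    using norm_diff_ineq[of "inverse x ^ N" "x ^ N"]
        by (simp add: r_def norm_power norm_inverse add.commute)
  moreover have "norm (inverse x ^ N - x ^ N) \<ge> inverse r ^ N - r ^ N"
    using norm_triangle_ineq2[of "inverse x ^ N" "x ^ N"] by (simp add: r_def norm_power norm_inverse)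
  ultimately show "norm (x powi n + x powi (-n)) \<ge> (1 - norm x) / norm x ^ nat \<bar>n\<bar>"
    and "norm (x powi (-n) - x powi n) \<ge> (1 - norm x) / norm x ^ nat \<bar>n\<bar>"
    using key d unfolding N_def[symmetric] r_def[symmetric]
    by (auto simp: power_int_minus power_inverse add.commute norm_minus_commute)
qed

lemma powi_denominators:
  fixes x :: complex
  assumes x: "x \<noteq> 0" "norm x < 1"
  shows "x powi n + x powi (-n) \<noteq> 0" "n \<noteq> 0 \<Longrightarrow> x powi (-n) - x powi n \<noteq> 0"
proof -
  have p: "0 < (1 - norm x) / norm x ^ nat \<bar>n\<bar>" using x by simp
  show "n \<noteq> 0 \<Longrightarrow> x powi (-n) - x powi n \<noteq> 0" using powi_norm_bounds(2)[OF x, of n] p by auto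
  show "x powi n + x powi (-n) \<noteq> 0" using powi_norm_bounds(1)[OF x, of n] p by (cases "n = 0") auto
qed

lemma lsech_bound:
  assumes x: "x \<noteq> 0" "norm x < 1"
  shows "norm (lsech x n) \<le> 2 / (1 - norm x) * norm x ^ nat \<bar>n\<bar>"
proof (cases "n = 0")
  case True then show ?thesis using x by (simp add: lsech_def field_simps)
next
  case False
  have p: "0 < (1 - norm x) / norm x ^ nat \<bar>n\<bar>" using x by simp
  have "norm (lsech x n) \<le> 2 / ((1 - norm x) / norm x ^ nat \<bar>n\<bar>)"
    using powi_norm_bounds(1)[OF x False] p unfolding lsech_def norm_divide
    by (intro frac_le) auto
  then show ?thesis by simp
qed

lemma lcsch_bound:
  assumes x: "x \<noteq> 0" "norm x < 1"
  shows "norm (lcsch x n) \<le> 2 / (1 - norm x) * norm x ^ nat \<bar>n\<bar>"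
proof (cases "n = 0")
  case True then show ?thesis using x by (simp add: lcsch_def field_simps)
next
  case False
  have p: "0 < (1 - norm x) / norm x ^ nat \<bar>n\<bar>" using x by simp
  have "norm (lcsch x n) \<le> 2 / ((1 - norm x) / norm x ^ nat \<bar>n\<bar>)"
    using powi_norm_bounds(2)[OF x False] p unfolding lcsch_def norm_divide
    by (intro frac_le) auto
  then show ?thesis by simp
qed

lemma poly_weight_bound: "k \<le> 2 \<Longrightarrow> \<bar>of_int n\<bar> ^ k \<le> (1 + of_int n ^ 2 :: real)"
proof -
  assume "k \<le> 2"
  then consider "k = 0" | "k = 1" | "k = 2" by linarith
  then show ?thesis
  proof cases
    case 2
    have "0 \<le> (\<bar>of_int n :: real\<bar> - 1)^2 " by simp
    then show ?thesis using 2 unfolding power2_diff by simp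
  qed auto
qed

lemma summable_lsech:
  assumes x: "x \<noteq> 0" "norm x < 1" and "k \<le> 2"
  shows "(\<lambda>n. of_int n ^ k * lsech x n) summable_on A"
proof (rule summable_int_geometric_bound[of "norm x" _ "2 / (1 - norm x)"])
  fix n
  have "norm (of_int n ^ k * lsech x n) \<le> (1 + of_int n ^ 2) * (2 / (1 - norm x) * norm x ^ nat \<bar>n\<bar>)"
    unfolding norm_mult using lsech_bound[OF x] poly_weight_bound[OF \<open>k \<le> 2\<close>]
    by (intro mult_mono) (auto simp: norm_power)
  then show "norm (of_int n ^ k * lsech x n) \<le> 2 / (1 - norm x) * ((1 + of_int n ^ 2) * norm x ^ nat \<bar>n\<bar>)"
    by (simp only: mult_ac)
qed (use x in auto)

lemma summable_lcsch:
  assumes x: "x \<noteq> 0" "norm x < 1" and "k \<le> 2"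
  shows "(\<lambda>n. of_int n ^ k * lcsch x n) summable_on A"
proof (rule summable_int_geometric_bound[of "norm x" _ "2 / (1 - norm x)"])
  fix n
  have "norm (of_int n ^ k * lcsch x n) \<le> (1 + of_int n ^ 2) * (2 / (1 - norm x) * norm x ^ nat \<bar>n\<bar>)"
    unfolding norm_mult using lcsch_bound[OF x] poly_weight_bound[OF \<open>k \<le> 2\<close>]
    by (intro mult_mono) (auto simp: norm_power)
  then show "norm (of_int n ^ k * lcsch x n) \<le> 2 / (1 - norm x) * ((1 + of_int n ^ 2) * norm x ^ nat \<bar>n\<bar>)"
    by (simp only: mult_ac)
qed (use x in auto)

lemma lsech_minus [simp]: "lsech x (-n) = lsech x n"
  by (simp add: lsech_def add.commute)

lemma lcsch_minus [simp]: "lcsch x (-n) = - lcsch x n"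
  unfolding lcsch_def minus_minus by (metis minus_diff_eq minus_divide_right)

lemma ltanh_minus [simp]: "ltanh x (-n) = - ltanh x n"
  unfolding ltanh_def minus_minus by (metis minus_diff_eq minus_divide_left add.commute)

lemma lsech_lcsch_ltanh_rational:
  assumes "x \<noteq> 0" "norm x < 1"
  shows "lsech x m = 2 * x powi m / (1 + (x powi m)^2)"
    and "lcsch x m = 2 * x powi m / (1 - (x powi m)^2)"
    and "ltanh x m = (1 - (x powi m)^2) / (1 + (x powi m)^2)"
proof -
  have a: "x powi m \<noteq> 0" using assms by simp
  have e: "1 / a + a = (1 + a^2) / a" "a + 1 / a = (1 + a^2) / a" "1 / a - a = (1 - a^2) / a"
      if "a \<noteq> 0" for a :: complex
    using that by (auto simp: field_simps power2_eq_square)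
  have m: "x powi (-m) = 1 / x powi m" by (simp add: power_int_minus_divide)
  show "lsech x m = 2 * x powi m / (1 + (x powi m)^2)" "lcsch x m = 2 * x powi m / (1 - (x powi m)^2)"
    "ltanh x m = (1 - (x powi m)^2) / (1 + (x powi m)^2)"
    unfolding lsech_def lcsch_def ltanh_def m e[OF a] using a by auto
qed

lemma one_plus_powi_square_nonzero:
  fixes x :: complex
  assumes x: "x \<noteq> 0" "norm x < 1"
  shows "1 + (x powi m)^2 \<noteq> 0" "m \<noteq> 0 \<Longrightarrow> 1 - (x powi m)^2 \<noteq> 0"
proof -
  have a: "x powi m \<noteq> 0" using x by simp
  have "1 + (x powi m)^2 = x powi m * (x powi m + x powi (-m))" "1 - (x powi m)^2
      = x powi m * (x powi (-m) - x powi m)"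
    using x by (simp_all add: power_int_minus field_simps power2_eq_square)
  then show "1 + (x powi m)^2 \<noteq> 0" "m \<noteq> 0 \<Longrightarrow> 1 - (x powi m)^2 \<noteq> 0"
    using powi_denominators[OF x, of m] a by simp_all
qed

text \<open>Divide \<open>sinh(a + b) = sinh a cosh b + cosh a sinh b\<close> by \<open>cosh a cosh b sinh(a + b)\<close>.\<close>

lemma lsech_mult:
  assumes x: "x \<noteq> 0" "norm x < 1" and "m + n \<noteq> 0"
  shows "lsech x m * lsech x n = (ltanh x m + ltanh x n) * lcsch x (m + n)"
proof -
  have alg: "2 * a / (1 + a^2) * (2 * b / (1 + b^2)) =
      ((1 - a^2) / (1 + a^2) + (1 - b^2) / (1 + b^2)) * (2 * (a * b) / (1 - (a * b)^2))"
    if "1 + a^2 \<noteq> 0" "1 + b^2 \<noteq> 0" "1 - (a * b)^2 \<noteq> 0" for a b :: complex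
  proof -
    have "(1 - a^2) / (1 + a^2) + (1 - b^2) / (1 + b^2) = 2 * (1 - (a * b)^2) / ((1 + a^2) * (1 + b^2))"
      using that(1,2) by (simp add: add_frac_eq) (simp add: algebra_simps)
    moreover have "2 * a / A * (2 * b / B) = 2 * d / (A * B) * (2 * (a * b) / d)" if "d \<noteq> 0" for A B d
      using that by simp
    ultimately show ?thesis using that(3) by (simp only: not_False_eq_True divide_divide_eq_right mult_1)
  qed
  have mn: "x powi (m + n) = x powi m * x powi n" using x by (simp add: power_int_add)
  show ?thesis unfolding lsech_lcsch_ltanh_rational[OF x] mn
    by (rule alg; (unfold mn[symmetric])?; intro one_plus_powi_square_nonzero x assms(3))
qed

text \<open>Divide \<open>cosh(a + b) = cosh a cosh b + sinh a sinh b\<close> by \<open>cosh a sinh b cosh(a + b)\<close>.\<close>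

lemma lsech_lcsch_mult:
  assumes x: "x \<noteq> 0" "norm x < 1" and "n \<noteq> 0"
  shows "lsech x m * lcsch x n = (ltanh x m + 1 / ltanh x n) * lsech x (m + n)"
proof -
  have alg: "2 * a / (1 + a^2) * (2 * b / (1 - b^2)) =
      ((1 - a^2) / (1 + a^2) + 1 / ((1 - b^2) / (1 + b^2))) * (2 * (a * b) / (1 + (a * b)^2))"
    if "1 + a^2 \<noteq> 0" "1 - b^2 \<noteq> 0" "1 + (a * b)^2 \<noteq> 0" for a b :: complex
  proof -
    have "(1 - a^2) / (1 + a^2) + (1 + b^2) / (1 - b^2) = 2 * (1 + (a * b)^2) / ((1 + a^2) * (1 - b^2))"
      using that(1,2) by (simp add: add_frac_eq) (simp add: algebra_simps)
    moreover have "2 * a / A * (2 * b / B) = 2 * d / (A * B) * (2 * (a * b) / d)" if "d \<noteq> 0" for A B d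
      using that by simp
    ultimately show ?thesis using that(3) by (simp only: not_False_eq_True divide_divide_eq_right mult_1)
  qed
  have mn: "x powi (m + n) = x powi m * x powi n" using x by (simp add: power_int_add)
  show ?thesis unfolding lsech_lcsch_ltanh_rational[OF x] mn
    by (rule alg; (unfold mn[symmetric])?; intro one_plus_powi_square_nonzero x assms(3))
qed

lemma ltanh_limits:
  assumes x: "x \<noteq> 0" "norm x < 1"
  shows "(ltanh x \<longlongrightarrow> 1) at_top" "(ltanh x \<longlongrightarrow> -1) at_bot"
proof -
  have z: "(\<lambda>n. x ^ (2 * n)) \<longlonglongrightarrow> 0"
    using LIMSEQ_power_zero[of "x^2"] x by (simp add: power_mult norm_power power_less_one_iff
        abs_square_less_1)
  have "(\<lambda>n. (1 - x ^ (2 * n)) / (1 + x ^ (2 * n))) \<longlonglongrightarrow> (1 - 0) / (1 + 0)"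
    by (intro tendsto_intros z) auto
  moreover have "(1 - x ^ (2 * n)) / (1 + x ^ (2 * n)) = ltanh x (int n)" for n
    by (simp add: lsech_lcsch_ltanh_rational[OF x] power_mult mult.commute)
  ultimately have l: "(\<lambda>n. ltanh x (int n)) \<longlonglongrightarrow> 1" by simp
  have f: "filterlim nat sequentially at_top" by real_asymp
  have "((\<lambda>k. ltanh x (int (nat k))) \<longlongrightarrow> 1) at_top" by (rule filterlim_compose[OF l f])
  moreover have "\<forall>\<^sub>F k in at_top. ltanh x (int (nat k)) = ltanh x k"
    using eventually_ge_at_top[of 0] by eventually_elim simp
  ultimately show t: "(ltanh x \<longlongrightarrow> 1) at_top" by (rule Lim_transform_eventually)
  have "((\<lambda>k. ltanh x (- k)) \<longlongrightarrow> 1) at_bot"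
    by (rule filterlim_compose[OF t]) real_asymp
  then have "((\<lambda>k. - ltanh x (- k)) \<longlongrightarrow> - 1) at_bot"
    by (rule tendsto_minus)
  then show "(ltanh x \<longlongrightarrow> -1) at_bot" by simp
qed

lemma ltanh_diff:
  assumes x: "x \<noteq> 0" "norm x < 1" and "m \<noteq> n"
  shows "ltanh x m - ltanh x n = lsech x m * lsech x n / lcsch x (m - n)"
proof -
  have "lcsch x (m - n) \<noteq> 0"
    using powi_denominators(2)[OF x, of "m - n"] assms(3) by (simp add: lcsch_def)
  then show ?thesis using lsech_mult[OF x, of m "-n"] assms(3) by simp
qed

text \<open>
  Along an arithmetic progression \<open>tanh\<close> rises from \<open>-1\<close> to \<open>1\<close>, so each unit of the shift
  contributes 2.
\<close>

lemma ltanh_telescoping: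
  assumes x: "x \<noteq> 0" "norm x < 1" and l: "l > 0"
  shows "((\<lambda>i. ltanh x (l * i + c) - ltanh x (l * (i - k) + c)) has_sum (2 * of_int k)) UNIV"
proof -
  have "((\<lambda>i. ltanh x (l * i + c) - ltanh x (l * (i - k) + c)) has_sum (of_int k * (1 - (-1)))) UNIV"
  proof (rule telescoping_int)
    show "(\<lambda>i. ltanh x (l * i + c) - ltanh x (l * (i - 1) + c)) summable_on UNIV"
    proof -
      have "(\<lambda>i. lsech x i) summable_on range (\<lambda>i. l * i + c)"
        using summable_lsech[OF x, of 0] by simp
      then have s: "(\<lambda>i. lsech x (l * i + c)) summable_on UNIV"
        using l by (subst (asm) summable_on_reindex) (auto simp: inj_def o_def)
      have "(\<lambda>i. norm (lsech x (l * i + c)) * (2 / (1 - norm x)) * norm (1 / lcsch x l)) summable_on UNIV"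
        using s by (intro summable_on_cmult_left) (simp add: summable_on_iff_abs_summable_on_complex)
      moreover have "norm (lsech x (l * i + c) * lsech x (l * (i - 1) + c) / lcsch x l)
          \<le> norm (lsech x (l * i + c)) * (2 / (1 - norm x)) * norm (1 / lcsch x l)" for i
      proof -
        have "norm (lsech x m) \<le> 2 / (1 - norm x)" for m
          using lsech_bound[OF x, of m] x power_le_one[of "norm x" "nat \<bar>m\<bar>"]
          by (smt (verit) divide_nonneg_nonneg mult_left_le norm_ge_zero)
        moreover have "norm (a * b / k) = norm a * norm b * norm (1 / k)" for a b k :: complex
          by (simp add: norm_mult norm_divide)
        ultimately show ?thesis
          by (simp only:) (intro mult_right_mono mult_left_mono; simp)
      qed
      ultimately have "(\<lambda>i. norm (lsech x (l * i + c) * lsech x (l * (i - 1) + c) / lcsch x l))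
          summable_on UNIV"
        by (rule Infinite_Sum.abs_summable_on_comparison_test')
      then have "(\<lambda>i. lsech x (l * i + c) * lsech x (l * (i - 1) + c) / lcsch x l) summable_on UNIV"
        by (rule Infinite_Sum.abs_summable_summable)
      moreover have "ltanh x (l * i + c) - ltanh x (l * (i - 1) + c)
          = lsech x (l * i + c) * lsech x (l * (i - 1) + c) / lcsch x l" for i
        using l ltanh_diff[OF x, of "l * i + c" "l * (i - 1) + c"] by (simp add: algebra_simps)
      ultimately show ?thesis by simp
    qed
    have "filterlim (\<lambda>i. l * i + c) at_top at_top"
      unfolding filterlim_at_top_ge[where c = 0]
    proof safe
      fix Z :: int assume "0 \<le> Z"
      have "Z \<le> l * i + c" if "Z + \<bar>c\<bar> \<le> i" for i
      proof -
        have "1 * i \<le> l * i" using that \<open>0 \<le> Z\<close> l by (intro mult_right_mono) auto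
        then show ?thesis using that by linarith
      qed
      then show "\<forall>\<^sub>F i in at_top. Z \<le> l * i + c" unfolding eventually_at_top_linorder by blast
    qed
    from filterlim_compose[OF ltanh_limits(1)[OF x] this]
    show "((\<lambda>i. ltanh x (l * i + c)) \<longlongrightarrow> 1) at_top" .
    have "filterlim (\<lambda>i. l * i + c) at_bot at_bot"
      unfolding filterlim_at_bot_le[where c = 0]
    proof safe
      fix Z :: int assume "Z \<le> 0"
      have "l * i + c \<le> Z" if "i \<le> Z - \<bar>c\<bar>" for i
      proof -
        have "l * i \<le> 1 * i" using that \<open>Z \<le> 0\<close> l by (intro mult_right_mono_neg) auto
        then show ?thesis using that by linarith
      qed
      then show "\<forall>\<^sub>F i in at_bot. l * i + c \<le> Z" unfolding eventually_at_bot_linorder by blast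
    qed
    from filterlim_compose[OF ltanh_limits(2)[OF x] this]
    show "((\<lambda>i. ltanh x (l * i + c)) \<longlongrightarrow> -1) at_bot" .
  qed
  then show ?thesis by (simp add: mult.commute)
qed

definition sech_series :: "complex \<Rightarrow> complex" where
  "sech_series x = (\<Sum>\<^sub>\<infinity>n. lsech x n)"

lemma has_sum_sech_series:
  assumes "x \<noteq> 0" "norm x < 1"
  shows "(lsech x has_sum sech_series x) UNIV"
  using summable_lsech[OF assms, of 0] by (simp add: sech_series_def)

text \<open>
  The products of terms with indices \<open>m\<close> and \<open>k - m\<close>, for fixed \<open>k \<noteq> 0\<close>, are \<open>1/sinh(kt)\<close> times the
  differences \<open>tanh(mt) - tanh((m - k)t)\<close>, which telescope to \<open>2k\<close>. The index \<open>k = 0\<close> contributes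
  the squares.
\<close>

lemma sech_series_square:
  assumes x: "x \<noteq> 0" "norm x < 1"
  shows "sech_series x ^ 2 = (\<Sum>\<^sub>\<infinity>k. 2 * of_int k * lcsch x k) + (\<Sum>\<^sub>\<infinity>m. lsech x m ^ 2)"
proof -
  have p: "((\<lambda>(m, n). lsech x m * lsech x n) has_sum (sech_series x ^ 2)) (UNIV \<times> UNIV)"
    unfolding power2_eq_square by (intro has_sum_times_complex has_sum_sech_series x)
  have p': "((\<lambda>(k, m). lsech x m * lsech x (k - m)) has_sum (sech_series x ^ 2)) (UNIV \<times> UNIV)"
    by (rule iffD2[OF has_sum_reindex_bij_witness[where j = "\<lambda>(k, m). (m, k - m)" and i
        = "\<lambda>(m, n). (m + n, m)"] p]) auto
  define Q where "Q = (\<Sum>\<^sub>\<infinity>m. lsech x m ^ 2)"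
  define g where "g k = 2 * of_int k * lcsch x k + (if k = 0 then Q else 0)" for k
  have fib: "((\<lambda>m. lsech x m * lsech x (k - m)) has_sum g k) UNIV" for k
  proof (cases "k = 0")
    case True
    have "(\<lambda>m. lsech x m * lsech x (k - m)) summable_on UNIV"
      using summable_on_SigmaD1[of "\<lambda>k m. lsech x m * lsech x (k - m)" UNIV "\<lambda>_. UNIV" k] p'
      by (auto simp: summable_on_def)
    then show ?thesis using True
      by (simp add: g_def Q_def power2_eq_square)
  next
    case False
    have "((\<lambda>m. (ltanh x (1 * m + 0) - ltanh x (1 * (m - k) + 0)) * lcsch x k)
        has_sum (2 * of_int k * lcsch x k)) UNIV"
      by (intro has_sum_cmult_left ltanh_telescoping x) auto
    moreover have "lsech x m * lsech x (k - m)
        = (ltanh x (1 * m + 0) - ltanh x (1 * (m - k) + 0)) * lcsch x k" for m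
      using lsech_mult[OF x, of m "k - m"] False ltanh_minus[of x "k - m"] by simp
    ultimately show ?thesis using False by (simp add: g_def)
  qed
  have "(g has_sum (sech_series x ^ 2)) UNIV"
    by (rule has_sum_SigmaD[OF p']) (use fib in auto)
  moreover have "(g has_sum ((\<Sum>\<^sub>\<infinity>k. 2 * of_int k * lcsch x k) + Q)) UNIV"
  proof -
    have "(\<lambda>k. 2 * (of_int k * lcsch x k)) summable_on UNIV"
      using summable_lcsch[OF x, of 1] by (intro summable_on_cmult_right) simp
    then have "((\<lambda>k. 2 * of_int k * lcsch x k) has_sum (\<Sum>\<^sub>\<infinity>k. 2 * of_int k * lcsch x k)) UNIV"
      by (simp add: mult.assoc)
    moreover have "((\<lambda>k. if k = 0 then Q else 0) has_sum Q) (UNIV::int set)"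
      by (rule has_sum_finite_neutralI[of "{0}"]) auto
    ultimately show ?thesis unfolding g_def by (rule has_sum_add)
  qed
  ultimately show ?thesis unfolding Q_def by (rule has_sum_unique)
qed

text \<open>
  Weight the products of terms with an even index \<open>2n\<close> and an odd index \<open>2d + 1\<close> by the sum of the
  two indices. The contribution of \<open>2n\<close> vanishes by symmetry, which leaves the left-hand side.
  Summed by the value \<open>c\<close> of \<open>2n + 2d + 1\<close>, the terms \<open>coth\<close> cancel between opposite odd indices and
  the terms \<open>tanh\<close> telescope to \<open>c\<close>.
\<close>

lemma sech_csch_convolution:
  assumes x: "x \<noteq> 0" "norm x < 1"
  shows "(\<Sum>\<^sub>\<infinity>n. lsech x (2 * n)) * (\<Sum>\<^sub>\<infinity>n. of_int (2 * n + 1) * lcsch x (2 * n + 1))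
    = (\<Sum>\<^sub>\<infinity>n. of_int (2 * n + 1) ^ 2 * lsech x (2 * n + 1))"
proof -
  have ev: "(\<lambda>n. of_int (2 * n) ^ k * lsech x (2 * n)) summable_on UNIV" if "k \<le> 2" for k
    using summable_on_reindex[of "\<lambda>n. 2 * n" UNIV "\<lambda>n. of_int n ^ k * lsech x n"] summable_lsech[OF x that]
    by (auto simp: inj_def o_def)
  have od: "(\<lambda>n. of_int (2 * n + 1) ^ k * lcsch x (2 * n + 1)) summable_on UNIV" if "k \<le> 2" for k
    using summable_on_reindex[of "\<lambda>n. 2 * n + 1" UNIV "\<lambda>n. of_int n ^ k
        * lcsch x n"] summable_lcsch[OF x that]
    by (auto simp: inj_def o_def)
  define D where "D = (\<Sum>\<^sub>\<infinity>n. lsech x (2 * n))"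
  define K where "K = (\<Sum>\<^sub>\<infinity>n. of_int (2 * n + 1) * lcsch x (2 * n + 1))"
  define K0 where "K0 = (\<Sum>\<^sub>\<infinity>n. lcsch x (2 * n + 1))"
  have D: "((\<lambda>n. lsech x (2 * n)) has_sum D) UNIV" using ev[of 0] by (simp add: D_def)
  have K: "((\<lambda>n. of_int (2 * n + 1) * lcsch x (2 * n + 1)) has_sum K) UNIV" using od[of 1]
      by (simp add: K_def)
  have K0: "((\<lambda>n. lcsch x (2 * n + 1)) has_sum K0) UNIV" using od[of 0] by (simp add: K0_def)
  \<comment> \<open>an odd function of \<open>n\<close>\<close>
  have Z: "((\<lambda>n. of_int (2 * n) * lsech x (2 * n)) has_sum 0) UNIV"
  proof -
    obtain z where z: "((\<lambda>n. of_int (2 * n) * lsech x (2 * n)) has_sum z) UNIV"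
      using ev[of 1] by (auto simp: summable_on_def)
    have "((\<lambda>n. of_int (2 * (- n)) * lsech x (2 * (- n))) has_sum z) UNIV"
      using z by (subst has_sum_reindex_bij_witness[of UNIV uminus uminus UNIV "\<lambda>n. of_int (2 * n)
          * lsech x (2 * n)"]) auto
    then have "((\<lambda>n. - (of_int (2 * n) * lsech x (2 * n))) has_sum z) UNIV"
      by (simp add: lsech_def add.commute)
    with has_sum_uminusI[OF z] have "z = - z" by (metis has_sum_unique)
    then show ?thesis using z by simp
  qed
  have "((\<lambda>(n, d). lsech x (2 * n) * (of_int (2 * d + 1) * lcsch x (2 * d + 1))
            + of_int (2 * n) * lsech x (2 * n) * lcsch x (2 * d + 1))
                has_sum (D * K + 0 * K0)) (UNIV \<times> UNIV)"
    using has_sum_add[OF has_sum_times_complex[OF D K] has_sum_times_complex[OF Z K0]]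
    by (simp add: case_prod_unfold)
  then have p: "((\<lambda>(n, d). of_int (2 * (n + d) + 1) * (lsech x (2 * n) * lcsch x (2 * d + 1)))
      has_sum (D * K)) (UNIV \<times> UNIV)"
    by (simp add: algebra_simps)
  have p': "((\<lambda>(c, d). of_int (2 * c + 1) * (lsech x (2 * (c - d)) * lcsch x (2 * d + 1)))
      has_sum (D * K)) (UNIV \<times> UNIV)"
    by (rule iffD2[OF has_sum_reindex_bij_witness[where j = "\<lambda>(c, d). (c - d, d)" and i
        = "\<lambda>(n, d). (n + d, d)"] p]) auto
  have fib: "((\<lambda>d. of_int (2 * c + 1) * (lsech x (2 * (c - d)) * lcsch x (2 * d + 1))) has_sum
      (of_int (2 * c + 1) ^ 2 * lsech x (2 * c + 1))) UNIV" for c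
  proof -
    define h where "h d = lsech x (2 * (c - d)) * lcsch x (2 * d + 1)" for d
    have "h summable_on UNIV"
    proof -
      have "(\<lambda>d. of_int (2 * c + 1) * h d) summable_on UNIV"
        using summable_on_SigmaD1[of "\<lambda>c d. of_int (2 * c + 1) * (lsech x (2 * (c - d)) * lcsch x (2
            * d + 1))" UNIV "\<lambda>_. UNIV" c] p'
        by (auto simp: summable_on_def h_def)
      moreover have "of_int (2 * c + 1) \<noteq> (0 :: complex)" by (subst of_int_eq_0_iff) presburger
      ultimately show ?thesis by (subst (asm) summable_on_cmult_right')
    qed
    then obtain S where S: "(h has_sum S) UNIV" by (auto simp: summable_on_def)
    \<comment> \<open>\<open>d \<mapsto> - d - 1\<close> changes the sign of the odd index \<open>2 * d + 1\<close>\<close>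
    have S': "((\<lambda>d. h (- d - 1)) has_sum S) UNIV"
      using S by (subst has_sum_reindex_bij_witness[of UNIV "\<lambda>d. - d - 1" "\<lambda>d. - d - 1" UNIV h]) auto
    have h2: "h d + h (- d - 1) = (ltanh x (2 * d + (2 * c + 2)) - ltanh x (2 * (d - (2 * c + 1)) + (2
        * c + 2))) * lsech x (2 * c + 1)" for d
    proof -
      have "h d = (ltanh x (2 * (c - d)) + 1 / ltanh x (2 * d + 1)) * lsech x (2 * c + 1)"
        unfolding h_def by (subst lsech_lcsch_mult[OF x]) (presburger, simp add: algebra_simps)
      moreover have "h (- d - 1) = (ltanh x (2 * d + (2 * c + 2)) + 1 / ltanh x (- (2 * d + 1)))
          * lsech x (2 * c + 1)"
        unfolding h_def by (subst lsech_lcsch_mult[OF x]) (presburger, simp add: algebra_simps)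
      moreover have "ltanh x (2 * (c - d)) = - ltanh x (2 * (d - (2 * c + 1)) + (2 * c + 2))"
        by (subst ltanh_minus[symmetric]) (simp add: algebra_simps)
      moreover have "(- A + 1 / T) * s + (B + 1 / - T) * s = (B - A) * s" for A B T s :: complex
        by (simp add: algebra_simps)
      ultimately show ?thesis by (simp only: ltanh_minus)
    qed
    have "((\<lambda>d. h d + h (- d - 1)) has_sum (2 * of_int (2 * c + 1) * lsech x (2 * c + 1))) UNIV"
      unfolding h2 by (intro has_sum_cmult_left ltanh_telescoping x) auto
    with has_sum_add[OF S S'] have "S + S = 2 * of_int (2 * c + 1) * lsech x (2 * c + 1)"
        by (metis has_sum_unique)
    then have "2 * S = 2 * (of_int (2 * c + 1) * lsech x (2 * c + 1))"
        by (simp only: mult_2[of S] mult.assoc)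
    then have "S = of_int (2 * c + 1) * lsech x (2 * c + 1)" by (simp only: mult_cancel_left) simp
    with has_sum_cmult_right[OF S, of "of_int (2 * c + 1)"] show ?thesis
      by (simp add: h_def power2_eq_square mult_ac)
  qed
  have "((\<lambda>c. of_int (2 * c + 1) ^ 2 * lsech x (2 * c + 1)) has_sum (D * K)) UNIV"
    by (rule has_sum_SigmaD[OF p']) (use fib in auto)
  then show ?thesis by (simp add: infsumI D_def K_def)
qed

lemma lsech_uminus: "lsech (- x) n = (if even n then 1 else -1) * lsech x n"
proof -
  have "(- x) powi n + (- x) powi (- n) = (if even n then 1 else -1) * (x powi n + x powi (- n))"
    by (simp add: power_int_minus_left)
  then show ?thesis unfolding lsech_def by (cases "even n") (simp_all only: if_True if_False
      divide_minus_right mult_1 mult_minus1)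
qed

lemma lcsch_uminus: "lcsch (- x) n = (if even n then 1 else -1) * lcsch x n"
proof -
  have "(- x) powi (- n) - (- x) powi n = (if even n then 1 else -1) * (x powi (- n) - x powi n)"
    by (simp add: power_int_minus_left)
  then show ?thesis unfolding lcsch_def by (cases "even n") (simp_all only: if_True if_False
      divide_minus_right mult_1 mult_minus1)
qed

lemma lsech_power: "lsech (x ^ k) n = lsech x (int k * n)"
  by (simp add: lsech_def power_int_power)

text \<open>Its counterpart for the even indices is \<open>sech_series (x^2)\<close>.\<close>

definition sech_odd :: "complex \<Rightarrow> complex" where
  "sech_odd x = (\<Sum>\<^sub>\<infinity>n. lsech x (2 * n + 1))"

lemma has_sum_sech_odd:
  assumes x: "x \<noteq> 0" "norm x < 1"
  shows "((\<lambda>n. lsech x (2 * n + 1)) has_sum sech_odd x) UNIV"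
  using summable_on_reindex[of "\<lambda>n. 2 * n + 1" UNIV "lsech x"] summable_lsech[OF x, of 0]
  by (auto simp: inj_def o_def sech_odd_def)

lemma has_sum_sech_even:
  assumes x: "x \<noteq> 0" "norm x < 1"
  shows "((\<lambda>n. lsech x (2 * n)) has_sum sech_series (x ^ 2)) UNIV"
proof -
  have "lsech (x ^ 2) = (\<lambda>n. lsech x (2 * n))" by (simp add: fun_eq_iff lsech_power)
  then show ?thesis using has_sum_sech_series[OF unit_disc_power(1,2)[OF x, of 2]] by simp
qed

lemma sech_series_split:
  assumes x: "x \<noteq> 0" "norm x < 1"
  shows "sech_series x = sech_series (x ^ 2) + sech_odd x"
  by (rule has_sum_unique[OF has_sum_sech_series[OF x]
        has_sum_even_odd_int[OF has_sum_sech_even[OF x] has_sum_sech_odd[OF x]]])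

lemma sech_series_minus:
  assumes x: "x \<noteq> 0" "norm x < 1"
  shows "sech_series (- x) = sech_series (x ^ 2) - sech_odd x"
proof -
  have "sech_odd (- x) = - sech_odd x"
    unfolding sech_odd_def using x by (simp add: lsech_uminus infsum_uminus)
  then show ?thesis using sech_series_split[of "- x"] x by simp
qed

text \<open>
  Replacing \<open>x\<close> by \<open>-x\<close> changes the sign of the odd terms only. So the product is a quarter of
  \<open>f(x)^2 - f(-x)^2\<close>, which the formula for the square of \<open>f = sech_series\<close> evaluates.
\<close>

lemma sech_even_times_odd:
  assumes x: "x \<noteq> 0" "norm x < 1"
  shows "sech_series (x ^ 2) * sech_odd x = (\<Sum>\<^sub>\<infinity>n. of_int (2 * n + 1) * lcsch x (2 * n + 1))"
proof -
  define K where "K = (\<Sum>\<^sub>\<infinity>n. of_int (2 * n + 1) * lcsch x (2 * n + 1))"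
  define L where "L = (\<Sum>\<^sub>\<infinity>n. of_int (2 * n) * lcsch x (2 * n))"
  have K: "((\<lambda>n. of_int (2 * n + 1) * lcsch x (2 * n + 1)) has_sum K) UNIV"
    using summable_on_reindex[of "\<lambda>n. 2 * n + 1" UNIV "\<lambda>n. of_int n * lcsch x n"] summable_lcsch[OF x, of 1]
    by (auto simp: inj_def o_def K_def)
  have L: "((\<lambda>n. of_int (2 * n) * lcsch x (2 * n)) has_sum L) UNIV"
    using summable_on_reindex[of "\<lambda>n. 2 * n" UNIV "\<lambda>n. of_int n * lcsch x n"] summable_lcsch[OF x, of 1]
    by (auto simp: inj_def o_def L_def)
  have "((\<lambda>n. of_int n * lcsch x n) has_sum (L + K)) UNIV"
    by (rule has_sum_even_odd_int[OF L K])
  from has_sum_cmult_right[OF this, of 2]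
  have p: "(\<Sum>\<^sub>\<infinity>k. 2 * of_int k * lcsch x k) = 2 * (L + K)" by (intro infsumI) (simp add: mult.assoc)
  have K': "((\<lambda>n. of_int (2 * n + 1) * lcsch (- x) (2 * n + 1)) has_sum (- K)) UNIV"
    using has_sum_uminusI[OF K] x by (simp add: lcsch_uminus)
  have L': "((\<lambda>n. of_int (2 * n) * lcsch (- x) (2 * n)) has_sum L) UNIV"
    using L x by (simp add: lcsch_uminus)
  have "((\<lambda>n. of_int n * lcsch (- x) n) has_sum (L + - K)) UNIV"
    by (rule has_sum_even_odd_int[OF L' K'])
  from has_sum_cmult_right[OF this, of 2]
  have m: "(\<Sum>\<^sub>\<infinity>k. 2 * of_int k * lcsch (- x) k) = 2 * (L - K)" by (intro infsumI) (simp add: mult.assoc)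
  have sq: "lsech (- x) n ^ 2 = lsech x n ^ 2" for n using x by (simp add: lsech_uminus)
  have "sech_series x ^ 2 - sech_series (- x) ^ 2 = 4 * K"
    using sech_series_square[OF x] sech_series_square[of "- x"] x unfolding p m sq by simp
  then have "4 * (sech_series (x ^ 2) * sech_odd x) = 4 * K"
    unfolding sech_series_split[OF x] sech_series_minus[OF x] by (simp add: power2_eq_square algebra_simps)
  then show ?thesis by (simp add: K_def)
qed

text \<open>
  \<open>sech_csch_convolution\<close> leaves the series of \<open>d / sinh(dt)\<close> over odd \<open>d\<close>, which
  \<open>sech_even_times_odd\<close> splits once more.
\<close>

lemma sech_odd_square_weights:
  assumes x: "x \<noteq> 0" "norm x < 1"
  shows "(\<Sum>\<^sub>\<infinity>n. of_int (2 * n + 1) ^ 2 * lsech x (2 * n + 1)) = sech_series (x ^ 2) ^ 2 * sech_odd x"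
  using sech_csch_convolution[OF x] sech_even_times_odd[OF x] infsumI[OF has_sum_sech_even[OF x]]
  by (simp add: power2_eq_square mult.assoc)

section \<open>Uniqueness of power series\<close>

text \<open>
  Values at the origin are left out, so that \<open>F\<close> may be given by a formula with negative powers of
  its argument.
\<close>

definition power_series_of :: "(nat \<Rightarrow> complex) \<Rightarrow> (complex \<Rightarrow> complex) \<Rightarrow> bool" where
  "power_series_of a F \<longleftrightarrow> (\<forall>x. x \<noteq> 0 \<longrightarrow> norm x < 1 \<longrightarrow> ((\<lambda>n. a n * x ^ n) has_sum F x) UNIV)"

lemma power_series_ofD: "power_series_of a F \<Longrightarrow> x \<noteq> 0 \<Longrightarrow> norm x < 1 \<Longrightarrow> ((\<lambda>n. a n * x ^ n) has_sum F x) UNIV"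
  by (auto simp: power_series_of_def)

lemma power_series_of_cong:
  "power_series_of a F \<Longrightarrow> (\<And>x. x \<noteq> 0 \<Longrightarrow> norm x < 1 \<Longrightarrow> F x = G x) \<Longrightarrow> power_series_of a G"
  by (auto simp: power_series_of_def)

text \<open>
  After multiplication with the variable, the two sums also agree at the origin and the identity
  theorem for formal power series applies.
\<close>

lemma power_series_of_unique:
  assumes a: "power_series_of a F" and b: "power_series_of b F"
  shows "a = b"
proof -
  have conv: "fps_conv_radius (fps_X * Abs_fps c) > 0"
    and ev: "z \<noteq> 0 \<Longrightarrow> norm z < 1 / 2 \<Longrightarrow> eval_fps (fps_X * Abs_fps c) z = z * F z"
    if c: "power_series_of c F" for c z
  proof -
    have "summable (\<lambda>n. c n * (1 / 2) ^ n)"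
      by (rule sums_summable[OF has_sum_imp_sums[OF power_series_ofD[OF c]]]) simp_all
    then have "conv_radius c \<ge> ereal (norm (1 / 2 :: complex))" by (rule conv_radius_geI)
    then have r: "fps_conv_radius (Abs_fps c) \<ge> ereal (1 / 2)" by (simp add: fps_conv_radius_def)
    then show "fps_conv_radius (fps_X * Abs_fps c) > 0"
      using fps_conv_radius_mult[of fps_X "Abs_fps c"] less_le_trans[of 0 "ereal (1 / 2)"]
          by (simp add: order.trans)
    assume z: "z \<noteq> 0" "norm z < 1 / 2"
    have "eval_fps (fps_X * Abs_fps c) z = eval_fps fps_X z * eval_fps (Abs_fps c) z"
      using z r by (intro eval_fps_mult) (auto intro: less_le_trans[rotated])
    also have "eval_fps (Abs_fps c) z = F z"
      using has_sum_imp_sums[OF power_series_ofD[OF c z(1)]] z by (simp add: eval_fps_def sums_iff)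
    finally show "eval_fps (fps_X * Abs_fps c) z = z * F z" by simp
  qed
  have "fps_X * Abs_fps a = fps_X * Abs_fps b"
  proof (rule eval_fps_eqD)
    have "eval_fps (fps_X * Abs_fps a) z = eval_fps (fps_X * Abs_fps b) z" if "norm z < 1 / 2" for z
      using ev[OF a _ that] ev[OF b _ that] by (cases "z = 0") (simp_all add: eval_fps_at_0)
    then show "\<forall>\<^sub>F z in nhds 0. eval_fps (fps_X * Abs_fps a) z = eval_fps (fps_X * Abs_fps b) z"
      unfolding eventually_nhds_metric by (intro exI[of _ "1 / 2"]) auto
  qed (use conv a b in auto)
  then have "Abs_fps a = Abs_fps b" by (simp only: mult_cancel_left) simp
  then show "a = b" by (simp add: fps_eq_iff fun_eq_iff)
qed

text \<open>
  Terms with the same exponent are collected. The sum over a fibre exists because a subfamily of a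
  summable family is summable and \<open>x^n \<noteq> 0\<close> is constant on the fibre.
\<close>

lemma power_series_of_collect:
  fixes c :: "'i \<Rightarrow> complex" and e :: "'i \<Rightarrow> nat"
  assumes "\<And>x. x \<noteq> 0 \<Longrightarrow> norm x < 1 \<Longrightarrow> ((\<lambda>i. c i * x ^ e i) has_sum F x) I"
  shows "power_series_of (\<lambda>n. \<Sum>\<^sub>\<infinity>i\<in>{i \<in> I. e i = n}. c i) F"
  unfolding power_series_of_def
proof safe
  fix x :: complex assume x: "x \<noteq> 0" "norm x < 1"
  note S = assms[OF x]
  have S': "((\<lambda>(n, i). c i * x ^ e i) has_sum F x) (SIGMA n:UNIV. {i \<in> I. e i = n})"
    by (rule iffD2[OF has_sum_reindex_bij_witness[where j = snd and i = "\<lambda>i. (e i, i)"] S]) auto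
  show "((\<lambda>n. (\<Sum>\<^sub>\<infinity>i\<in>{i \<in> I. e i = n}. c i) * x ^ n) has_sum F x) UNIV"
  proof (rule has_sum_SigmaD[OF S'])
    fix n
    have "(\<lambda>i. c i * x ^ e i) summable_on {i \<in> I. e i = n}"
      using has_sum_imp_summable[OF S] by (rule summable_on_subset) auto
    then have "(\<lambda>i. c i * x ^ n) summable_on {i \<in> I. e i = n}"
      by (subst (asm) summable_on_cong[where g = "\<lambda>i. c i * x ^ n"]) auto
    then have "c summable_on {i \<in> I. e i = n}"
      using x by (subst (asm) summable_on_cmult_left') auto
    then have "((\<lambda>i. c i * x ^ n) has_sum ((\<Sum>\<^sub>\<infinity>i\<in>{i \<in> I. e i = n}. c i) * x ^ n)) {i \<in> I. e i = n}"
      by (intro has_sum_cmult_left has_sum_infsum)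
    then show "((\<lambda>i. case (n, i) of (n, i) \<Rightarrow> c i * x ^ e i) has_sum ((\<Sum>\<^sub>\<infinity>i\<in>{i \<in> I. e i
        = n}. c i) * x ^ n)) {i \<in> I. e i = n}"
      by (subst has_sum_cong[where g = "\<lambda>i. c i * x ^ n"]) auto
  qed
qed

lemma power_series_of_add:
  "power_series_of a F \<Longrightarrow> power_series_of b G \<Longrightarrow> power_series_of (\<lambda>n. a n + b n) (\<lambda>x. F x + G x)"
  by (auto simp: power_series_of_def distrib_right intro!: has_sum_add)

lemma power_series_of_cmult:
  "power_series_of a F \<Longrightarrow> power_series_of (\<lambda>n. c * a n) (\<lambda>x. c * F x)"
  by (auto simp: power_series_of_def mult.assoc intro!: has_sum_cmult_right)

lemma power_series_of_one: "power_series_of (\<lambda>n. if n = 0 then 1 else 0) (\<lambda>x. 1)"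
  unfolding power_series_of_def by (auto intro!: has_sum_finite_neutralI[of "{0}"] split: if_splits)

lemma power_series_of_mult:
  assumes "power_series_of a F" "power_series_of b G"
  shows "power_series_of (\<lambda>n. \<Sum>i\<le>n. a i * b (n - i)) (\<lambda>x. F x * G x)"
proof -
  have "power_series_of (\<lambda>n. \<Sum>\<^sub>\<infinity>p\<in>{p \<in> UNIV \<times> UNIV. fst p + snd p
      = n}. a (fst p) * b (snd p)) (\<lambda>x. F x * G x)"
  proof (rule power_series_of_collect)
    fix x :: complex assume x: "x \<noteq> 0" "norm x < 1"
    show "((\<lambda>p. a (fst p) * b (snd p) * x ^ (fst p + snd p)) has_sum (F x * G x)) (UNIV \<times> UNIV)"
      using has_sum_times_complex[OF power_series_ofD[OF assms(1) x] power_series_ofD[OF assms(2) x]]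
      by (simp add: case_prod_unfold power_add mult_ac)
  qed
  moreover have "(\<Sum>\<^sub>\<infinity>p\<in>{p \<in> UNIV \<times> UNIV. fst p + snd p = n}. a (fst p) * b (snd p))
      = (\<Sum>i\<le>n. a i * b (n - i))" for n
  proof -
    have "{p \<in> UNIV \<times> UNIV. fst p + snd p = n} = (\<lambda>i. (i, n - i)) ` {..n}" by (auto simp: image_iff)
    moreover have "inj_on (\<lambda>i. (i, n - i)) {..n}" by (auto simp: inj_on_def)
    ultimately show ?thesis by (simp add: sum.reindex o_def)
  qed
  ultimately show ?thesis by simp
qed

lemma power_series_of_minus:
  assumes "power_series_of a F"
  shows "power_series_of (\<lambda>n. (-1) ^ n * a n) (\<lambda>x. F (- x))"
  unfolding power_series_of_def
proof safe
  fix x :: complex assume x: "x \<noteq> 0" "norm x < 1"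
  have "((\<lambda>n. a n * (- x) ^ n) has_sum F (- x)) UNIV"
    using x by (intro power_series_ofD[OF assms]) auto
  then show "((\<lambda>n. (-1) ^ n * a n * x ^ n) has_sum F (- x)) UNIV"
    by (simp add: power_minus[of x] mult_ac)
qed

lemma power_series_of_square_argument:
  assumes "power_series_of a F"
  shows "power_series_of (\<lambda>n. if even n then a (n div 2) else 0) (\<lambda>x. F (x ^ 2))"
proof -
  have "power_series_of (\<lambda>n. \<Sum>\<^sub>\<infinity>i\<in>{i \<in> UNIV. 2 * i = n}. a i) (\<lambda>x. F (x ^ 2))"
  proof (rule power_series_of_collect)
    fix x :: complex assume x: "x \<noteq> 0" "norm x < 1"
    show "((\<lambda>i. a i * x ^ (2 * i)) has_sum (F (x ^ 2))) UNIV"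
      using power_series_ofD[OF assms unit_disc_power(1,2)[OF x, of 2]] by (simp add: power_mult)
  qed
  moreover have "(\<Sum>\<^sub>\<infinity>i\<in>{i \<in> UNIV. 2 * i = n}. a i) = (if even n then a (n div 2) else 0)" for n
  proof (cases "even n")
    case True
    then have "{i \<in> UNIV. 2 * i = n} = {n div 2}" by auto
    then show ?thesis using True by simp
  next
    case False
    then have "{i \<in> UNIV. 2 * i = n} = {}" by auto
    then show ?thesis using False by (simp only:) simp
  qed
  ultimately show ?thesis by simp
qed

text \<open>
  For the coefficients \<open>c(n)\<close> of \<open>F\<close> the first equation says \<open>c(2n) = c(n)\<close>. The second one
  expresses the coefficient of \<open>x^(2n)\<close> in \<open>F^2\<close> through that of \<open>x^n\<close>; for \<open>n \<ge> 2\<close> the former is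
  \<open>8 c(2n - 1)\<close> plus terms in coefficients of smaller index and \<open>c(2n) = c(n)\<close>, so it determines
  \<open>c(2n - 1)\<close>. Here \<open>c(1) \<noteq> 0\<close> is essential.
\<close>

lemma functional_equations_determine_series:
  assumes a: "power_series_of a F" "a 0 = 1" "a 1 = 4"
    and b: "power_series_of b G" "b 0 = 1" "b 1 = 4"
    and F: "\<And>x. x \<noteq> 0 \<Longrightarrow> norm x < 1 \<Longrightarrow> F x + F (- x) = 2 * F (x ^ 2)"
       "\<And>x. x \<noteq> 0 \<Longrightarrow> norm x < 1 \<Longrightarrow> F x ^ 2 + F (- x) ^ 2 = 4 * F (x ^ 2) ^ 2 - 2 * F (- (x ^ 2)) ^ 2"
    and G: "\<And>x. x \<noteq> 0 \<Longrightarrow> norm x < 1 \<Longrightarrow> G x + G (- x) = 2 * G (x ^ 2)"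
       "\<And>x. x \<noteq> 0 \<Longrightarrow> norm x < 1 \<Longrightarrow> G x ^ 2 + G (- x) ^ 2 = 4 * G (x ^ 2) ^ 2 - 2 * G (- (x ^ 2)) ^ 2"
  shows "a = b"
proof -
  have rec: "c (2 * n) = c n"
      "(\<Sum>i\<le>2 * n. c i * c (2 * n - i)) = (2 - (-1) ^ n) * (\<Sum>i\<le>n. c i * c (n - i))"
    if c: "power_series_of c H"
      and H: "\<And>x. x \<noteq> 0 \<Longrightarrow> norm x < 1 \<Longrightarrow> H x + H (- x) = 2 * H (x ^ 2)"
       "\<And>x. x \<noteq> 0 \<Longrightarrow> norm x < 1 \<Longrightarrow> H x ^ 2 + H (- x) ^ 2 = 4 * H (x ^ 2) ^ 2 - 2 * H (- (x ^ 2)) ^ 2"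
    for c H n
  proof -
    have "power_series_of (\<lambda>n. c n + (-1) ^ n * c n) (\<lambda>x. 2 * H (x ^ 2))"
      by (rule power_series_of_cong[OF power_series_of_add[OF c power_series_of_minus[OF c]]]) (rule H(1))
    moreover have "power_series_of (\<lambda>n. 2 * (if even n then c (n div 2) else 0)) (\<lambda>x. 2 * H (x ^ 2))"
      by (intro power_series_of_cmult power_series_of_square_argument c)
    ultimately have "(\<lambda>n. c n + (-1) ^ n * c n) = (\<lambda>n. 2 * (if even n then c (n div 2) else 0))"
      by (rule power_series_of_unique)
    from fun_cong[OF this, of "2 * n"] show "c (2 * n) = c n" by simp
    define d where "d n = (\<Sum>i\<le>n. c i * c (n - i))" for n
    have d: "power_series_of d (\<lambda>x. H x ^ 2)"
      using power_series_of_mult[OF c c] by (simp add: d_def[abs_def] power2_eq_square)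
    have "power_series_of (\<lambda>n. d n + (-1) ^ n * d n) (\<lambda>x. 4 * H (x ^ 2) ^ 2 + (-2) * H (- (x ^ 2)) ^ 2)"
      by (rule power_series_of_cong[OF power_series_of_add[OF d power_series_of_minus[OF d]]]) (simp
          add: H(2))
    moreover have "power_series_of (\<lambda>n. 4 * (if even n then d (n div 2) else 0) + (-2)
        * (if even n then (-1) ^ (n div 2) * d (n div 2) else 0))
         (\<lambda>x. 4 * H (x ^ 2) ^ 2 + (-2) * H (- (x ^ 2)) ^ 2)"
      by (intro power_series_of_add power_series_of_cmult power_series_of_square_argument[OF d]
          power_series_of_square_argument[OF power_series_of_minus[OF d]])
    ultimately have "(\<lambda>n. d n + (-1) ^ n * d n)
        = (\<lambda>n. 4 * (if even n then d (n div 2) else 0) + (-2) * (if even n then (-1) ^ (n div 2)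
        * d (n div 2) else 0))"
      by (rule power_series_of_unique)
    from fun_cong[OF this, of "2 * n"] have "2 * d (2 * n) = 2 * ((2 - (-1) ^ n) * d n)"
        by (simp add: algebra_simps)
    then show "(\<Sum>i\<le>2 * n. c i * c (2 * n - i)) = (2 - (-1) ^ n) * (\<Sum>i\<le>n. c i * c (n - i))"
      by (simp only: mult_cancel_left d_def) simp
  qed
  note ra = rec[OF a(1) F] and rb = rec[OF b(1) G]
  have "a n = b n" for n
  proof (induction n rule: less_induct)
    case (less n)
    consider "n = 0" | "n = 1" | m where "n = 2 * m" "m > 0" | m where "n = 2 * m + 3"
    proof -
      have "n = 0 \<or> n = 1 \<or> (\<exists>m>0. n = 2 * m) \<or> (\<exists>m. n = 2 * m + 3)" by presburger
      then show ?thesis using that by blast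
    qed
    then show ?case
    proof cases
      case 3 then show ?thesis using less[of m] ra(1)[of m] rb(1)[of m] by simp
    next
      case 4
      have split: "(\<Sum>i\<le>2 * (m + 2). c i * c (2 * (m + 2) - i)) =
          2 * c (m + 2) + 8 * c n + (\<Sum>i\<in>{2..2 * m + 2}. c i * c (2 * (m + 2) - i))"
        if "c 0 = 1" "c 1 = 4" "c (2 * (m + 2)) = c (m + 2)" for c :: "nat \<Rightarrow> complex"
      proof -
        have "{..2 * (m + 2)} = insert 0 (insert 1 (insert (2 * m + 3) (insert (2 * m + 4) {2..2 * m
            + 2})))" by auto
        then show ?thesis using that 4 by (simp add: eval_nat_numeral)
      qed
      have s: "(\<Sum>i\<in>{2..2 * m + 2}. a i * a (2 * (m + 2) - i))
          = (\<Sum>i\<in>{2..2 * m + 2}. b i * b (2 * (m + 2) - i))"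
        using 4 by (intro sum.cong refl arg_cong2[of _ _ _ _ "(*)"] less) auto
      have t: "(\<Sum>i\<le>m + 2. a i * a (m + 2 - i)) = (\<Sum>i\<le>m + 2. b i * b (m + 2 - i))"
        using 4 by (intro sum.cong refl arg_cong2[of _ _ _ _ "(*)"] less) auto
      have u: "a (m + 2) = b (m + 2)" using 4 by (intro less) simp
      have "2 * a (m + 2) + 8 * a n + (\<Sum>i\<in>{2..2 * m + 2}. a i * a (2 * (m + 2) - i)) =
            2 * b (m + 2) + 8 * b n + (\<Sum>i\<in>{2..2 * m + 2}. b i * b (2 * (m + 2) - i))"
        using ra(2)[of "m + 2"] rb(2)[of "m + 2"] split[OF a(2,3) ra(1)] split[OF b(2,3) rb(1)] t by simp
      then show ?thesis unfolding s u by simp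
    qed (use a b in auto)
  qed
  then show ?thesis by (rule ext)
qed

section \<open>Lambert series as double series\<close>

text \<open>
  Absolute convergence follows from \<open>(k+1)(j+1) \<ge> (k+1) + j\<close>, which bounds the terms by those of a
  product of two simple series.
\<close>

lemma lambert_summable:
  fixes w z :: "nat \<Rightarrow> complex"
  assumes x: "x \<noteq> 0" "norm x < 1" and z: "\<And>j. norm (z j) \<le> 1"
    and w: "summable (\<lambda>k. norm (w k) * norm x ^ Suc k)"
  shows "(\<lambda>(k, j). w k * z j * x ^ (Suc k * Suc j)) summable_on UNIV \<times> UNIV"
proof -
  define r where "r = norm x"
  have r: "0 < r" "r < 1" using x by (auto simp: r_def)
  have "(\<lambda>k. complex_of_real (norm (w k) * r ^ Suc k)) summable_on UNIV"
    by (rule norm_summable_imp_summable_on) (use w r in \<open>simp add: r_def norm_mult norm_power del: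
        power_Suc\<close>)
  then obtain A where A: "((\<lambda>k. complex_of_real (norm (w k) * r ^ Suc k)) has_sum A) UNIV"
      by (auto simp: summable_on_def)
  have "(\<lambda>j. complex_of_real r ^ j) summable_on UNIV"
    by (rule norm_summable_imp_summable_on) (use r in \<open>simp add: norm_power summable_geometric\<close>)
  then obtain B where B: "((\<lambda>j. complex_of_real r ^ j) has_sum B) UNIV" by (auto simp: summable_on_def)
  have "(\<lambda>p. norm ((\<lambda>(k, j). complex_of_real (norm (w k) * r ^ Suc k) * complex_of_real r ^ j) p))
      summable_on UNIV \<times> UNIV"
    using has_sum_imp_summable[OF has_sum_times_complex[OF A B]]
    by (simp only: summable_on_iff_abs_summable_on_complex)
  then have "(\<lambda>p. norm ((\<lambda>(k, j). w k * z j * x ^ (Suc k * Suc j)) p)) summable_on UNIV \<times> UNIV"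
  proof (rule Infinite_Sum.abs_summable_on_comparison_test', safe)
    fix k j
    have "norm (w k) * norm (z j) * r ^ (Suc k * Suc j) \<le> norm (w k) * 1 * r ^ (Suc k + j)"
      using r z[of j] by (intro mult_mono power_decreasing) auto
    then show "norm (w k * z j * x ^ (Suc k * Suc j))
        \<le> norm (complex_of_real (norm (w k) * r ^ Suc k) * complex_of_real r ^ j)"
      using r by (simp only: norm_mult norm_power norm_of_real power_add r_def[symmetric]) (simp add:
          mult.assoc)
  qed
  then show ?thesis by (rule Infinite_Sum.abs_summable_summable)
qed

lemma summable_weight:
  assumes x: "norm (x::complex) < 1" and "\<And>k. norm (w k :: complex) \<le> 1 + real (Suc k) ^ 2"
  shows "summable (\<lambda>k. norm (w k) * norm x ^ Suc k)"
proof (rule summable_comparison_test')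
  show "summable (\<lambda>k. (1 + real (Suc k) ^ 2) * norm x ^ Suc k)"
    unfolding summable_Suc_iff[of "\<lambda>n. (1 + real n ^ 2) * norm x ^ n"] using x
        by (intro summable_square_geometric) auto
  show "norm (norm (w k) * norm x ^ Suc k) \<le> (1 + real (Suc k) ^ 2) * norm x ^ Suc k" if "0 \<le> k" for k
    using assms(2)[of k] by (simp add: mult_right_mono del: power_Suc of_nat_Suc)
qed

lemma chi_has_sum:
  fixes y :: complex
  assumes "norm y < 1"
  shows "((\<lambda>j. of_int (chi_4_2 (int (Suc j))) * y ^ Suc j) has_sum (y / (1 + y ^ 2))) UNIV"
proof -
  have n: "norm (- (y ^ 2)) < 1" using assms by (cases "y = 0") (auto simp: norm_power power_less_one_iff)
  then have "((\<lambda>i. (- (y ^ 2)) ^ i) has_sum (1 / (1 - (- (y ^ 2))))) UNIV"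
    by (intro norm_summable_imp_has_sum geometric_sums) (simp_all add: norm_power summable_geometric)
  from has_sum_cmult_right[OF this, of y]
  have s: "((\<lambda>i. y * (- (y ^ 2)) ^ i) has_sum (y / (1 + y ^ 2))) UNIV" by simp
  have t: "y * (- (y ^ 2)) ^ i = of_int (chi_4_2 (int (Suc (2 * i)))) * y ^ Suc (2 * i)" for i
  proof (cases "even i")
    case True
    then obtain k where "i = 2 * k" by (elim evenE)
    moreover have "chi_4_2 (int (Suc (2 * (2 * k)))) = 1" by (simp add: chi_4_2_def)
    ultimately show ?thesis by (simp add: power_mult)
  next
    case False
    then obtain k where "i = 2 * k + 1" by (elim oddE)
    moreover have "y * (- (y ^ 2)) ^ (2 * k + 1) = - (y ^ Suc (2 * (2 * k + 1)))"
      by (simp flip: power_mult power_add power_Suc)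
    moreover have "chi_4_2 (int (Suc (2 * (2 * k + 1)))) = -1" by (simp add: chi_4_2_def)
    ultimately show ?thesis by simp
  qed
  have "((\<lambda>j. of_int (chi_4_2 (int (Suc j))) * y ^ Suc j) has_sum (y / (1 + y ^ 2))) {j. even j}"
    by (rule iffD1[OF has_sum_reindex_bij_witness[where j = "\<lambda>i. 2 * i" and i
        = "\<lambda>j. j div 2"] s]) (auto simp: t simp del: power_Suc)
  moreover have "chi_4_2 (int (Suc j)) = 0" if "odd j" for j using that
      by (simp add: chi_4_2_def) presburger
  ultimately show ?thesis
    by (subst (asm) has_sum_cong_neutral[where T = UNIV and g
        = "\<lambda>j. of_int (chi_4_2 (int (Suc j))) * y ^ Suc j"]) auto
qed

section \<open>Two squares\<close>

text \<open>The generating function of the sum of divisors, as a Lambert series.\<close>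

definition sigma_series :: "complex \<Rightarrow> complex" where
  "sigma_series x = (\<Sum>\<^sub>\<infinity>e::nat. x ^ Suc e / (1 - x ^ Suc e) ^ 2)"

text \<open>The two forms arise by summing \<open>k x^(kj)\<close> over \<open>j\<close> first or over \<open>k\<close> first.\<close>

lemma has_sum_sigma_series:
  assumes x: "x \<noteq> 0" "norm x < 1"
  shows "((\<lambda>k. of_nat (Suc k) * (x ^ Suc k / (1 - x ^ Suc k))) has_sum sigma_series x) UNIV"
    and "((\<lambda>e. x ^ Suc e / (1 - x ^ Suc e) ^ 2) has_sum sigma_series x) UNIV"
proof -
  have "(\<lambda>(k, j). of_nat (Suc k) * 1 * x ^ (Suc k * Suc j)) summable_on UNIV \<times> UNIV"
  proof (rule lambert_summable[OF x])
    have "real (Suc k) \<le> 1 + real (Suc k) ^ 2" for k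
      using poly_weight_bound[of 1 "int (Suc k)"] by simp
    then show "summable (\<lambda>k. norm (of_nat (Suc k) :: complex) * norm x ^ Suc k)"
      by (intro summable_weight x) (simp only: norm_of_nat)
  qed simp
  then obtain S where S: "((\<lambda>(k, j). of_nat (Suc k) * x ^ (Suc k * Suc j)) has_sum S) (UNIV \<times> UNIV)"
    by (auto simp: summable_on_def simp del: of_nat_Suc)
  have a: "((\<lambda>k. of_nat (Suc k) * (x ^ Suc k / (1 - x ^ Suc k))) has_sum S) UNIV"
  proof (rule has_sum_SigmaD[OF S])
    fix k
    have "((\<lambda>j. of_nat (Suc k) * (x ^ Suc k) ^ Suc j)
        has_sum (of_nat (Suc k) * (x ^ Suc k / (1 - x ^ Suc k)))) UNIV"
      using x by (intro has_sum_cmult_right geometric_has_sum norm_power_Suc_less_1)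
    then show "((\<lambda>j. case (k, j) of (k, j) \<Rightarrow> of_nat (Suc k) * x ^ (Suc k * Suc j))
        has_sum (of_nat (Suc k) * (x ^ Suc k / (1 - x ^ Suc k)))) UNIV"
      by (simp only: prod.case power_mult)
  qed
  have S': "((\<lambda>(j, k). of_nat (Suc k) * x ^ (Suc k * Suc j)) has_sum S) (UNIV \<times> UNIV)"
    using S by (subst has_sum_swap) (simp add: case_prod_unfold)
  have b: "((\<lambda>j. x ^ Suc j / (1 - x ^ Suc j) ^ 2) has_sum S) UNIV"
  proof (rule has_sum_SigmaD[OF S'])
    fix j
    have "((\<lambda>k. of_nat (Suc k) * (x ^ Suc j) ^ Suc k) has_sum (x ^ Suc j / (1 - x ^ Suc j) ^ 2)) UNIV"
      using x by (intro geometric_derivative_has_sum norm_power_Suc_less_1)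
    then show "((\<lambda>k. case (j, k) of (j, k) \<Rightarrow> of_nat (Suc k) * x ^ (Suc k * Suc j))
        has_sum (x ^ Suc j / (1 - x ^ Suc j) ^ 2)) UNIV"
      by (simp only: prod.case power_mult[symmetric] mult.commute[of "Suc j"])
  qed
  have [simp]: "sigma_series x = S" unfolding sigma_series_def by (rule infsumI[OF b])
  show "((\<lambda>k. of_nat (Suc k) * (x ^ Suc k / (1 - x ^ Suc k))) has_sum sigma_series x) UNIV" using a by simp
  show "((\<lambda>e. x ^ Suc e / (1 - x ^ Suc e) ^ 2) has_sum sigma_series x) UNIV" using b by simp
qed

text \<open>
  Jacobi's series for sums of four squares. The terms \<open>k / sinh(kt)\<close> produce \<open>\<sigma>(x) - \<sigma>(x^2)\<close> since
  \<open>y / (1 - y^2) = y / (1 - y) - y^2 / (1 - y^2)\<close>, and the squares of \<open>1/cosh\<close> produce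
  \<open>\<sigma>(x^2) - 4 \<sigma>(x^4)\<close> since \<open>u / (1 + u)^2 = u / (1 - u)^2 - 4 u^2 / (1 - u^2)^2\<close>; here \<open>\<sigma>\<close> is
  \<open>sigma_series\<close>.
\<close>

lemma sech_series_square_sigma:
  assumes x: "x \<noteq> 0" "norm x < 1"
  shows "sech_series x ^ 2 = 1 + 8 * (sigma_series x - 4 * sigma_series (x ^ 4))"
proof -
  note U = has_sum_sigma_series
  have x2: "x ^ 2 \<noteq> 0" "norm (x ^ 2) < 1" and x4: "x ^ 4 \<noteq> 0" "norm (x ^ 4) < 1"
    using unit_disc_power[OF x, of 2] unit_disc_power[OF x, of 4] by auto
  have nz: "1 - x ^ Suc k \<noteq> 0" "1 + x ^ Suc k \<noteq> 0" "1 + (x ^ Suc k)^2 \<noteq> 0" "1 - (x ^ Suc k)^2 \<noteq> 0" for k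
  proof -
    have n: "norm (x ^ Suc k) < 1" by (rule norm_power_Suc_less_1[OF x(2)])
    then show "1 - x ^ Suc k \<noteq> 0" using power_neq_one[of "x ^ Suc k" 1] by auto
    show "1 + x ^ Suc k \<noteq> 0" using n by (metis add_eq_0_iff norm_minus_cancel norm_one less_irrefl)
    show "1 + (x ^ Suc k)^2 \<noteq> 0"
      using one_plus_powi_square_nonzero(1)[OF x, of "int (Suc k)"] unfolding power_int_of_nat .
    show "1 - (x ^ Suc k)^2 \<noteq> 0"
      using one_plus_powi_square_nonzero(2)[OF x, of "int (Suc k)"] unfolding power_int_of_nat by simp
  qed
  have 1: "(\<Sum>\<^sub>\<infinity>k. 2 * of_int k * lcsch x k) = 8 * (sigma_series x - sigma_series (x ^ 2))"
  proof -
    have "((\<lambda>k. 4 * (of_nat (Suc k) * (x ^ Suc k / (1 - x ^ Suc k)) - of_nat (Suc k)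
        * ((x ^ 2) ^ Suc k / (1 - (x ^ 2) ^ Suc k))))
        has_sum (4 * (sigma_series x - sigma_series (x ^ 2)))) UNIV"
      by (intro has_sum_cmult_right has_sum_diff U x x2)
    moreover have "4 * (of_nat (Suc k) * (x ^ Suc k / (1 - x ^ Suc k)) - of_nat (Suc k)
        * ((x ^ 2) ^ Suc k / (1 - (x ^ 2) ^ Suc k)))
        = 2 * of_int (int (Suc k)) * lcsch x (int (Suc k))" for k
    proof -
      define y where "y = x ^ Suc k"
      have y: "1 - y \<noteq> 0" "1 + y \<noteq> 0" using nz[of k] by (auto simp: y_def)
      have y2: "(x ^ 2) ^ Suc k = y ^ 2" unfolding y_def power_mult[symmetric] by (simp add: mult.commute)
      have lc: "lcsch x (int (Suc k)) = 2 * (y / (1 - y ^ 2))"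
        unfolding lsech_lcsch_ltanh_rational(2)[OF x] power_int_of_nat y_def by simp
      have yd: "y / (1 - y) - y ^ 2 / (1 - y ^ 2) = y / (1 - y ^ 2)"
      proof -
        have "1 - y ^ 2 = (1 - y) * (1 + y)" by (simp add: power2_eq_square algebra_simps)
        then show ?thesis using y by (simp add: divide_simps) (simp add: power2_eq_square algebra_simps)
      qed
      have "4 * (a * b - a * c) = 2 * a * (2 * d)" if "b - c = d" for a b c d :: complex
        using that by (simp flip: right_diff_distrib)
      from this[OF yd] show ?thesis unfolding y2 lc y_def[symmetric] of_int_of_nat_eq .
    qed
    ultimately have "((\<lambda>k. 2 * of_int (int (Suc k)) * lcsch x (int (Suc k)))
        has_sum (4 * (sigma_series x - sigma_series (x ^ 2)))) UNIV"
      by (simp only:)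
    from even_has_sum_int[of "\<lambda>k. 2 * of_int k * lcsch x k", OF _ this]
    have "((\<lambda>k. 2 * of_int k * lcsch x k)
        has_sum (0 + 2 * (4 * (sigma_series x - sigma_series (x ^ 2))))) UNIV"
      by simp
    then show ?thesis by (intro infsumI) simp
  qed
  have 2: "(\<Sum>\<^sub>\<infinity>m. lsech x m ^ 2) = 1 + 8 * (sigma_series (x ^ 2) - 4 * sigma_series (x ^ 4))"
  proof -
    have "((\<lambda>e. 4 * ((x ^ 2) ^ Suc e / (1 - (x ^ 2) ^ Suc e) ^ 2 - 4 * ((x ^ 4) ^ Suc e / (1
        - (x ^ 4) ^ Suc e) ^ 2)))
        has_sum (4 * (sigma_series (x ^ 2) - 4 * sigma_series (x ^ 4)))) UNIV"
      by (intro has_sum_cmult_right has_sum_diff U x4 x2)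
    moreover have "4 * ((x ^ 2) ^ Suc e / (1 - (x ^ 2) ^ Suc e) ^ 2 - 4 * ((x ^ 4) ^ Suc e / (1
        - (x ^ 4) ^ Suc e) ^ 2)) = lsech x (int (Suc e)) ^ 2" for e
    proof -
      define y where "y = x ^ Suc e"
      define u where "u = y ^ 2"
      have u: "1 - u \<noteq> 0" "1 + u \<noteq> 0" using nz[of e] by (auto simp: u_def y_def)
      have "(x ^ 2) ^ Suc e = u" "(x ^ 4) ^ Suc e = u ^ 2"
        unfolding u_def y_def power_mult[symmetric] by (rule arg_cong[of _ _ "power x"], simp)+
      moreover have "lsech x (int (Suc e)) = 2 * y / (1 + u)"
        unfolding lsech_lcsch_ltanh_rational(1)[OF x] power_int_of_nat y_def u_def ..
      moreover have "u / (1 - u) ^ 2 - 4 * (u ^ 2 / (1 - u ^ 2) ^ 2) = u / (1 + u) ^ 2"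
      proof -
        have e: "1 - u ^ 2 = (1 - u) * (1 + u)" by (simp add: power2_eq_square algebra_simps)
        have "u / (1 - u) ^ 2 - 4 * (u ^ 2 / (1 - u ^ 2) ^ 2)
            = (u * (1 + u)^2 - 4 * u ^ 2) / ((1 - u)^2 * (1 + u)^2)"
          unfolding e power_mult_distrib using u by (simp add: diff_divide_distrib)
        also have "u * (1 + u)^2 - 4 * u ^ 2 = u * (1 - u) ^ 2"
            by (simp add: power2_eq_square algebra_simps)
        finally show ?thesis using u by simp
      qed
      moreover have "(2 * y / (1 + u)) ^ 2 = 4 * (u / (1 + u) ^ 2)"
          by (simp add: u_def power_divide power_mult_distrib)
      ultimately show ?thesis by (simp only:)
    qed
    ultimately have "((\<lambda>e. lsech x (int (Suc e)) ^ 2)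
        has_sum (4 * (sigma_series (x ^ 2) - 4 * sigma_series (x ^ 4)))) UNIV"
      by (simp only:)
    from even_has_sum_int[of "\<lambda>k. lsech x k ^ 2", OF _ this]
    have "((\<lambda>k. lsech x k ^ 2) has_sum (lsech x 0 ^ 2 + 2 * (4 * (sigma_series (x ^ 2) - 4
        * sigma_series (x ^ 4))))) UNIV"
      by simp
    then show ?thesis by (intro infsumI) (simp add: lsech_def)
  qed
  show ?thesis unfolding sech_series_square[OF x] 1 2 by (simp add: algebra_simps)
qed

text \<open>
  This is the recursion \<open>\<sigma>(2n) = 3 \<sigma>(n) - 2 \<sigma>(n/2)\<close> of the sum of divisors. With
  \<open>g(y) = y / (1 - y)^2\<close>, the terms with odd exponent use \<open>g(y) + g(-y) = 4 g(y^2)\<close>.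
\<close>

lemma sigma_series_minus:
  assumes x: "x \<noteq> 0" "norm x < 1"
  shows "sigma_series x + sigma_series (- x) = 6 * sigma_series (x ^ 2) - 4 * sigma_series (x ^ 4)"
proof -
  note U = has_sum_sigma_series(2)
  define g where "g y = y / (1 - y) ^ 2" for y :: complex
  have x2: "x ^ 2 \<noteq> 0" "norm (x ^ 2) < 1" and x4: "x ^ 4 \<noteq> 0" "norm (x ^ 4) < 1" and mx: "- x \<noteq> 0"
      "norm (- x) < 1"
    using unit_disc_power[OF x, of 2] unit_disc_power[OF x, of 4] x by auto
  have l: "((\<lambda>e. g (x ^ Suc e) + g ((- x) ^ Suc e)) has_sum (sigma_series x + sigma_series (- x))) UNIV"
    unfolding g_def by (intro has_sum_add U x mx)
  have r1: "((\<lambda>e. 4 * g ((x ^ 2) ^ Suc e)) has_sum (4 * sigma_series (x ^ 2))) UNIV"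
    unfolding g_def by (intro has_sum_cmult_right U x2)
  define t where "t e = 2 * g (x ^ Suc e) - 4 * g ((x ^ 2) ^ Suc e)" for e
  have "((\<lambda>e. 2 * g ((x ^ 2) ^ Suc e) - 4 * g ((x ^ 4) ^ Suc e))
      has_sum (2 * sigma_series (x ^ 2) - 4 * sigma_series (x ^ 4))) UNIV"
    unfolding g_def by (intro has_sum_cmult_right has_sum_diff U x2 x4)
  moreover have "2 * g ((x ^ 2) ^ Suc e) - 4 * g ((x ^ 4) ^ Suc e) = t (2 * e + 1)" for e
  proof -
    have "(x ^ 2) ^ Suc e = x ^ Suc (2 * e + 1)" "(x ^ 4) ^ Suc e = (x ^ 2) ^ Suc (2 * e + 1)"
      unfolding power_mult[symmetric] by (rule arg_cong[of _ _ "power x"], simp)+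
    then show ?thesis by (simp only: t_def)
  qed
  ultimately have t: "((\<lambda>e. t (2 * e + 1))
      has_sum (2 * sigma_series (x ^ 2) - 4 * sigma_series (x ^ 4))) UNIV"
    by (simp only:)
  have "(t has_sum (2 * sigma_series (x ^ 2) - 4 * sigma_series (x ^ 4))) {e. odd e}"
    by (rule iffD1[OF has_sum_reindex_bij_witness[where j = "\<lambda>i. 2 * i + 1" and i = "\<lambda>j. j div 2"] t]) auto
  then have r2: "((\<lambda>e. if odd e then t e else 0)
      has_sum (2 * sigma_series (x ^ 2) - 4 * sigma_series (x ^ 4))) UNIV"
    by (subst (asm) has_sum_cong_neutral[where T = UNIV and g = "\<lambda>e. if odd e then t e else 0"]) auto
  have "g (x ^ Suc e) + g ((- x) ^ Suc e) = 4 * g ((x ^ 2) ^ Suc e) + (if odd e then t e else 0)" for e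
  proof (cases "odd e")
    case True
    then have "(- x) ^ Suc e = x ^ Suc e" by simp
    with True show ?thesis by (simp add: t_def)
  next
    case False
    define y where "y = x ^ Suc e"
    have y: "1 - y \<noteq> 0" "1 + y \<noteq> 0"
    proof -
      have n: "norm y < 1" unfolding y_def by (rule norm_power_Suc_less_1[OF x(2)])
      then show "1 - y \<noteq> 0" using power_neq_one[of y 1] by auto
      show "1 + y \<noteq> 0" using n by (metis add_eq_0_iff norm_minus_cancel norm_one less_irrefl)
    qed
    have e: "1 - y ^ 2 = (1 - y) * (1 + y)" by (simp add: power2_eq_square algebra_simps)
    have "(- x) ^ Suc e = - y" "(x ^ 2) ^ Suc e = y ^ 2"
      using False unfolding y_def power_mult[symmetric] by (simp_all add: mult.commute)
    moreover have "g y + g (- y) = 4 * g (y ^ 2)"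
    proof -
      have "g y + g (- y) = (y * (1 + y) ^ 2 - y * (1 - y) ^ 2) / ((1 - y)^2 * (1 + y)^2)"
        unfolding g_def using y by (simp add: diff_divide_distrib)
      also have "y * (1 + y) ^ 2 - y * (1 - y) ^ 2 = 4 * y ^ 2"
          by (simp add: power2_eq_square algebra_simps)
      finally show ?thesis by (simp add: g_def e power_mult_distrib)
    qed
    ultimately show ?thesis using False by (simp add: y_def)
  qed
  then have "((\<lambda>e. g (x ^ Suc e) + g ((- x) ^ Suc e))
      has_sum (4 * sigma_series (x ^ 2) + (2 * sigma_series (x ^ 2) - 4 * sigma_series (x ^ 4)))) UNIV"
    using has_sum_add[OF r1 r2] by (simp only:)
  from has_sum_unique[OF l this] show ?thesis by simp
qed

text \<open>
  All series \<open>sigma_series\<close> cancel once \<open>sigma_series_minus\<close> has removed the negative arguments.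
\<close>

lemma sech_series_functional_equation:
  assumes x: "x \<noteq> 0" "norm x < 1"
  shows "sech_series x ^ 2 + sech_series (- x) ^ 2
      = 4 * sech_series (x ^ 2) ^ 2 - 2 * sech_series (- (x ^ 2)) ^ 2"
proof -
  have x2: "x ^ 2 \<noteq> 0" "norm (x ^ 2) < 1" and mx: "- x \<noteq> 0" "norm (- x) < 1" and mx2: "- (x ^ 2) \<noteq> 0"
      "norm (- (x ^ 2)) < 1"
    using unit_disc_power[OF x, of 2] x by auto
  have p: "(x ^ 2) ^ 2 = x ^ 4" "(x ^ 2) ^ 4 = x ^ 8" "(- x) ^ 4 = x ^ 4" "(- (x ^ 2)) ^ 4 = x ^ 8"
      by (simp_all flip: power_mult)
  show ?thesis
    using sigma_series_minus[OF x] sigma_series_minus[OF x2]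
    unfolding sech_series_square_sigma[OF x] sech_series_square_sigma[OF mx]
        sech_series_square_sigma[OF x2] sech_series_square_sigma[OF mx2] p
    by algebra
qed

lemma sech_series_lambert:
  assumes x: "x \<noteq> 0" "norm x < 1"
  shows "((\<lambda>(k, j). of_int (chi_4_2 (int (Suc j))) * x ^ (Suc k * Suc j))
      has_sum ((sech_series x - 1) / 4)) (UNIV \<times> UNIV)"
proof -
  have chi: "norm (of_int (chi_4_2 k) :: complex) \<le> 1" for k by (simp add: chi_4_2_def)
  have "(\<lambda>(k, j). 1 * of_int (chi_4_2 (int (Suc j))) * x ^ (Suc k * Suc j)) summable_on UNIV \<times> UNIV"
    by (rule lambert_summable[OF x chi summable_weight[OF x(2)]]) simp
  then obtain S where S: "((\<lambda>(k, j). of_int (chi_4_2 (int (Suc j))) * x ^ (Suc k * Suc j))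
      has_sum S) (UNIV \<times> UNIV)"
    by (auto simp: summable_on_def)
  have "((\<lambda>k. x ^ Suc k / (1 + (x ^ Suc k) ^ 2)) has_sum S) UNIV"
  proof (rule has_sum_SigmaD[OF S])
    fix k
    show "((\<lambda>j. case (k, j) of (k, j) \<Rightarrow> of_int (chi_4_2 (int (Suc j))) * x ^ (Suc k * Suc j))
        has_sum (x ^ Suc k / (1 + (x ^ Suc k) ^ 2))) UNIV"
      using chi_has_sum[OF norm_power_Suc_less_1[OF x(2)]] by (simp only: prod.case power_mult)
  qed
  from has_sum_cmult_right[OF this, of 2]
  have "((\<lambda>k. lsech x (int (Suc k))) has_sum (2 * S)) UNIV"
    unfolding lsech_lcsch_ltanh_rational(1)[OF x] power_int_of_nat times_divide_eq_right .
  from even_has_sum_int[of "lsech x", OF _ this]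
  have "(lsech x has_sum (lsech x 0 + 2 * (2 * S))) UNIV" by simp
  from has_sum_unique[OF has_sum_sech_series[OF x] this] have "sech_series x = 1 + 4 * S"
    by (simp add: lsech_def)
  then show ?thesis using S by simp
qed

text \<open>
  For \<open>n > 0\<close> the coefficient of \<open>x^n\<close> is four times the sum of \<open>\<chi>(d)\<close> over the divisors \<open>d\<close> of \<open>n\<close>;
  only the first two coefficients matter.
\<close>

lemma sech_series_power_series:
  obtains a where "power_series_of a sech_series" "a 0 = 1" "a 1 = 4"
proof -
  define r where "r n = (\<Sum>\<^sub>\<infinity>p\<in>{p \<in> UNIV \<times> UNIV. Suc (fst p) * Suc (snd p)
      = n}. of_int (chi_4_2 (int (Suc (snd p)))) :: complex)" for n
  have r: "power_series_of r (\<lambda>x. (sech_series x - 1) / 4)"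
    unfolding r_def using sech_series_lambert
        by (intro power_series_of_collect) (simp add: case_prod_unfold)
  have "power_series_of (\<lambda>n. (if n = 0 then 1 else 0) + 4 * r n) sech_series"
    by (rule power_series_of_cong[OF power_series_of_add[OF power_series_of_one
        power_series_of_cmult[OF r, of 4]]]) (simp add: diff_divide_distrib)
  moreover have "r 0 = 0" unfolding r_def by simp
  moreover have "r 1 = 1"
  proof -
    have "{p \<in> UNIV \<times> UNIV. Suc (fst p) * Suc (snd p) = 1} = {(0, 0)}" by auto
    then show ?thesis unfolding r_def by (simp only:) (simp add: chi_4_2_def)
  qed
  ultimately show thesis by (intro that[of "\<lambda>n. (if n = 0 then 1 else 0) + 4 * r n"]) auto
qed

lemma phi_square_power_series:
  obtains b where "power_series_of b (\<lambda>x. phi x ^ 2)" "b 0 = 1" "b 1 = 4"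
proof -
  define b where "b n = (\<Sum>\<^sub>\<infinity>p\<in>{p \<in> UNIV \<times> UNIV. nat (fst p ^ 2 + snd p ^ 2) = n}. 1 :: complex)" for n
  have "power_series_of b (\<lambda>x. phi x ^ 2)"
    unfolding b_def
  proof (rule power_series_of_collect)
    fix x :: complex assume x: "x \<noteq> 0" "norm x < 1"
    have "x powi (m ^ 2) * x powi (n ^ 2) = 1 * x ^ nat (m ^ 2 + n ^ 2)" for m n
    proof -
      have "x powi (m ^ 2) * x powi (n ^ 2) = x powi (m ^ 2 + n ^ 2)"
        by (rule power_int_add[symmetric]) (use x in simp)
      also have "\<dots> = x ^ nat (m ^ 2 + n ^ 2)" by (rule power_int_nonneg_exp) simp
      finally show ?thesis by simp
    qed
    then show "((\<lambda>p. 1 * x ^ nat ((fst p)\<^sup>2 + (snd p)\<^sup>2)) has_sum (phi x)\<^sup>2) (UNIV \<times> UNIV)"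
      using has_sum_times_complex[OF has_sum_phi[OF x] has_sum_phi[OF x]]
      by (simp add: case_prod_unfold power2_eq_square[of "phi x"])
  qed
  moreover have "b 0 = 1"
  proof -
    have "p = (0, 0)" if "nat (fst p ^ 2 + snd p ^ 2) = 0" for p :: "int \<times> int"
      using that by (cases p) (simp add: sum_power2_le_zero_iff)
    then have "{p \<in> UNIV \<times> UNIV. nat (fst p ^ 2 + snd p ^ 2) = 0} = {(0, 0) :: int \<times> int}" by auto
    then show ?thesis unfolding b_def by (simp only:) simp
  qed
  moreover have "b 1 = 4"
  proof -
    have "p \<in> {(1, 0), (-1, 0), (0, 1), (0, -1)}" if "nat (fst p ^ 2 + snd p ^ 2) = 1" for p :: "int \<times> int"
    proof -
      obtain m n where p: "p = (m, n)" by (cases p)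
      have e: "m ^ 2 + n ^ 2 = 1" using that by (simp add: p)
      have "m ^ 2 \<le> 1 ^ 2" "n ^ 2 \<le> 1 ^ 2"
        using e zero_le_power2[of m] zero_le_power2[of n] unfolding one_power2 by linarith+
      then have "\<bar>m\<bar> \<le> 1" "\<bar>n\<bar> \<le> 1"
        using power2_le_iff_abs_le[of 1 m] power2_le_iff_abs_le[of 1 n] by simp_all
      then have "m \<in> {-1, 0, 1}" "n \<in> {-1, 0, 1}" by auto
      then show ?thesis using e by (auto simp: p)
    qed
    then have "{p \<in> UNIV \<times> UNIV. nat (fst p ^ 2 + snd p ^ 2) = 1}
        = {(1, 0), (-1, 0), (0, 1), (0, -1 :: int)}" by auto
    then show ?thesis unfolding b_def by (simp only:) simp
  qed
  ultimately show thesis by (rule that)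
qed

lemma phi_square_minus:
  assumes x: "x \<noteq> 0" "norm x < 1"
  shows "phi (- x) ^ 2 = phi (x ^ 2) ^ 2 - 4 * x * psi (x ^ 4) ^ 2"
  using phi_square[of "- x"] x by simp

text \<open>Jacobi's theorem on sums of two squares, in the form of generating functions.\<close>

lemma sech_series_eq_phi_square:
  assumes x: "x \<noteq> 0" "norm x < 1"
  shows "sech_series x = phi x ^ 2"
proof -
  obtain a where a: "power_series_of a sech_series" "a 0 = 1" "a 1 = 4" by (rule sech_series_power_series)
  obtain b where b: "power_series_of b (\<lambda>x. phi x ^ 2)" "b 0 = 1" "b 1 = 4"
      by (rule phi_square_power_series)
  have "a = b"
  proof (rule functional_equations_determine_series[OF a b])
    fix x :: complex assume x: "x \<noteq> 0" "norm x < 1"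
    show "sech_series x + sech_series (- x) = 2 * sech_series (x ^ 2)"
      unfolding sech_series_split[OF x] sech_series_minus[OF x] by simp
    show "sech_series x ^ 2 + sech_series (- x) ^ 2
        = 4 * sech_series (x ^ 2) ^ 2 - 2 * sech_series (- (x ^ 2)) ^ 2"
      by (rule sech_series_functional_equation[OF x])
    show sum: "phi x ^ 2 + phi (- x) ^ 2 = 2 * phi (x ^ 2) ^ 2"
      unfolding phi_square[OF x] phi_square_minus[OF x] by simp
    have "phi x ^ 2 * phi (- x) ^ 2 = (phi (- (x ^ 2)) ^ 2) ^ 2"
      unfolding phi_times_phi_minus[OF x, symmetric] by (simp add: power_mult_distrib)
    then show "(phi x ^ 2) ^ 2 + (phi (- x) ^ 2) ^ 2
        = 4 * (phi (x ^ 2) ^ 2) ^ 2 - 2 * (phi (- (x ^ 2)) ^ 2) ^ 2"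
      using sum by algebra
  qed
  then show ?thesis
    using has_sum_unique power_series_ofD[OF a(1) x] power_series_ofD[OF b(1) x] by blast
qed

section \<open>Odd squares twisted by the character modulo 4\<close>

definition weighted_sech :: "complex \<Rightarrow> complex" where
  "weighted_sech x = (\<Sum>\<^sub>\<infinity>n. of_int (2 * n + 1) ^ 2 * lsech x (2 * n + 1))"

text \<open>
  By the two squares theorem and \<open>phi_square\<close>, the odd part of the series is \<open>4 x \<psi>(x^4)^2\<close> and the
  even part is \<open>\<phi>(x^2)^2\<close>.
\<close>

lemma weighted_sech_theta:
  assumes x: "x \<noteq> 0" "norm x < 1"
  shows "weighted_sech x = 4 * x * psi (x ^ 4) ^ 2 * phi (x ^ 2) ^ 4"
proof -
  have "sech_odd x = 4 * x * psi (x ^ 4) ^ 2"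
    using sech_series_split[OF x] phi_square[OF x] unit_disc_power[OF x, of 2] x
    by (simp add: sech_series_eq_phi_square)
  then show ?thesis
    unfolding weighted_sech_def sech_odd_square_weights[OF x]
    using unit_disc_power[OF x, of 2] by (simp add: sech_series_eq_phi_square flip: power_mult)
qed

text \<open>
  The sum of \<open>d^2 \<chi>(N/d)\<close> over the odd divisors \<open>d\<close> of \<open>N\<close>. It is indexed by the pairs of
  predecessors of \<open>d\<close> and \<open>N/d\<close> because it arises by collecting the terms of a double series over
  the natural numbers.
\<close>

definition odd_square_coeff :: "nat \<Rightarrow> complex" where
  "odd_square_coeff N = (\<Sum>\<^sub>\<infinity>p\<in>{p \<in> UNIV \<times> UNIV. Suc (fst p) * Suc (snd p) = N}.
     (if even (fst p) then of_nat (Suc (fst p)) ^ 2 else 0) * of_int (chi_4_2 (int (Suc (snd p)))))"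

lemma weighted_sech_power_series: "power_series_of odd_square_coeff (\<lambda>x. weighted_sech x / 4)"
  unfolding odd_square_coeff_def
proof (rule power_series_of_collect)
  fix x :: complex assume x: "x \<noteq> 0" "norm x < 1"
  define w :: "nat \<Rightarrow> complex" where "w k = (if even k then of_nat (Suc k) ^ 2 else 0)" for k
  have chi: "norm (of_int (chi_4_2 k) :: complex) \<le> 1" for k by (simp add: chi_4_2_def)
  have "norm (w k) \<le> 1 + real (Suc k) ^ 2" for k by (simp add: w_def norm_power del: of_nat_Suc)
  then have "(\<lambda>(k, j). w k * of_int (chi_4_2 (int (Suc j))) * x ^ (Suc k * Suc j)) summable_on UNIV \<times> UNIV"
    by (intro lambert_summable x chi summable_weight)
  then obtain S where S: "((\<lambda>(k, j). w k * of_int (chi_4_2 (int (Suc j))) * x ^ (Suc k * Suc j))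
      has_sum S) (UNIV \<times> UNIV)"
    by (auto simp: summable_on_def)
  have "((\<lambda>k. w k * (x ^ Suc k / (1 + (x ^ Suc k) ^ 2))) has_sum S) UNIV"
  proof (rule has_sum_SigmaD[OF S])
    fix k
    have "((\<lambda>j. w k * (of_int (chi_4_2 (int (Suc j))) * (x ^ Suc k) ^ Suc j))
        has_sum (w k * (x ^ Suc k / (1 + (x ^ Suc k) ^ 2)))) UNIV"
      by (intro has_sum_cmult_right chi_has_sum norm_power_Suc_less_1 x)
    then show "((\<lambda>j. case (k, j) of (k, j) \<Rightarrow> w k * of_int (chi_4_2 (int (Suc j))) * x ^ (Suc k
        * Suc j)) has_sum (w k * (x ^ Suc k / (1 + (x ^ Suc k) ^ 2)))) UNIV"
      by (simp only: prod.case power_mult mult.assoc)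
  qed
  from has_sum_cmult_right[OF this, of 2]
  have "((\<lambda>k. w k * lsech x (int (Suc k))) has_sum (2 * S)) UNIV"
    unfolding lsech_lcsch_ltanh_rational(1)[OF x] power_int_of_nat by (simp add: mult_ac)
  then have "((\<lambda>k. w k * lsech x (int (Suc k))) has_sum (2 * S)) {k. even k}"
    by (subst (asm) has_sum_cong_neutral[where T = "{k. even k}" and g
        = "\<lambda>k. w k * lsech x (int (Suc k))"]) (auto simp: w_def)
  then have 1: "((\<lambda>n. w (2 * n) * lsech x (int (Suc (2 * n)))) has_sum (2 * S)) UNIV"
    by (rule iffD2[OF has_sum_reindex_bij_witness[where j = "\<lambda>n. 2 * n" and i
        = "\<lambda>k. k div 2"], rotated -1]) auto
  define F where "F n = of_int (2 * n + 1) ^ 2 * lsech x (2 * n + 1)" for n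
  have reflect: "F (- int (Suc n)) = F (int n)" for n
  proof -
    have "2 * - int (Suc n) + 1 = - (2 * int n + 1)" by simp
    then show ?thesis unfolding F_def by (simp only: lsech_minus of_int_minus power2_minus)
  qed
  have F: "F (int n) = w (2 * n) * lsech x (int (Suc (2 * n)))" for n
  proof -
    have "2 * int n + 1 = int (Suc (2 * n))" by simp
    then show ?thesis unfolding F_def w_def by (simp only: of_int_of_nat_eq) simp
  qed
  have "(F has_sum (2 * S + 2 * S)) UNIV"
    by (rule has_sum_int_split) (use 1 in \<open>simp_all only: reflect F\<close>)
  then have "weighted_sech x = 4 * S" unfolding weighted_sech_def F_def by (intro infsumI) simp
  then have "weighted_sech x / 4 = S" by simp
  then show "((\<lambda>p. (if even (fst p) then of_nat (Suc (fst p)) ^ 2 else 0)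
      * of_int (chi_4_2 (int (Suc (snd p)))) * x ^ (Suc (fst p) * Suc (snd p)))
      has_sum (weighted_sech x / 4)) (UNIV \<times> UNIV)"
    using S by (simp only: case_prod_unfold w_def)
qed

text \<open>If \<open>de \<equiv> 1 (mod 4)\<close> then \<open>d\<close> and \<open>e\<close> are odd and congruent modulo 4.\<close>

lemma odd_square_coeff_sigma:
  assumes N: "N mod 4 = 1"
  shows "odd_square_coeff N = of_int (sigma_char 2 chi_4_2 N)"
proof -
  define g :: "nat \<Rightarrow> nat \<Rightarrow> complex" where "g d e
      = (if odd d then of_nat d ^ 2 else 0) * of_int (chi_4_2 (int e))" for d e
  have N0: "N > 0" using N by (cases N) auto
  have "odd_square_coeff N = (\<Sum>\<^sub>\<infinity>d\<in>{d. d dvd N}. g d (N div d))"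
    unfolding odd_square_coeff_def
  proof (rule infsum_reindex_bij_witness[where j = "\<lambda>p. Suc (fst p)" and i
      = "\<lambda>d. (d - 1, N div d - 1)"], goal_cases)
    case (1 p)
    then have "N div Suc (fst p) = Suc (snd p)"
      using nonzero_mult_div_cancel_left[of "Suc (fst p)" "Suc (snd p)"] by (auto simp del: mult_Suc)
    then show ?case by (cases p) simp
  next
    case (2 p) then show ?case by (auto intro: dvdI[of _ _ "Suc (snd p)"] simp del: mult_Suc)
  next
    case (3 d) then show ?case using N0 by (auto elim: dvd_pos_nat)
  next
    case (4 d)
    then have "d > 0" "N div d > 0" using N0
        by (auto elim: dvd_pos_nat simp: div_greater_zero_iff dvd_imp_le)
    then have "Suc (d - 1) = d" "Suc (N div d - 1) = N div d" by simp_all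
    then show ?case using 4 by (simp only: mem_Collect_eq mem_Times_iff UNIV_I fst_conv snd_conv
        simp_thms dvd_mult_div_cancel)
  next
    case (5 p)
    then have "N div Suc (fst p) = Suc (snd p)"
      using nonzero_mult_div_cancel_left[of "Suc (fst p)" "Suc (snd p)"] by (auto simp del: mult_Suc)
    then show ?case by (simp add: g_def)
  qed
  also have "\<dots> = (\<Sum>d | d dvd N. g d (N div d))" using N0 by (intro infsum_finite) simp
  also have "\<dots> = (\<Sum>d | d dvd N. of_int (chi_4_2 (int d) * int d ^ 2))"
  proof (intro sum.cong refl)
    fix d assume "d \<in> {d. d dvd N}"
    then obtain e where e: "N = d * e" by auto
    have "d > 0" using e N0 by (cases d) auto
    have "d mod 4 * (e mod 4) mod 4 = 1" using N e by (metis mod_mult_eq)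
    moreover have "d mod 4 = 0 \<or> d mod 4 = 1 \<or> d mod 4 = 2 \<or> d mod 4 = 3" "e mod 4 = 0 \<or> e mod 4
        = 1 \<or> e mod 4 = 2 \<or> e mod 4 = 3" by presburger+
    ultimately have de: "d mod 4 = 1 \<and> e mod 4 = 1 \<or> d mod 4 = 3 \<and> e mod 4 = 3" by auto
    then have "int d mod 4 = 1 \<and> int e mod 4 = 1 \<or> int d mod 4 = 3 \<and> int e mod 4 = 3"
      using zmod_int[of d 4] zmod_int[of e 4] by auto
    then have "chi_4_2 (int e) = chi_4_2 (int d)" by (auto simp: chi_4_2_def)
    moreover have "odd d" using de by presburger
    ultimately show "g d (N div d) = of_int (chi_4_2 (int d) * int d ^ 2)"
      using e \<open>d > 0\<close> by (simp add: g_def)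
  qed
  also have "\<dots> = of_int (sigma_char 2 chi_4_2 N)" by (simp add: sigma_char_def)
  finally show ?thesis .
qed

text \<open>
  The combination on the left retains the exponents \<open>\<equiv> 1 (mod 4)\<close> of an odd power series. In the
  closed form of the series this replaces \<open>\<phi>(x^2)^4\<close> by the mean of \<open>Y^2\<close> and \<open>Z^2\<close> for
  \<open>Y = \<phi>(x^2)^2\<close> and \<open>Z = \<phi>(-x^2)^2\<close>. The mean equals \<open>Y Z\<close> plus half the square of
  \<open>Y - Z = 8 x^2 \<psi>(x^8)^2\<close>: the first summand gives the Euler product and the second one the pairs
  of cores.
\<close>

lemma weighted_sech_filtered:
  assumes x: "x \<noteq> 0" "norm x < 1"
  shows "(weighted_sech x - \<i> * weighted_sech (\<i> * x)) / 8 =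
    x * euler_prod (x ^ 4) ^ 6 + 32 * (x ^ 5 * (psi (x ^ 4) * psi (x ^ 8) ^ 2) ^ 2)"
proof -
  have x2: "x ^ 2 \<noteq> 0" "norm (x ^ 2) < 1" and ix: "\<i> * x \<noteq> 0" "norm (\<i> * x) < 1"
    using unit_disc_power[OF x, of 2] x by (auto simp: norm_mult)
  have p: "(x ^ 2) ^ 2 = x ^ 4" "(x ^ 2) ^ 4 = x ^ 8" by (simp_all flip: power_mult)
  have "(\<i> * x) ^ 4 = ((\<i> * x) ^ 2) ^ 2" by (simp flip: power_mult)
  then have ip: "(\<i> * x) ^ 2 = - (x ^ 2)" "(\<i> * x) ^ 4 = x ^ 4" by (simp_all add: power_mult_distrib p)
  define P R Y Z where "P = phi (x ^ 4) ^ 2" and "R = psi (x ^ 8) ^ 2" and "Y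
      = phi (x ^ 2) ^ 2" and "Z = phi (- (x ^ 2)) ^ 2"
  have Y: "Y = P + 4 * x ^ 2 * R" and Z: "Z = P - 4 * x ^ 2 * R"
    using phi_square[OF x2] phi_square_minus[OF x2] by (simp_all add: p P_def R_def Y_def Z_def)
  have YZ: "Y * Z = phi (- (x ^ 4)) ^ 4"
  proof -
    have "Y * Z = (phi (x ^ 2) * phi (- (x ^ 2))) ^ 2" by (simp add: Y_def Z_def power_mult_distrib)
    also have "\<dots> = phi (- (x ^ 4)) ^ 4" unfolding phi_times_phi_minus[OF x2] p by (simp flip: power_mult)
    finally show ?thesis .
  qed
  have E: "euler_prod (x ^ 4) ^ 6 = psi (x ^ 4) ^ 2 * phi (- (x ^ 4)) ^ 4"
    using euler_prod_power6[OF x2] by (simp add: p)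
  have "phi (x ^ 2) ^ 4 = Y ^ 2" "phi (- (x ^ 2)) ^ 4 = Z ^ 2"
      by (simp_all add: Y_def Z_def flip: power_mult)
  then have "(weighted_sech x - \<i> * weighted_sech (\<i> * x)) / 8
      = x * psi (x ^ 4) ^ 2 * ((Y ^ 2 + Z ^ 2) / 2)"
    unfolding weighted_sech_theta[OF x] weighted_sech_theta[OF ix] ip by (simp add: algebra_simps)
  also have "(Y ^ 2 + Z ^ 2) / 2 = Y * Z + 32 * x ^ 4 * R ^ 2"
    unfolding Y Z by (simp add: power2_eq_square power4_eq_xxxx algebra_simps add_divide_distrib)
  also have "x * psi (x ^ 4) ^ 2 * (Y * Z + 32 * x ^ 4 * R ^ 2)
      = x * euler_prod (x ^ 4) ^ 6 + 32 * (x ^ 5 * (psi (x ^ 4) * psi (x ^ 8) ^ 2) ^ 2)"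
    unfolding YZ E by (simp add: R_def power_mult_distrib algebra_simps eval_nat_numeral)
  finally show ?thesis .
qed

section \<open>Comparison of coefficients\<close>

lemma core_pair_count:
  "card {p \<in> {xs. is_partition xs \<and> is_core t xs} \<times> {xs. is_partition xs
      \<and> is_core t xs}. sum_list (fst p) + sum_list (snd p) = n}
    = core_tuple_count t 2 n"
  unfolding core_tuple_count_def
proof (rule bij_betw_same_card[of "\<lambda>(xs, ys). [xs, ys]"], rule bij_betwI')
  fix ls assume "ls \<in> {ls. is_partition_tuple 2 n ls \<and> (\<forall>xs\<in>set ls. is_core t xs)}"
  then show "\<exists>p\<in>{p \<in> {xs. is_partition xs \<and> is_core t xs} \<times> {xs. is_partition xs
      \<and> is_core t xs}. sum_list (fst p) + sum_list (snd p) = n}.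
      ls = (case p of (xs, ys) \<Rightarrow> [xs, ys])"
    by (auto simp: is_partition_tuple_def length_Suc_conv numeral_2_eq_2)
qed (auto simp: is_partition_tuple_def)

lemma core_pair_power_series:
  "power_series_of (\<lambda>N. of_nat (card {p \<in> {xs. is_partition xs \<and> is_core 4 xs} \<times> {xs. is_partition xs
      \<and> is_core 4 xs}.
      4 * (sum_list (fst p) + sum_list (snd p)) + 5
          = N})) (\<lambda>x. x ^ 5 * (psi (x ^ 4) * psi (x ^ 8) ^ 2) ^ 2)"
    (is "power_series_of (\<lambda>N. of_nat (card {p \<in> ?C \<times> ?C. ?e p = N})) ?F")
proof -
  have "power_series_of (\<lambda>N. \<Sum>\<^sub>\<infinity>p\<in>{p \<in> ?C \<times> ?C. ?e p = N}. 1) ?F"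
  proof (rule power_series_of_collect)
    fix x :: complex assume x: "x \<noteq> 0" "norm x < 1"
    have "(x ^ 4) ^ 2 = x ^ 8" by (simp flip: power_mult)
    then have G: "((\<lambda>xs. (x ^ 4) ^ sum_list xs) has_sum (psi (x ^ 4) * psi (x ^ 8) ^ 2)) ?C"
      using four_core_generating_function[of "x ^ 4"] unit_disc_power[OF x, of 4] by simp
    have "((\<lambda>p. x ^ 5 * (case p of (xs, ys) \<Rightarrow> (x ^ 4) ^ sum_list xs * (x ^ 4) ^ sum_list ys)) has_sum
        (x ^ 5 * (psi (x ^ 4) * psi (x ^ 8) ^ 2 * (psi (x ^ 4) * psi (x ^ 8) ^ 2)))) (?C \<times> ?C)"
      by (intro has_sum_cmult_right has_sum_times_complex G)
    moreover have "x ^ 5 * (case p of (xs, ys) \<Rightarrow> (x ^ 4) ^ sum_list xs * (x ^ 4) ^ sum_list ys)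
        = 1 * x ^ ?e p" for p
      by (cases p) (simp only: prod.case fst_conv snd_conv power_mult[symmetric] power_add[symmetric]
          mult_1,
        rule arg_cong[of _ _ "power x"], simp)
    ultimately show "((\<lambda>p. 1 * x ^ ?e p) has_sum ?F x) (?C \<times> ?C)"
      by (simp only: power2_eq_square[of "psi (x ^ 4) * psi (x ^ 8) ^ 2"])
  qed
  moreover have "(\<Sum>\<^sub>\<infinity>p\<in>S. 1) = (of_nat (card S) :: complex)" for S :: "(nat list \<times> nat list) set"
    by (rule infsum_one)
  ultimately show ?thesis by (simp only:)
qed

text \<open>
  Every point of the punctured disc is the nome of a point of the upper half plane, found by the
  principal logarithm.
\<close>

lemma eta_power_series:
  fixes a :: "nat \<Rightarrow> complex"
  assumes "\<And>\<tau>. Im \<tau> > 0 \<Longrightarrow> ((\<lambda>m. a m * nome \<tau> ^ m) has_sum dedekind_eta (4 * \<tau>) ^ 6) {1..}"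
  shows "power_series_of (\<lambda>m. if m = 0 then 0 else a m) (\<lambda>x. x * euler_prod (x ^ 4) ^ 6)"
  unfolding power_series_of_def
proof safe
  fix x :: complex assume x: "x \<noteq> 0" "norm x < 1"
  define \<tau> where "\<tau> = Ln x / (2 * of_real pi * \<i>)"
  have t: "2 * of_real pi * \<i> * \<tau> = Ln x" by (simp add: \<tau>_def)
  have nome: "nome \<tau> = x" using x by (simp add: nome_def t)
  have "Im \<tau> = - ln (norm x) / (2 * pi)"
    using x by (simp add: \<tau>_def Im_divide power2_eq_square)
  then have "Im \<tau> > 0" using x by (simp add: divide_neg_pos)
  from assms[OF this] have s: "((\<lambda>m. a m * x ^ m) has_sum dedekind_eta (4 * \<tau>) ^ 6) {1..}"
      by (simp only: nome)
  have power: "nome u ^ k = nome (of_nat k * u)" for u k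
    unfolding nome_def exp_of_nat_mult[symmetric] by (simp add: mult_ac)
  have "nome (4 * \<tau>) = nome \<tau> ^ 4" "nome (4 * \<tau> / 24) ^ 6 = nome \<tau>" unfolding power by simp_all
  then have "dedekind_eta (4 * \<tau>) ^ 6 = x * euler_prod (x ^ 4) ^ 6"
    by (simp only: dedekind_eta_def power_mult_distrib euler_prod_def nome)
  with s show "((\<lambda>m. (if m = 0 then 0 else a m) * x ^ m) has_sum (x * euler_prod (x ^ 4) ^ 6)) UNIV"
    by (subst has_sum_cong_neutral[where T = "{1..}" and g = "\<lambda>m. a m * x ^ m"]) auto
qed

theorem theorem4p1:
  fixes a :: "nat \<Rightarrow> complex" and n :: nat
  assumes "\<And>\<tau>. Im \<tau> > 0 \<Longrightarrow>
    ((\<lambda>m. a m * nome \<tau> ^ m) has_sum dedekind_eta (4 * \<tau>) ^ 6) {1..}"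
  shows "of_nat (core_tuple_count 4 2 n) =
    1 / 32 * (of_int (sigma_char 2 chi_4_2 (4 * n + 5)) - a (4 * n + 5))"
proof -
  let ?C = "{xs. is_partition xs \<and> is_core 4 xs}"
  define A where "A N = card {p \<in> ?C \<times> ?C. 4 * (sum_list (fst p) + sum_list (snd p)) + 5 = N}" for N
  define F where "F x = (weighted_sech x - \<i> * weighted_sech (\<i> * x)) / 8" for x
  have "power_series_of (\<lambda>m. (if m = 0 then 0 else a m) + 32 * of_nat (A m)) F"
    unfolding A_def
    by (rule power_series_of_cong[OF power_series_of_add[OF eta_power_series[OF assms]
        power_series_of_cmult[OF core_pair_power_series, of 32]]])
       (simp_all add: F_def weighted_sech_filtered)
  moreover have "power_series_of (\<lambda>m. odd_square_coeff m * (1 - \<i> * \<i> ^ m) / 2) F"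
    unfolding power_series_of_def
  proof safe
    fix x :: complex assume x: "x \<noteq> 0" "norm x < 1"
    have ix: "\<i> * x \<noteq> 0" "norm (\<i> * x) < 1" using x by (auto simp: norm_mult)
    note S = power_series_ofD[OF weighted_sech_power_series]
    have "((\<lambda>m. 1 / 2 * (odd_square_coeff m * x ^ m - \<i> * (odd_square_coeff m * (\<i> * x) ^ m))) has_sum
        (1 / 2 * (weighted_sech x / 4 - \<i> * (weighted_sech (\<i> * x) / 4)))) UNIV"
      by (intro has_sum_cmult_right has_sum_diff S x ix)
    then show "((\<lambda>m. odd_square_coeff m * (1 - \<i> * \<i> ^ m) / 2 * x ^ m) has_sum F x) UNIV"
      by (simp add: F_def power_mult_distrib algebra_simps diff_divide_distrib)
  qed
  ultimately have eq: "(\<lambda>m. (if m = 0 then 0 else a m) + 32 * of_nat (A m))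
      = (\<lambda>m. odd_square_coeff m * (1 - \<i> * \<i> ^ m) / 2)"
    by (rule power_series_of_unique)
  \<comment> \<open>at exponents congruent to 1 modulo 4 the filter \<open>(1 - \<i> * \<i> ^ m) / 2\<close> is 1\<close>
  have "\<i> ^ 5 = \<i>" by (simp add: eval_nat_numeral)
  then have i: "\<i> ^ (4 * n + 5) = \<i>" by (simp add: power_add power_mult)
  have "A (4 * n + 5) = core_tuple_count 4 2 n"
    unfolding A_def core_pair_count[symmetric] by (rule arg_cong[of _ _ card]) auto
  moreover have "odd_square_coeff (4 * n + 5) = of_int (sigma_char 2 chi_4_2 (4 * n + 5))"
    by (rule odd_square_coeff_sigma) presburger
  ultimately have "a (4 * n + 5) + 32 * of_nat (core_tuple_count 4 2 n)
      = of_int (sigma_char 2 chi_4_2 (4 * n + 5))"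
    using fun_cong[OF eq, of "4 * n + 5"] by (simp only: i) simp
  then show ?thesis by (simp add: field_simps)
qed

end
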